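(* Let $G_{v_0}$ be a forest with integer weights on all vertices except one unweighted vertex $v_0$, let $G=G_{v_0}\setminus\{v_0\}$, let $n\in\mathbb Z$ be such that $G_{v_0}(n)$ is negative definite, with corresponding Seifert framing $r=\Sigma^2$, and let $G_{v_0}(n)_{u_0}$ be $G_{v_0}(n)$ together with a new unweighted vertex $u_0$ adjacent only to $v_0$. Then the map $\mathrm{hocolim}\,\Phi$ extends to an isomorphism between $\mathbb{CFKI}^\natural(G_{v_0}(n)_{u_0})$ and $\mathbb{XKI}_{r}(\mathbb{CFKI}^\natural(G_{v_0}))$; that is, it gives isomorphisms of doubly filtered simplicial sets for every $\mathrm{Spin}^c$ structure on $Y_{G_{v_0}(n)}$ which commute with the involutions $\mathfrak I$ and $\mathfrak J$ on both sides.
   Context: **Plumbings.** For a weighted forest $H$, $X_H$ is the plumbing 4-manifold and $Y_H=\partial X_H$; vertices are identified with classes in $H_2(X_H;\mathbb Z)$. $G_{v_0}(n)$ is $G_{v_0}$ with $v_0$ given weight $n$. $\mathrm{Char}(H)\subset H^2(X_H;\mathbb Z)$ is the set of characteristic classes; classes $S\in H_2(X_H,Y_H;\mathbb Z)$ act by $k+S:=k+2PD[S]$. Orbits of $\mathrm{Char}(H)$ under $H_2(X_H;\mathbb Z)$ correspond to $\mathrm{Spin}^c(Y_H)$; $\mathrm{Char}(H,\mathfrak t)$ is the orbit of $\mathfrak t$; conjugation $\bar{\mathfrak t}$ corresponds to $k\mapsto -k$. An unweighted vertex $v_0$ attached to $H$ defines a class in $H_2(X_H,Y_H;\mathbb Z)$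 (boundary connected sum of disk fibers over the vertices adjacent to $v_0$), with boundary a knot $K\subset Y_H$; it acts on $\mathrm{Char}(H)$ by $k+v_0=k+2PD[v_0]$, taking $\mathrm{Char}(H,\mathfrak t)$ to $\mathrm{Char}(H,\mathfrak t+[K])$. **Knot lattice simplicial sets.** For $H$ negative definite, the cube $[k,E]$ ($k\in\mathrm{Char}(H,\mathfrak t)$, $E$ a set of vertices of $H$) is the convex hull of $\{k+\sum_{v\in I}v: I\subseteq E\}$; $h_U(k)=\frac{k^2+|V(H)|}{4}$, $h_U([k,E])$ is the minimum over the vertices of the cube. $D_{H,\mathfrak t}$ is the category of these cubes with a morphism from each cube to each of its faces. $\mathbb{CF}^\natural(H,\mathfrak t)$ is the homotopy colimit over $D_{H,\mathfrak t}$ of the diagram $\mathbb{CFD}$ of single points of height $h_U([k,E])$. Given an unweighted vertex $v_0$ attached to $H$ (forming $H_{v_0}$), $h_V([k,E])=h_U([k+v_0,E])$, and $\mathbb{CFK}^\natural(H_{v_0},\mathfrak t)$ is the homotopy colimit over $D_{H,\mathfrak t}$ of points of double height $(h_U,h_V)$. Homotopy colimits use the Bousfield–Kan (simplicial bar) formula. The flip map $\Gamma$ is induced by $[k,E]\mapsto[k+v_0,E]$; the involution $\mathfrak I\colon\mathbb{CF}^\natural(H,\mathfrak t)\to\mathbb{CF}^\natural(H,\bar{\mathfrak t})$ by $[k,E]\mapsto[-k-\sum_{v\in E}v,E]$ (preserving $h_U$); the involution $\mathfrak J\colon\mathbb{CFK}^\natural(H_{v_0},\mathfrak t)\to\mathbb{CFK}^\natural(H_{v_0},\overline{\mathfrak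 t+[K]})$ by $[k,E]\mapsto[-k-v_0-\sum_{v\in E}v,E]$ (exchanging $h_U$ and $h_V$). Thus $\mathfrak I\mathfrak J=\Gamma$. $\mathbb{CFKI}^\natural(H_{v_0})$ is the collection of all $\mathbb{CFK}^\natural(H_{v_0},\mathfrak t)$ with $\mathfrak I$ and $\mathfrak J$ (strict involutions, all higher homotopy data degenerate). **Surgery indexing.** $K=K_{G_{v_0}}\subset Y_G$. $\Sigma_0\in H_2(X_G;\mathbb Q)$ is the class with $\Sigma_0\cdot v=v_0\cdot v$ for all vertices $v$ of $G$; $\Sigma=v_0-\Sigma_0$, $r=\Sigma^2=n-\Sigma_0^2<0$. For $L\in\mathrm{Char}(G_{v_0}(n))$ let $\hat A(L)=\frac{L(\Sigma)+r}{2}$. $\mathcal A$ is the set of pairs $(\mathfrak t,i)$ for which some $L\in\mathrm{Char}(G_{v_0}(n))$ has $L|_G\in\mathrm{Char}(G,\mathfrak t)$, $\hat A(L)=i$. $\mathrm{Spin}^c(Y_{G_{v_0}(n)})$ is $\mathcal A$ modulo $(\mathfrak t,i)\sim(\mathfrak t+[K],i+r)$, with classes $[\mathfrak t,i]$; the dual knot $\mu$ acts by $[\mathfrak t,i]+[\mu]=[\mathfrak t,i+1]$, and $\overline{[\mathfrak t,i]}=[\bar{\mathfrak t},r-i]$. $\mathcal I_{[\mathfrak t,i]}$ has objects $(\mathfrak t',i',a),(\mathfrak t',i',b)$, $(\mathfrak t',i')$ in the class $[\mathfrak t,i]$, and non-identity morphisms $\lambda_{\mathfrak t',i'}\colon(\mathfrak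 t',i',a)\to(\mathfrak t',i',b)$, $\rho_{\mathfrak t',i'}\colon(\mathfrak t',i',a)\to(\mathfrak t'+[K],i'+r,b)$. **The surgery functor on strictly involutive input.** A (doubly) filtered simplicial set is a simplicial set with a (pair of) height function(s) on simplices such that faces have height at least that of the simplex. For heights $(h_1,h_2)$, $p_{j,!}X$ remembers only $h_j$; $A_i^*X$ has height $\min\{h_1,h_2+2i\}$; $[q]$ adds $q$ to the height; $\eta_1\colon A_i^*X\to p_{1,!}X$, $\eta_2\colon A_i^*X\to p_{2,!}X[2i]$ are the identity on underlying simplicial sets. $\mathrm{gr}_r(i)=\frac{(2i-r)^2+r}{4r}$. Let $X=\mathbb{CFKI}^\natural(G_{v_0})$, $X^{\mathfrak t}=\mathbb{CFK}^\natural(G_{v_0},\mathfrak t)$. The diagram $\mathbb{XD}_r^{[\mathfrak t,i]}(X)$ on $\mathcal I_{[\mathfrak t,i]}$ sends $(\mathfrak t',i',a)\mapsto A_{i'}^*(X^{\mathfrak t'})[\mathrm{gr}_r(i')]$, $(\mathfrak t',i',b)\mapsto p_{1,!}(X^{\mathfrak t'})[\mathrm{gr}_r(i')]$, $\lambda\mapsto\eta_1$, $\rho\mapsto\Gamma\circ\eta_2$. $\mathbb{XKD}_r^{[\mathfrak t,i]}(X)$ has the same underlying simplicial sets and maps, with first height at $(\mathfrak t',i',\cdot)$ that of $\mathbb{XD}_r^{[\mathfrak t,i]}(X)$ at $(\mathfrak t',i',\cdot)$ and second height that of $\mathbb{XD}_r^{[\mathfrak t,i+1]}(X)$ at $(\mathfrak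 t',i'+1,\cdot)$. The doubly filtered simplicial set of $\mathbb{XKI}_r(X)$ in $\mathrm{Spin}^c$ structure $[\mathfrak t,i]$ is $\mathrm{hocolim}\,\mathbb{XKD}_r^{[\mathfrak t,i]}(X)$. Its flip map $\tilde\Gamma$ from $[\mathfrak t,i]$ to $[\mathfrak t,i+1]$ is induced by the index shift $(\mathfrak t',i',\cdot)\mapsto(\mathfrak t',i'+1,\cdot)$ and identities of underlying simplicial sets. Its involution $\mathfrak I$ from $[\mathfrak t,i]$ to $\overline{[\mathfrak t,i]}$ is induced by the index maps $(\mathfrak t',i',a)\mapsto(\overline{\mathfrak t'+[K]},-i',a)$ and $(\mathfrak t',i',b)\mapsto(\bar{\mathfrak t}',r-i',b)$ (which exchange $\lambda_{\mathfrak t',i'}$ with $\rho_{\overline{\mathfrak t'+[K]},-i'}$), covered by $\mathfrak J$ of $X$ at $a$-objects and $\mathfrak I$ of $X$ at $b$-objects. Its involution $\mathfrak J$ is $\mathfrak I\circ\tilde\Gamma$. **The map $\mathrm{hocolim}\,\Phi$.** Let $\mathbb{TB}^{[\mathfrak t,i]}$ be the diagram on $\mathcal I_{[\mathfrak t,i]}$ whose value at $(\mathfrak t',i',b)$ (resp. $(\mathfrak t',i',a)$) is the homotopy colimit of $\mathbb{CFD}$ over the cubes $[L,E]$ of $D_{G_{v_0}(n),[\mathfrak t,i]}$ with $v_0\notin E$ (resp. $v_0\in E$), $L|_G\in\mathrm{Char}(G,\mathfrak t')$, $\hat A(L)=i'$, with $\lambda,\rho$ induced by $[L,E\cup\{v_0\}]\mapsto[L,E]$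 and $[L,E\cup\{v_0\}]\mapsto[L+v_0,E]$; its homotopy colimit is $\mathbb{CF}^\natural(G_{v_0}(n),[\mathfrak t,i])$. $\Phi\colon\mathbb{TB}^{[\mathfrak t,i]}\to\mathbb{XD}_r^{[\mathfrak t,i]}(X)$ is the natural isomorphism induced by $[L,E]\mapsto[L|_G,E]$ at $b$-objects and $[L,E\cup\{v_0\}]\mapsto[L|_G,E]$ at $a$-objects. *)

theory Defs
  imports Complex_Main "HOL-Library.FuncSet" "HOL-Library.Product_Order"
begin

section \<open>Filtered simplicial sets\<close>

text \<open>
  A simplicial set is a contravariant functor on the simplex category: \<open>cells X n\<close> is the set of
  \<open>n\<close>-simplices, and \<open>act X m n \<phi>\<close> is the operator from \<open>n\<close>-simplices to \<open>m\<close>-simplices given by a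
  monotone \<open>\<phi> : [m] \<rightarrow> [n]\<close>. The type of heights is \<open>rat\<close> for a filtered simplicial set and
  \<open>rat \<times> rat\<close>, which carries the componentwise order, for a doubly filtered one.
\<close>

definition Delta :: "nat \<Rightarrow> nat \<Rightarrow> (nat \<Rightarrow> nat) set" where
  "Delta m n = {\<phi> \<in> {..m} \<rightarrow>\<^sub>E {..n}. mono_on {..m} \<phi>}"

record ('x, 'h) fsset =
  cells :: "nat \<Rightarrow> 'x set"
  act :: "nat \<Rightarrow> nat \<Rightarrow> (nat \<Rightarrow> nat) \<Rightarrow> 'x \<Rightarrow> 'x"
  ht :: "nat \<Rightarrow> 'x \<Rightarrow> 'h"

text \<open>
  The height condition is imposed for all simplicial operators, so that the simplices of height at
  least \<open>h\<close> are closed under degeneracies as well as faces.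
\<close>

definition is_fsset :: "('x, 'h::order) fsset \<Rightarrow> bool" where
  "is_fsset X \<longleftrightarrow>
     (\<forall>m n. \<forall>\<phi>\<in>Delta m n. \<forall>x\<in>cells X n.
        act X m n \<phi> x \<in> cells X m \<and> ht X n x \<le> ht X m (act X m n \<phi> x)) \<and>
     (\<forall>n. \<forall>x\<in>cells X n. act X n n (restrict id {..n}) x = x) \<and>
     (\<forall>l m n. \<forall>\<psi>\<in>Delta l m. \<forall>\<phi>\<in>Delta m n. \<forall>x\<in>cells X n.
        act X l m \<psi> (act X m n \<phi> x) = act X l n (compose {..l} \<phi> \<psi>) x)"

definition fsset_iso ::
  "('x, 'h::order) fsset \<Rightarrow> ('y, 'h) fsset \<Rightarrow> (nat \<Rightarrow> 'x \<Rightarrow> 'y) \<Rightarrow> bool" where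
  "fsset_iso X Y f \<longleftrightarrow> is_fsset X \<and> is_fsset Y \<and>
     (\<forall>n. bij_betw (f n) (cells X n) (cells Y n)) \<and>
     (\<forall>m n. \<forall>\<phi>\<in>Delta m n. \<forall>x\<in>cells X n. f m (act X m n \<phi> x) = act Y m n \<phi> (f n x)) \<and>
     (\<forall>n. \<forall>x\<in>cells X n. ht Y n (f n x) = ht X n x)"

definition point :: "'h \<Rightarrow> (unit, 'h) fsset" where
  "point h = \<lparr>cells = (\<lambda>n. {()}), act = (\<lambda>m n \<phi> x. ()), ht = (\<lambda>n x. h)\<rparr>"

definition reheight :: "(nat \<Rightarrow> 'x \<Rightarrow> 'h2) \<Rightarrow> ('x, 'h1) fsset \<Rightarrow> ('x, 'h2) fsset" where
  "reheight h X = \<lparr>cells = cells X, act = act X, ht = h\<rparr>"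

definition p1 :: "('x, rat \<times> rat) fsset \<Rightarrow> ('x, rat) fsset" where
  "p1 X = reheight (\<lambda>n x. fst (ht X n x)) X"

definition Astar :: "rat \<Rightarrow> ('x, rat \<times> rat) fsset \<Rightarrow> ('x, rat) fsset" where
  "Astar i X = reheight (\<lambda>n x. min (fst (ht X n x)) (snd (ht X n x) + 2 * i)) X"

definition raise :: "rat \<Rightarrow> ('x, rat) fsset \<Rightarrow> ('x, rat) fsset" where
  "raise q X = reheight (\<lambda>n x. ht X n x + q) X"


section \<open>Categories, diagrams and homotopy colimits\<close>

text \<open>\<open>cmp C f g\<close> is the composite in diagrammatic order: first \<open>f\<close>, then \<open>g\<close>.\<close>

record ('o, 'm) cat =
  Ob :: "'o set"
  Arr :: "'m set"
  src :: "'m \<Rightarrow> 'o"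
  tgt :: "'m \<Rightarrow> 'o"
  idn :: "'o \<Rightarrow> 'm"
  cmp :: "'m \<Rightarrow> 'm \<Rightarrow> 'm"

definition full_sub :: "('o, 'm) cat \<Rightarrow> ('o \<Rightarrow> bool) \<Rightarrow> ('o, 'm) cat" where
  "full_sub C P = C\<lparr>Ob := {x \<in> Ob C. P x}, Arr := {f \<in> Arr C. P (src C f) \<and> P (tgt C f)}\<rparr>"

record ('o, 'm, 'x, 'h) diagram =
  dob :: "'o \<Rightarrow> ('x, 'h) fsset"
  dmor :: "'m \<Rightarrow> nat \<Rightarrow> 'x \<Rightarrow> 'x"

text \<open>
  A chain \<open>d\<^sub>0 \<rightarrow> \<dots> \<rightarrow> d\<^sub>n\<close> in \<open>C\<close> is stored as the functor \<open>[n] \<rightarrow> C\<close> it defines: \<open>\<sigma> i j\<close> is the arrow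
  \<open>d\<^sub>i \<rightarrow> d\<^sub>j\<close> for \<open>i \<le> j \<le> n\<close>, and \<open>\<sigma>\<close> is \<open>undefined\<close> elsewhere so that equal chains are equal
  functions.
\<close>

type_synonym 'm chain = "nat \<Rightarrow> nat \<Rightarrow> 'm"

definition tab :: "nat \<Rightarrow> (nat \<Rightarrow> nat \<Rightarrow> 'm) \<Rightarrow> 'm chain" where
  "tab n s = (\<lambda>i j. if i \<le> j \<and> j \<le> n then s i j else undefined)"

definition vtx :: "('o, 'm) cat \<Rightarrow> 'm chain \<Rightarrow> nat \<Rightarrow> 'o" where
  "vtx C \<sigma> i = src C (\<sigma> i i)"

definition chains :: "('o, 'm) cat \<Rightarrow> nat \<Rightarrow> 'm chain set" where
  "chains C n = {\<sigma>. tab n \<sigma> = \<sigma> \<and>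
     (\<forall>i\<le>n. vtx C \<sigma> i \<in> Ob C \<and> \<sigma> i i = idn C (vtx C \<sigma> i)) \<and>
     (\<forall>i j. i \<le> j \<and> j \<le> n \<longrightarrow>
        \<sigma> i j \<in> Arr C \<and> src C (\<sigma> i j) = vtx C \<sigma> i \<and> tgt C (\<sigma> i j) = vtx C \<sigma> j) \<and>
     (\<forall>i j k. i \<le> j \<and> j \<le> k \<and> k \<le> n \<longrightarrow> \<sigma> i k = cmp C (\<sigma> i j) (\<sigma> j k))}"

text \<open>
  Bousfield--Kan formula (diagonal of the simplicial bar construction): an \<open>n\<close>-simplex is a chain
  \<open>d\<^sub>0 \<rightarrow> \<dots> \<rightarrow> d\<^sub>n\<close> together with an \<open>n\<close>-simplex of the value at \<open>d\<^sub>0\<close>, whose height it inherits. An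
  operator that moves the initial vertex to \<open>d\<^sub>j\<close> also pushes the simplex forward along
  \<open>d\<^sub>0 \<rightarrow> d\<^sub>j\<close>.
\<close>

definition hocolim ::
  "('o, 'm) cat \<Rightarrow> ('o, 'm, 'x, 'h) diagram \<Rightarrow> ('m chain \<times> 'x, 'h) fsset" where
  "hocolim C F = \<lparr>
     cells = (\<lambda>n. {(\<sigma>, x). \<sigma> \<in> chains C n \<and> x \<in> cells (dob F (vtx C \<sigma> 0)) n}),
     act = (\<lambda>m n \<phi> (\<sigma>, x).
       (tab m (\<lambda>i j. \<sigma> (\<phi> i) (\<phi> j)),
        dmor F (\<sigma> 0 (\<phi> 0)) m (act (dob F (vtx C \<sigma> 0)) m n \<phi> x))),
     ht = (\<lambda>n (\<sigma>, x). ht (dob F (vtx C \<sigma> 0)) n x)\<rparr>"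

text \<open>
  The map of homotopy colimits out of a \<open>C\<close>-diagram induced by a functor with arrow map \<open>T\<close> and a
  natural family \<open>\<eta> d\<close> of maps covering it.
\<close>

definition hocolim_map ::
  "('o, 'm) cat \<Rightarrow> ('m \<Rightarrow> 'm2) \<Rightarrow> ('o \<Rightarrow> nat \<Rightarrow> 'x \<Rightarrow> 'y) \<Rightarrow>
   nat \<Rightarrow> 'm chain \<times> 'x \<Rightarrow> 'm2 chain \<times> 'y" where
  "hocolim_map C T \<eta> n = (\<lambda>(\<sigma>, x). (tab n (\<lambda>i j. T (\<sigma> i j)), \<eta> (vtx C \<sigma> 0) n x))"


section \<open>Plumbing forests and their lattices\<close>

text \<open>Unweighted vertices are those on which \<open>wt\<close> is \<open>None\<close>.\<close>

record 'v wgraph =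
  verts :: "'v set"
  edges :: "'v set set"
  wt :: "'v \<Rightarrow> int option"

definition is_cycle :: "'v wgraph \<Rightarrow> 'v list \<Rightarrow> bool" where
  "is_cycle H p \<longleftrightarrow> length p \<ge> 3 \<and> distinct p \<and>
     (\<forall>i. Suc i < length p \<longrightarrow> {p ! i, p ! Suc i} \<in> edges H) \<and> {last p, hd p} \<in> edges H"

definition forest :: "'v wgraph \<Rightarrow> bool" where
  "forest H \<longleftrightarrow> finite (verts H) \<and> (\<forall>e\<in>edges H. e \<subseteq> verts H \<and> card e = 2) \<and> (\<nexists>p. is_cycle H p)"

definition del_vertex :: "'v wgraph \<Rightarrow> 'v \<Rightarrow> 'v wgraph" where
  "del_vertex H v =
     \<lparr>verts = verts H - {v}, edges = {e \<in> edges H. v \<notin> e}, wt = (wt H)(v := None)\<rparr>"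

definition give_weight :: "'v wgraph \<Rightarrow> 'v \<Rightarrow> int \<Rightarrow> 'v wgraph" where
  "give_weight H v n = H\<lparr>wt := (wt H)(v \<mapsto> n)\<rparr>"

text \<open>\<open>attach H v u\<close> adds a new unweighted vertex \<open>u\<close> adjacent only to \<open>v\<close>.\<close>

definition attach :: "'v wgraph \<Rightarrow> 'v \<Rightarrow> 'v \<Rightarrow> 'v wgraph" where
  "attach H v u = \<lparr>verts = insert u (verts H), edges = insert {v, u} (edges H), wt = wt H\<rparr>"

definition dot :: "'v wgraph \<Rightarrow> 'v \<Rightarrow> 'v \<Rightarrow> int" where
  "dot H v w = (if v = w then the (wt H v) else if {v, w} \<in> edges H then 1 else 0)"

text \<open>
  For \<open>H\<close> with all vertices weighted, the group \<open>H\<^sub>2(X\<^sub>H; R)\<close> is free on the vertices, so its elements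
  are coefficient functions on \<open>verts H\<close>. As \<open>X\<^sub>H\<close> is simply connected,
  \<open>H\<^sup>2(X\<^sub>H; \<int>) = Hom(H\<^sub>2(X\<^sub>H; \<int>), \<int>)\<close>; a class is the function of its values on the vertices, set to \<open>0\<close>
  off \<open>verts H\<close>.
\<close>

definition qform :: "'v wgraph \<Rightarrow> ('v \<Rightarrow> 'a::comm_ring_1) \<Rightarrow> ('v \<Rightarrow> 'a) \<Rightarrow> 'a" where
  "qform H x y = (\<Sum>v\<in>verts H. \<Sum>w\<in>verts H. x v * y w * of_int (dot H v w))"

definition neg_def :: "'v wgraph \<Rightarrow> bool" where
  "neg_def H \<longleftrightarrow> (\<forall>x :: 'v \<Rightarrow> int. (\<exists>v\<in>verts H. x v \<noteq> 0) \<longrightarrow> qform H x x < 0)"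

definition pairing :: "'v wgraph \<Rightarrow> ('v \<Rightarrow> int) \<Rightarrow> ('v \<Rightarrow> 'a::comm_ring_1) \<Rightarrow> 'a" where
  "pairing H k x = (\<Sum>v\<in>verts H. of_int (k v) * x v)"

definition Char :: "'v wgraph \<Rightarrow> ('v \<Rightarrow> int) set" where
  "Char H = {k. (\<forall>v. v \<notin> verts H \<longrightarrow> k v = 0) \<and>
                (\<forall>x :: 'v \<Rightarrow> int. even (pairing H k x - qform H x x))}"

text \<open>
  \<open>PD H x\<close> is the Poincare dual, in \<open>H\<^sup>2\<close> of the plumbing on the weighted vertices of \<open>H\<close>, of the
  combination \<open>\<Sum>v. x v * v\<close>; here \<open>v\<close> may also be an unweighted vertex, which is then a class
  relative to the boundary and pairs with a weighted vertex by adjacency.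
\<close>

definition PD :: "'v wgraph \<Rightarrow> ('v \<Rightarrow> int) \<Rightarrow> 'v \<Rightarrow> int" where
  "PD H x = (\<lambda>w. if w \<in> dom (wt H) then \<Sum>v\<in>verts H. x v * dot H v w else 0)"

definition plus_class :: "'v wgraph \<Rightarrow> ('v \<Rightarrow> int) \<Rightarrow> ('v \<Rightarrow> int) \<Rightarrow> 'v \<Rightarrow> int" where
  "plus_class H k x = (\<lambda>w. k w + 2 * PD H x w)"

text \<open>\<open>plus_verts H k I\<close> is \<open>k + (\<Sum>v\<in>I. v)\<close>.\<close>

definition plus_verts :: "'v wgraph \<Rightarrow> ('v \<Rightarrow> int) \<Rightarrow> 'v set \<Rightarrow> 'v \<Rightarrow> int" where
  "plus_verts H k I = plus_class H k (\<lambda>v. of_bool (v \<in> I))"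

definition neg :: "('v \<Rightarrow> int) \<Rightarrow> 'v \<Rightarrow> int" where
  "neg k = (\<lambda>w. - k w)"

text \<open>
  A \<open>Spin\<^sup>c\<close> structure \<open>t\<close> on the boundary is an orbit, so that \<open>Char(H, t)\<close> is \<open>t\<close> itself.
\<close>

definition orbit :: "'v wgraph \<Rightarrow> ('v \<Rightarrow> int) \<Rightarrow> ('v \<Rightarrow> int) set" where
  "orbit H k = range (plus_class H k)"

definition spinc :: "'v wgraph \<Rightarrow> ('v \<Rightarrow> int) set set" where
  "spinc H = orbit H ` Char H"

text \<open>The class in \<open>H\<^sub>2(X\<^sub>H; \<rat>)\<close> whose intersection number with each vertex \<open>w\<close> is \<open>f w\<close>.\<close>

definition rat_dual :: "'v wgraph \<Rightarrow> ('v \<Rightarrow> int) \<Rightarrow> 'v \<Rightarrow> rat" where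
  "rat_dual H f = (THE x. (\<forall>v. v \<notin> verts H \<longrightarrow> x v = 0) \<and>
     (\<forall>w\<in>verts H. (\<Sum>v\<in>verts H. x v * of_int (dot H v w)) = of_int (f w)))"

definition square :: "'v wgraph \<Rightarrow> ('v \<Rightarrow> int) \<Rightarrow> rat" where
  "square H k = pairing H k (rat_dual H k)"


section \<open>Knot lattice simplicial sets\<close>

text \<open>
  The cube \<open>[k, E]\<close> is the pair \<open>(k, E)\<close>; for negative definite \<open>H\<close> the convex hull determines the
  pair, and its faces are the \<open>[k + (\<Sum>v\<in>I. v), E']\<close> with \<open>I\<close>, \<open>E'\<close> disjoint subsets of \<open>E\<close>.
\<close>

type_synonym 'v cube = "('v \<Rightarrow> int) \<times> 'v set"

definition face_of :: "'v wgraph \<Rightarrow> 'v cube \<Rightarrow> 'v cube \<Rightarrow> bool" where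
  "face_of H c c' \<longleftrightarrow> (\<exists>I E'. I \<subseteq> snd c \<and> E' \<subseteq> snd c \<and> I \<inter> E' = {} \<and>
     c' = (plus_verts H (fst c) I, E'))"

definition cubes :: "'v wgraph \<Rightarrow> ('v \<Rightarrow> int) set \<Rightarrow> 'v cube set" where
  "cubes H t = {(k, E). k \<in> t \<and> E \<subseteq> verts H}"

definition cube_cat ::
  "'v wgraph \<Rightarrow> ('v \<Rightarrow> int) set \<Rightarrow> ('v cube, 'v cube \<times> 'v cube) cat" where
  "cube_cat H t = \<lparr>
     Ob = cubes H t,
     Arr = {(c, c'). c \<in> cubes H t \<and> c' \<in> cubes H t \<and> face_of H c c'},
     src = fst, tgt = snd, idn = (\<lambda>c. (c, c)), cmp = (\<lambda>f g. (fst f, snd g))\<rparr>"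

definition hU0 :: "'v wgraph \<Rightarrow> ('v \<Rightarrow> int) \<Rightarrow> rat" where
  "hU0 H k = (square H k + of_nat (card (verts H))) / 4"

definition hU :: "'v wgraph \<Rightarrow> 'v cube \<Rightarrow> rat" where
  "hU H c = Min ((\<lambda>I. hU0 H (plus_verts H (fst c) I)) ` Pow (snd c))"

text \<open>In \<open>hV\<close> and below, \<open>Hv\<close> is a graph with \<open>v\<close> its unweighted vertex, attached to \<open>Hv - v\<close>.\<close>

definition hV :: "'v wgraph \<Rightarrow> 'v \<Rightarrow> 'v cube \<Rightarrow> rat" where
  "hV Hv v c = hU (del_vertex Hv v) (plus_verts Hv (fst c) {v}, snd c)"

definition points :: "('o \<Rightarrow> 'h) \<Rightarrow> ('o, 'm, unit, 'h) diagram" where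
  "points h = \<lparr>dob = (\<lambda>c. point (h c)), dmor = (\<lambda>f n x. x)\<rparr>"

type_synonym 'v cube_simplex = "('v cube \<times> 'v cube) chain \<times> unit"

definition CF :: "'v wgraph \<Rightarrow> ('v \<Rightarrow> int) set \<Rightarrow> ('v cube_simplex, rat) fsset" where
  "CF H t = hocolim (cube_cat H t) (points (hU H))"

definition CFK ::
  "'v wgraph \<Rightarrow> 'v \<Rightarrow> ('v \<Rightarrow> int) set \<Rightarrow> ('v cube_simplex, rat \<times> rat) fsset" where
  "CFK Hv v t =
     hocolim (cube_cat (del_vertex Hv v) t) (points (\<lambda>c. (hU (del_vertex Hv v) c, hV Hv v c)))"

definition cube_map ::
  "'v wgraph \<Rightarrow> ('v \<Rightarrow> int) set \<Rightarrow> ('v cube \<Rightarrow> 'w cube) \<Rightarrow>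
   nat \<Rightarrow> 'v cube_simplex \<Rightarrow> 'w cube_simplex" where
  "cube_map H t f = hocolim_map (cube_cat H t) (map_prod f f) (\<lambda>c n x. x)"

text \<open>
  A family of doubly filtered simplicial sets \<open>cfk t\<close>, indexed by the set \<open>idx\<close> of \<open>Spin\<^sup>c\<close>
  structures with its conjugation and translation by the class of the knot, together with the maps
  \<open>flip t : cfk t \<rightarrow> cfk (t + [K])\<close>, \<open>invI t : cfk t \<rightarrow> cfk (conj t)\<close> and
  \<open>invJ t : cfk t \<rightarrow> cfk (conj (t + [K]))\<close> of underlying simplicial sets.
\<close>

record ('s, 'x) cfki =
  idx :: "'s set"
  conjg :: "'s \<Rightarrow> 's"
  addK :: "'s \<Rightarrow> 's"
  cfk :: "'s \<Rightarrow> ('x, rat \<times> rat) fsset"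
  flip :: "'s \<Rightarrow> nat \<Rightarrow> 'x \<Rightarrow> 'x"
  invI :: "'s \<Rightarrow> nat \<Rightarrow> 'x \<Rightarrow> 'x"
  invJ :: "'s \<Rightarrow> nat \<Rightarrow> 'x \<Rightarrow> 'x"

definition CFKI :: "'v wgraph \<Rightarrow> 'v \<Rightarrow> (('v \<Rightarrow> int) set, 'v cube_simplex) cfki" where
  "CFKI Hv v = (let H = del_vertex Hv v in \<lparr>
     idx = spinc H,
     conjg = image neg,
     addK = image (\<lambda>k. plus_verts Hv k {v}),
     cfk = CFK Hv v,
     flip = (\<lambda>t. cube_map H t (\<lambda>(k, E). (plus_verts Hv k {v}, E))),
     invI = (\<lambda>t. cube_map H t (\<lambda>(k, E). (neg (plus_verts H k E), E))),
     invJ = (\<lambda>t. cube_map H t (\<lambda>(k, E). (neg (plus_verts H (plus_verts Hv k {v}) E), E)))\<rparr>)"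

definition cfki_iso ::
  "('s, 'x) cfki \<Rightarrow> ('t, 'y) cfki \<Rightarrow> ('s \<Rightarrow> 't) \<Rightarrow> ('s \<Rightarrow> nat \<Rightarrow> 'x \<Rightarrow> 'y) \<Rightarrow> bool" where
  "cfki_iso P Q \<beta> f \<longleftrightarrow>
     bij_betw \<beta> (idx P) (idx Q) \<and>
     (\<forall>s\<in>idx P.
        \<beta> (conjg P s) = conjg Q (\<beta> s) \<and> \<beta> (addK P s) = addK Q (\<beta> s) \<and>
        fsset_iso (cfk P s) (cfk Q (\<beta> s)) (f s) \<and>
        (\<forall>n. \<forall>x\<in>cells (cfk P s) n.
           f (conjg P s) n (invI P s n x) = invI Q (\<beta> s) n (f s n x) \<and>
           f (conjg P (addK P s)) n (invJ P s n x) = invJ Q (\<beta> s) n (f s n x)))"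


section \<open>The surgery functor\<close>

text \<open>\<open>ObA t i\<close> and \<open>ObB t i\<close> are the objects \<open>(t, i, a)\<close> and \<open>(t, i, b)\<close>.\<close>

datatype 's surg_ob = ObA 's rat | ObB 's rat

datatype 's surg_arr = Idn "'s surg_ob" | Lam 's rat | Rho 's rat

fun surg_src :: "'s surg_arr \<Rightarrow> 's surg_ob" where
  "surg_src (Idn d) = d"
| "surg_src (Lam t i) = ObA t i"
| "surg_src (Rho t i) = ObA t i"

fun surg_tgt :: "('s \<Rightarrow> 's) \<Rightarrow> rat \<Rightarrow> 's surg_arr \<Rightarrow> 's surg_ob" where
  "surg_tgt K r (Idn d) = d"
| "surg_tgt K r (Lam t i) = ObB t i"
| "surg_tgt K r (Rho t i) = ObB (K t) (i + r)"

fun surg_cmp :: "'s surg_arr \<Rightarrow> 's surg_arr \<Rightarrow> 's surg_arr" where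
  "surg_cmp (Idn d) g = g"
| "surg_cmp f g = f"

text \<open>
  The index category of a class \<open>c\<close> of pairs \<open>(t, i)\<close>; \<open>K\<close> is translation of \<open>Spin\<^sup>c\<close> structures by
  the class of the knot. No arrow leaves a \<open>b\<close>-object except its identity, so composites always
  involve an identity.
\<close>

definition surg_cat ::
  "('s \<Rightarrow> 's) \<Rightarrow> rat \<Rightarrow> ('s \<times> rat) set \<Rightarrow> ('s surg_ob, 's surg_arr) cat" where
  "surg_cat K r c = (let obs = {ObA t i |t i. (t, i) \<in> c} \<union> {ObB t i |t i. (t, i) \<in> c} in \<lparr>
     Ob = obs,
     Arr = Idn ` obs \<union> {Lam t i |t i. (t, i) \<in> c} \<union> {Rho t i |t i. (t, i) \<in> c},
     src = surg_src, tgt = surg_tgt K r, idn = Idn, cmp = surg_cmp\<rparr>)"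

definition gr :: "rat \<Rightarrow> rat \<Rightarrow> rat" where
  "gr r i = ((2 * i - r)\<^sup>2 + r) / (4 * r)"

fun XD_ob :: "rat \<Rightarrow> ('s, 'x) cfki \<Rightarrow> 's surg_ob \<Rightarrow> ('x, rat) fsset" where
  "XD_ob r X (ObA t i) = raise (gr r i) (Astar i (cfk X t))"
| "XD_ob r X (ObB t i) = raise (gr r i) (p1 (cfk X t))"

text \<open>
  \<open>Lam\<close> acts by \<open>\<eta>\<^sub>1\<close> and \<open>Rho\<close> by \<open>\<Gamma> \<circ> \<eta>\<^sub>2\<close>, where \<open>\<eta>\<^sub>1\<close> and \<open>\<eta>\<^sub>2\<close> are the identity on simplices.
\<close>

fun XD_mor :: "('s, 'x) cfki \<Rightarrow> 's surg_arr \<Rightarrow> nat \<Rightarrow> 'x \<Rightarrow> 'x" where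
  "XD_mor X (Idn d) n x = x"
| "XD_mor X (Lam t i) n x = x"
| "XD_mor X (Rho t i) n x = flip X t n x"

definition XD :: "rat \<Rightarrow> ('s, 'x) cfki \<Rightarrow> ('s surg_ob, 's surg_arr, 'x, rat) diagram" where
  "XD r X = \<lparr>dob = XD_ob r X, dmor = XD_mor X\<rparr>"

fun succ_ob :: "'s surg_ob \<Rightarrow> 's surg_ob" where
  "succ_ob (ObA t i) = ObA t (i + 1)"
| "succ_ob (ObB t i) = ObB t (i + 1)"

fun succ_arr :: "'s surg_arr \<Rightarrow> 's surg_arr" where
  "succ_arr (Idn d) = Idn (succ_ob d)"
| "succ_arr (Lam t i) = Lam t (i + 1)"
| "succ_arr (Rho t i) = Rho t (i + 1)"

definition XKD ::
  "rat \<Rightarrow> ('s, 'x) cfki \<Rightarrow> ('s surg_ob, 's surg_arr, 'x, rat \<times> rat) diagram" where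
  "XKD r X = \<lparr>
     dob = (\<lambda>d. reheight (\<lambda>n x. (ht (XD_ob r X d) n x, ht (XD_ob r X (succ_ob d)) n x)) (XD_ob r X d)),
     dmor = XD_mor X\<rparr>"

fun inv_ob :: "rat \<Rightarrow> ('s, 'x) cfki \<Rightarrow> 's surg_ob \<Rightarrow> 's surg_ob" where
  "inv_ob r X (ObA t i) = ObA (conjg X (addK X t)) (- i)"
| "inv_ob r X (ObB t i) = ObB (conjg X t) (r - i)"

fun inv_arr :: "rat \<Rightarrow> ('s, 'x) cfki \<Rightarrow> 's surg_arr \<Rightarrow> 's surg_arr" where
  "inv_arr r X (Idn d) = Idn (inv_ob r X d)"
| "inv_arr r X (Lam t i) = Rho (conjg X (addK X t)) (- i)"
| "inv_arr r X (Rho t i) = Lam (conjg X (addK X t)) (- i)"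

fun inv_cover :: "('s, 'x) cfki \<Rightarrow> 's surg_ob \<Rightarrow> nat \<Rightarrow> 'x \<Rightarrow> 'x" where
  "inv_cover X (ObA t i) = invJ X t"
| "inv_cover X (ObB t i) = invI X t"

text \<open>The equivalence relation generated by \<open>(t, i) \<sim> (t + [K], i + r)\<close> on the set \<open>A\<close> of pairs.\<close>

definition surg_rel ::
  "('s \<Rightarrow> 's) \<Rightarrow> rat \<Rightarrow> ('s \<times> rat) set \<Rightarrow> (('s \<times> rat) \<times> ('s \<times> rat)) set" where
  "surg_rel K r A = (let S = {((t, i), (K t, i + r)) |t i. (t, i) \<in> A} in (S \<union> S\<inverse>)\<^sup>*)"

definition XKI ::
  "rat \<Rightarrow> ('s \<times> rat) set \<Rightarrow> ('s, 'x) cfki \<Rightarrow> (('s \<times> rat) set, 's surg_arr chain \<times> 'x) cfki" where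
  "XKI r A X = (let
     cat = surg_cat (addK X) r;
     cj = image (\<lambda>(t, i). (conjg X t, r - i));
     add\<mu> = image (\<lambda>(t, i). (t, i + 1));
     fl = (\<lambda>c. hocolim_map (cat c) succ_arr (\<lambda>d n x. x));
     iI = (\<lambda>c. hocolim_map (cat c) (inv_arr r X) (inv_cover X))
   in \<lparr>
     idx = A // surg_rel (addK X) r A,
     conjg = cj,
     addK = add\<mu>,
     cfk = (\<lambda>c. hocolim (cat c) (XKD r X)),
     flip = fl,
     invI = iI,
     invJ = (\<lambda>c n x. iI (add\<mu> c) n (fl c n x))\<rparr>)"


section \<open>Surgery on an unweighted vertex and the map hocolim \<open>\<Phi>\<close>\<close>

text \<open>
  Throughout, \<open>Gv\<close> is a forest with \<open>v\<close> as its only unweighted vertex, \<open>G = Gv - v\<close>, and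
  \<open>Gv(n) = give_weight Gv v n\<close>.
\<close>

definition Sigma_class :: "'v wgraph \<Rightarrow> 'v \<Rightarrow> 'v \<Rightarrow> rat" where
  "Sigma_class Gv v = (\<lambda>w. of_bool (w = v) - rat_dual (del_vertex Gv v) (dot Gv v) w)"

definition seifert_framing :: "'v wgraph \<Rightarrow> 'v \<Rightarrow> int \<Rightarrow> rat" where
  "seifert_framing Gv v n =
     qform (give_weight Gv v n) (Sigma_class Gv v) (Sigma_class Gv v)"

definition Ahat :: "'v wgraph \<Rightarrow> 'v \<Rightarrow> int \<Rightarrow> ('v \<Rightarrow> int) \<Rightarrow> rat" where
  "Ahat Gv v n L =
     (pairing (give_weight Gv v n) L (Sigma_class Gv v) + seifert_framing Gv v n) / 2"

definition restr :: "'v wgraph \<Rightarrow> ('v \<Rightarrow> int) \<Rightarrow> 'v \<Rightarrow> int" where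
  "restr G L = (\<lambda>w. if w \<in> verts G then L w else 0)"

definition surg_pairs :: "'v wgraph \<Rightarrow> 'v \<Rightarrow> int \<Rightarrow> (('v \<Rightarrow> int) set \<times> rat) set" where
  "surg_pairs Gv v n = {(t, i). t \<in> spinc (del_vertex Gv v) \<and>
     (\<exists>L\<in>Char (give_weight Gv v n). restr (del_vertex Gv v) L \<in> t \<and> Ahat Gv v n L = i)}"

text \<open>
  The identification of \<open>Spin\<^sup>c\<close> structures of the surgered manifold, as orbits in \<open>Char(Gv(n))\<close>, with
  classes of pairs \<open>(t, i)\<close>.
\<close>

definition spinc_class ::
  "'v wgraph \<Rightarrow> 'v \<Rightarrow> int \<Rightarrow> ('v \<Rightarrow> int) set \<Rightarrow> (('v \<Rightarrow> int) set \<times> rat) set" where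
  "spinc_class Gv v n s =
     (\<lambda>L. (orbit (del_vertex Gv v) (restr (del_vertex Gv v) L), Ahat Gv v n L)) ` s"

definition TB_index ::
  "'v wgraph \<Rightarrow> 'v \<Rightarrow> int \<Rightarrow> ('v \<Rightarrow> int) set \<Rightarrow>
   (('v \<Rightarrow> int) set surg_ob, ('v \<Rightarrow> int) set surg_arr) cat" where
  "TB_index Gv v n s =
     surg_cat (addK (CFKI Gv v)) (seifert_framing Gv v n) (spinc_class Gv v n s)"

fun in_block ::
  "'v wgraph \<Rightarrow> 'v \<Rightarrow> int \<Rightarrow> ('v \<Rightarrow> int) set surg_ob \<Rightarrow> 'v cube \<Rightarrow> bool" where
  "in_block Gv v n (ObA t i) (L, E) \<longleftrightarrow>
     v \<in> E \<and> restr (del_vertex Gv v) L \<in> t \<and> Ahat Gv v n L = i"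
| "in_block Gv v n (ObB t i) (L, E) \<longleftrightarrow>
     v \<notin> E \<and> restr (del_vertex Gv v) L \<in> t \<and> Ahat Gv v n L = i"

fun TB_cube ::
  "'v wgraph \<Rightarrow> 'v \<Rightarrow> int \<Rightarrow> ('v \<Rightarrow> int) set surg_arr \<Rightarrow> 'v cube \<Rightarrow> 'v cube" where
  "TB_cube Gv v n (Idn d) (L, E) = (L, E)"
| "TB_cube Gv v n (Lam t i) (L, E) = (L, E - {v})"
| "TB_cube Gv v n (Rho t i) (L, E) = (plus_verts (give_weight Gv v n) L {v}, E - {v})"

definition TB ::
  "'v wgraph \<Rightarrow> 'v \<Rightarrow> int \<Rightarrow> ('v \<Rightarrow> int) set \<Rightarrow>
   (('v \<Rightarrow> int) set surg_ob, ('v \<Rightarrow> int) set surg_arr, 'v cube_simplex, rat) diagram" where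
  "TB Gv v n s = (let Gn = give_weight Gv v n in \<lparr>
     dob = (\<lambda>d. hocolim (full_sub (cube_cat Gn s) (in_block Gv v n d)) (points (hU Gn))),
     dmor = (\<lambda>f. cube_map Gn s (TB_cube Gv v n f))\<rparr>)"

definition hocolim_TB ::
  "'v wgraph \<Rightarrow> 'v \<Rightarrow> int \<Rightarrow> ('v \<Rightarrow> int) set \<Rightarrow>
   (('v \<Rightarrow> int) set surg_arr chain \<times> 'v cube_simplex, rat) fsset" where
  "hocolim_TB Gv v n s = hocolim (TB_index Gv v n s) (TB Gv v n s)"

text \<open>
  The identification of the homotopy colimit of \<open>TB\<close> with the simplicial set of \<open>Gv(n)\<close>: a chain
  \<open>d\<^sub>0 \<rightarrow> \<dots> \<rightarrow> d\<^sub>m\<close> of indices and a chain \<open>c\<^sub>0 \<rightarrow> \<dots> \<rightarrow> c\<^sub>m\<close> of cubes in the block of \<open>d\<^sub>0\<close> give the chain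
  whose \<open>j\<close>-th cube is the image of \<open>c\<^sub>j\<close> under \<open>d\<^sub>0 \<rightarrow> d\<^sub>j\<close> (Thomason's map to the nerve of the
  Grothendieck construction).
\<close>

definition assemble ::
  "'v wgraph \<Rightarrow> 'v \<Rightarrow> int \<Rightarrow>
   nat \<Rightarrow> ('v \<Rightarrow> int) set surg_arr chain \<times> 'v cube_simplex \<Rightarrow> 'v cube_simplex" where
  "assemble Gv v n m = (\<lambda>(\<sigma>, (\<tau>, u)).
     (tab m (\<lambda>i j. (TB_cube Gv v n (\<sigma> 0 i) (fst (\<tau> i j)), TB_cube Gv v n (\<sigma> 0 j) (snd (\<tau> i j)))), u))"

text \<open>On \<open>b\<close>-objects \<open>v\<close> is not in \<open>E\<close>, so one formula serves for both kinds of objects.\<close>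

definition Phi ::
  "'v wgraph \<Rightarrow> 'v \<Rightarrow> int \<Rightarrow> ('v \<Rightarrow> int) set \<Rightarrow> ('v \<Rightarrow> int) set surg_ob \<Rightarrow>
   nat \<Rightarrow> 'v cube_simplex \<Rightarrow> 'v cube_simplex" where
  "Phi Gv v n s d =
     cube_map (give_weight Gv v n) s (\<lambda>(L, E). (restr (del_vertex Gv v) L, E - {v}))"

definition hocolim_Phi ::
  "'v wgraph \<Rightarrow> 'v \<Rightarrow> int \<Rightarrow> ('v \<Rightarrow> int) set \<Rightarrow>
   nat \<Rightarrow> ('v \<Rightarrow> int) set surg_arr chain \<times> 'v cube_simplex \<Rightarrow>
   ('v \<Rightarrow> int) set surg_arr chain \<times> 'v cube_simplex" where
  "hocolim_Phi Gv v n s = hocolim_map (TB_index Gv v n s) (\<lambda>f. f) (Phi Gv v n s)"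

end

theory Submission
  imports Defs
begin

text \<open>
  The class \<open>\<Sigma>\<close> is orthogonal to the vertices of \<open>G\<close> and \<open>\<Sigma>\<^sup>2 = r < 0\<close>. Hence a characteristic class \<open>L\<close>
  of \<open>Gv(n)\<close> is determined by the pair of its restriction to \<open>G\<close> and \<open>Ahat(L)\<close>, its square splits as
  \<open>L\<^sup>2 = (L|G)\<^sup>2 + L(\<Sigma>)\<^sup>2 / r\<close>, and adding \<open>v\<close> adds \<open>[K]\<close> and \<open>r\<close> to the two components. So a cube of
  \<open>Gv(n)\<close> amounts to an object of the index category with a cube of \<open>G\<close>, and \<open>gr\<close> accounts for the
  difference of heights. The index category is thin, so that a chain of cubes of \<open>Gv(n)\<close> determines
  its chain of indices, and pulling all its cubes back into the block of the first one inverts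
  Thomason's map. The resulting isomorphism is explicit on chains of cubes, where the involutions
  and the flip maps are compared cube by cube; the flip map of the dual knot adds \<open>2\<close> to \<open>L(v)\<close>,
  which fixes \<open>L|G\<close> and raises \<open>Ahat(L)\<close> by one.
\<close>


section \<open>Chains and simplicial sets\<close>

text \<open>A simplex of the homotopy colimit stores its cubes in the block of its initial index
  only, and the involutions change that block. An abstract inverse of Thomason's map would be hard
  to compare with them, so the inverse is written as a formula in the cubes alone,
  \<open>cut_simplex\<close>: a cube that has crossed to the far side of the initial cube in
  direction \<open>v\<close> is translated back by \<open>v\<close>, and the two sides are told
  apart by \<open>Ahat\<close>, whose values on them differ by \<open>r\<close>. The involution
  exchanges the two sides, and the extra \<open>v\<close> in \<open>invJ\<close> at a-objects is the
  translation that this exchange costs. The simplicial axioms are checked by hand only for chains of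
  cubes and then carried along explicit bijections, so the surgery diagrams are never shown to be
  functors separately. The second height is treated as the first height of a chain shifted by the
  dual knot: the shifted chain has the same cut and the successor index.\<close>

lemma tab_apply [simp]: "i \<le> j \<Longrightarrow> j \<le> n \<Longrightarrow> tab n s i j = s i j"
  by (simp add: tab_def)

lemma tab_eq_iff: "tab n s = tab n s' \<longleftrightarrow> (\<forall>i j. i \<le> j \<and> j \<le> n \<longrightarrow> s i j = s' i j)"
  by (auto simp: tab_def fun_eq_iff)

lemma tab_cong: "(\<And>i j. i \<le> j \<Longrightarrow> j \<le> n \<Longrightarrow> s i j = s' i j) \<Longrightarrow> tab n s = tab n s'"
  by (simp add: tab_eq_iff)

lemma tab_tab [simp]: "tab n (tab n s) = tab n s"
  by (simp add: tab_eq_iff)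

lemma Delta_le: "\<phi> \<in> Delta m n \<Longrightarrow> i \<le> m \<Longrightarrow> \<phi> i \<le> n"
  by (auto simp: Delta_def PiE_def Pi_def)

lemma Delta_mono: "\<phi> \<in> Delta m n \<Longrightarrow> i \<le> j \<Longrightarrow> j \<le> m \<Longrightarrow> \<phi> i \<le> \<phi> j"
  by (auto simp: Delta_def mono_on_def)

lemma restrict_id_Delta: "restrict id {..n} \<in> Delta n n"
  by (auto simp: Delta_def mono_on_def)

lemma compose_Delta: "\<psi> \<in> Delta l m \<Longrightarrow> \<phi> \<in> Delta m n \<Longrightarrow> compose {..l} \<phi> \<psi> \<in> Delta l n"
  using Delta_le[of \<psi> l m] Delta_mono[of \<psi> l m] Delta_le[of \<phi> m n] Delta_mono[of \<phi> m n]
  by (auto simp: Delta_def mono_on_def compose_def)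

lemma chains_tab: "\<sigma> \<in> chains C n \<Longrightarrow> tab n \<sigma> = \<sigma>"
  by (simp add: chains_def)

lemma chains_arr:
  assumes "\<sigma> \<in> chains C n" "i \<le> j" "j \<le> n"
  shows "\<sigma> i j \<in> Arr C" "src C (\<sigma> i j) = vtx C \<sigma> i" "tgt C (\<sigma> i j) = vtx C \<sigma> j"
  using assms unfolding chains_def by auto

lemma chains_ob:
  assumes "\<sigma> \<in> chains C n" "i \<le> n"
  shows "vtx C \<sigma> i \<in> Ob C" "\<sigma> i i = idn C (vtx C \<sigma> i)"
  using assms unfolding chains_def by auto

lemma chains_cmp:
  "\<sigma> \<in> chains C n \<Longrightarrow> i \<le> j \<Longrightarrow> j \<le> k \<Longrightarrow> k \<le> n \<Longrightarrow> cmp C (\<sigma> i j) (\<sigma> j k) = \<sigma> i k"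
  unfolding chains_def by auto

lemma vtx_tab [simp]: "i \<le> n \<Longrightarrow> vtx C (tab n s) i = src C (s i i)"
  by (simp add: vtx_def)

lemma chains_act:
  assumes "\<sigma> \<in> chains C n" "\<phi> \<in> Delta m n"
  shows "tab m (\<lambda>i j. \<sigma> (\<phi> i) (\<phi> j)) \<in> chains C m"
proof -
  have v: "vtx C (tab m (\<lambda>i j. \<sigma> (\<phi> i) (\<phi> j))) i = vtx C \<sigma> (\<phi> i)" if "i \<le> m" for i
    using that by (simp add: vtx_def)
  show ?thesis
    unfolding chains_def
    using chains_arr[OF assms(1)] chains_ob(1)[OF assms(1)] chains_ob(2)[OF assms(1), symmetric]
      chains_cmp[OF assms(1)] Delta_le[OF assms(2)] Delta_mono[OF assms(2)]
    by (simp add: v del: vtx_tab)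
qed

text \<open>Every simplex of \<open>Y\<close> is an image, so the axioms of \<open>X\<close> pass
  through \<open>f\<close>. This supplies the axioms for homotopy colimits over the surgery index
  category.\<close>

lemma fsset_iso_push:
  fixes X :: "('x, 'h::order) fsset"
  assumes X: "is_fsset X"
    and bij: "\<And>n. bij_betw (f n) (cells X n) (cells Y n)"
    and eqv: "\<And>m n \<phi> x. \<phi> \<in> Delta m n \<Longrightarrow> x \<in> cells X n \<Longrightarrow>
      f m (act X m n \<phi> x) = act Y m n \<phi> (f n x)"
    and hts: "\<And>n x. x \<in> cells X n \<Longrightarrow> ht Y n (f n x) = ht X n x"
  shows "fsset_iso X Y f"
proof -
  have im: "\<exists>x\<in>cells X n. y = f n x" if "y \<in> cells Y n" for n y
    using bij[of n] that by (auto simp: bij_betw_def)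
  have fin: "f n x \<in> cells Y n" if "x \<in> cells X n" for n x
    using bij[of n] that by (auto simp: bij_betw_def)
  have cl: "act X m n \<phi> x \<in> cells X m" "ht X n x \<le> ht X m (act X m n \<phi> x)"
    if "\<phi> \<in> Delta m n" "x \<in> cells X n" for m n \<phi> x
    using X that unfolding is_fsset_def by blast+
  have idl: "act X n n (restrict id {..n}) x = x" if "x \<in> cells X n" for n x
    using X that unfolding is_fsset_def by blast
  have cmpl: "act X l m \<psi> (act X m n \<phi> x) = act X l n (compose {..l} \<phi> \<psi>) x"
    if "\<psi> \<in> Delta l m" "\<phi> \<in> Delta m n" "x \<in> cells X n" for l m n \<phi> \<psi> x
    using X that unfolding is_fsset_def by blast
  have "is_fsset Y"
    unfolding is_fsset_def
  proof (intro conjI allI ballI)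
    fix m n \<phi> y assume \<phi>: "\<phi> \<in> Delta m n" and "y \<in> cells Y n"
    then obtain x where x: "x \<in> cells X n" "y = f n x" using im by blast
    then show "act Y m n \<phi> y \<in> cells Y m" "ht Y n y \<le> ht Y m (act Y m n \<phi> y)"
      using cl[OF \<phi> x(1)] by (simp_all add: eqv[OF \<phi>, symmetric] fin hts)
  next
    fix n y assume "y \<in> cells Y n"
    then obtain x where x: "x \<in> cells X n" "y = f n x" using im by blast
    then show "act Y n n (restrict id {..n}) y = y"
      using eqv[OF restrict_id_Delta x(1)] idl[OF x(1)] by simp
  next
    fix l m n \<psi> \<phi> y assume \<psi>: "\<psi> \<in> Delta l m" and \<phi>: "\<phi> \<in> Delta m n" and "y \<in> cells Y n"
    then obtain x where x: "x \<in> cells X n" "y = f n x" using im by blast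
    then show "act Y l m \<psi> (act Y m n \<phi> y) = act Y l n (compose {..l} \<phi> \<psi>) y"
      using cmpl[OF \<psi> \<phi> x(1)] eqv[OF \<psi> cl(1)[OF \<phi> x(1)]] eqv[OF \<phi> x(1)] eqv[OF compose_Delta[OF \<psi> \<phi>] x(1)]
      by simp
  qed
  then show ?thesis
    unfolding fsset_iso_def using assms by blast
qed

text \<open>The inverse bijection is equivariant and carries the axioms from \<open>Y\<close> to
  \<open>X\<close>. Closure of \<open>X\<close> under the operators is assumed because the inverse
  recovers a simplex only once it is known to be a cell.\<close>

lemma fsset_iso_pull:
  fixes X :: "('x, 'h::order) fsset"
  assumes Y: "is_fsset Y"
    and closed: "\<And>m n \<phi> x. \<phi> \<in> Delta m n \<Longrightarrow> x \<in> cells X n \<Longrightarrow> act X m n \<phi> x \<in> cells X m"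
    and bij: "\<And>n. bij_betw (f n) (cells X n) (cells Y n)"
    and eqv: "\<And>m n \<phi> x. \<phi> \<in> Delta m n \<Longrightarrow> x \<in> cells X n \<Longrightarrow>
      f m (act X m n \<phi> x) = act Y m n \<phi> (f n x)"
    and hts: "\<And>n x. x \<in> cells X n \<Longrightarrow> ht Y n (f n x) = ht X n x"
  shows "fsset_iso X Y f"
proof -
  define g where "g n = inv_into (cells X n) (f n)" for n
  have fin: "f n x \<in> cells Y n" and gf: "g n (f n x) = x" if "x \<in> cells X n" for n x
    using bij[of n] that by (auto simp: bij_betw_def g_def)
  have gin: "g n y \<in> cells X n" and fg: "f n (g n y) = y" if "y \<in> cells Y n" for n y
    using bij[of n] that by (auto simp: bij_betw_def g_def inv_into_into f_inv_into_f)
  have "fsset_iso Y X g"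
  proof (rule fsset_iso_push[OF Y])
    show "bij_betw (g n) (cells Y n) (cells X n)" for n
      unfolding g_def by (rule bij_betw_inv_into[OF bij])
    show "g m (act Y m n \<phi> y) = act X m n \<phi> (g n y)" if "\<phi> \<in> Delta m n" "y \<in> cells Y n" for m n \<phi> y
      using eqv[OF that(1) gin[OF that(2)]] gf[OF closed[OF that(1) gin[OF that(2)]]] fg[OF that(2)]
      by simp
    show "ht X n (g n y) = ht Y n y" if "y \<in> cells Y n" for n y
      using hts[OF gin[OF that]] fg[OF that] by simp
  qed
  then show ?thesis
    unfolding fsset_iso_def using assms by blast
qed

text \<open>On each level \<open>h\<close> is \<open>g\<close> after the inverse of
  \<open>f\<close>. A proposed formula for that composite therefore only has to be tested on
  simplices coming from \<open>P\<close>.\<close>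

lemma fsset_iso_factor:
  assumes "fsset_iso P Q f" "fsset_iso P R g" "\<And>n x. x \<in> cells P n \<Longrightarrow> h n (f n x) = g n x"
  shows "fsset_iso Q R h"
proof -
  have bij: "bij_betw (h n) (cells Q n) (cells R n)" for n
  proof -
    have "bij_betw (h n \<circ> f n) (cells P n) (cells R n)"
      using assms(2) bij_betw_cong[of "cells P n" "h n \<circ> f n" "g n"] assms(3)
      by (simp add: fsset_iso_def)
    then show ?thesis
      using assms(1) bij_betw_comp_iff[of "f n" "cells P n" "cells Q n" "h n" "cells R n"]
      by (simp add: fsset_iso_def)
  qed
  have im: "\<exists>x\<in>cells P n. y = f n x" if "y \<in> cells Q n" for n y
    using assms(1) that unfolding fsset_iso_def bij_betw_def by blast
  have "h m (act Q m n \<phi> y) = act R m n \<phi> (h n y)" "ht R n (h n y) = ht Q n y"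
    if y: "y \<in> cells Q n" and \<phi>: "\<phi> \<in> Delta m n" for m n \<phi> y
  proof -
    obtain x where x: "x \<in> cells P n" "y = f n x" using im[OF y] by blast
    have "is_fsset P"
      using assms(1) by (simp add: fsset_iso_def)
    then have "act P m n \<phi> x \<in> cells P m"
      using x(1) \<phi> unfolding is_fsset_def by blast
    moreover have "f m (act P m n \<phi> x) = act Q m n \<phi> y" "g m (act P m n \<phi> x) = act R m n \<phi> (g n x)"
      "ht Q n y = ht P n x" "ht R n (g n x) = ht P n x"
      using assms(1,2) \<phi> x unfolding fsset_iso_def by auto
    ultimately show "h m (act Q m n \<phi> y) = act R m n \<phi> (h n y)" "ht R n (h n y) = ht Q n y"
      using assms(3) x by (metis, metis)
  qed
  note eqv = this
  show ?thesis
    unfolding fsset_iso_def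
  proof (intro conjI allI ballI)
    show "is_fsset Q" "is_fsset R"
      using assms(1,2) by (simp_all add: fsset_iso_def)
  \<comment> \<open>The height equation was proved together with equivariance and so carries an
    operator it does not mention; the identity operator fills the gap.\<close>
  qed (use bij eqv(1) eqv(2)[OF _ restrict_id_Delta] in auto)
qed


subsection \<open>Chains of cubes\<close>

text \<open>An arrow of the cube category is the pair of its ends, so a chain is nothing but its
  sequence of cubes; values of \<open>e\<close> beyond \<open>n\<close> are cut off.\<close>

definition cube_chain :: "nat \<Rightarrow> (nat \<Rightarrow> 'v cube) \<Rightarrow> ('v cube \<times> 'v cube) chain" where
  "cube_chain n e = tab n (\<lambda>i j. (e i, e j))"

lemma cube_chain_eq_iff: "cube_chain n e = cube_chain n e' \<longleftrightarrow> (\<forall>i\<le>n. e i = e' i)"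
  by (auto simp: cube_chain_def tab_eq_iff)

lemma cube_chain_apply [simp]: "i \<le> j \<Longrightarrow> j \<le> n \<Longrightarrow> cube_chain n e i j = (e i, e j)"
  by (simp add: cube_chain_def)

lemma tab_cube_chain [simp]: "tab n (cube_chain n e) = cube_chain n e"
  by (simp add: cube_chain_def)

text \<open>The face condition is asked for all pairs of positions rather than consecutive ones, so
  it restricts along any monotone map without appeal to transitivity.\<close>

definition is_cube_chain :: "'v wgraph \<Rightarrow> 'v cube set \<Rightarrow> nat \<Rightarrow> (nat \<Rightarrow> 'v cube) \<Rightarrow> bool" where
  "is_cube_chain H S n e \<longleftrightarrow>
     (\<forall>i\<le>n. e i \<in> S) \<and> (\<forall>i j. i \<le> j \<and> j \<le> n \<longrightarrow> face_of H (e i) (e j))"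

lemma chains_full_sub_cube_cat:
  "chains (full_sub (cube_cat H t) P) n =
     {cube_chain n e |e. is_cube_chain H {c \<in> cubes H t. P c} n e}" (is "?L = ?R")
proof (intro set_eqI iffI)
  fix \<sigma> assume \<sigma>: "\<sigma> \<in> ?L"
  let ?C = "full_sub (cube_cat H t) P"
  let ?e = "vtx ?C \<sigma>"
  have "\<sigma> i j = (?e i, ?e j)" "face_of H (?e i) (?e j)" if "i \<le> j" "j \<le> n" for i j
    using chains_arr[OF \<sigma> that] by (auto simp: full_sub_def cube_cat_def prod_eq_iff)
  moreover have "?e i \<in> {c \<in> cubes H t. P c}" if "i \<le> n" for i
    using chains_ob(1)[OF \<sigma> that] by (auto simp: full_sub_def cube_cat_def)
  moreover from calculation(1) have "tab n \<sigma> = cube_chain n ?e"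
    unfolding cube_chain_def by (rule tab_cong)
  ultimately have "is_cube_chain H {c \<in> cubes H t. P c} n ?e" "\<sigma> = cube_chain n ?e"
    unfolding is_cube_chain_def using chains_tab[OF \<sigma>] by auto
  then show "\<sigma> \<in> ?R" by blast
next
  fix \<sigma> assume "\<sigma> \<in> ?R"
  then obtain e where "\<sigma> = cube_chain n e" "is_cube_chain H {c \<in> cubes H t. P c} n e"
    by blast
  then show "\<sigma> \<in> ?L"
    by (auto simp: chains_def is_cube_chain_def full_sub_def cube_cat_def vtx_def)
qed

lemma chains_cube_cat:
  "chains (cube_cat H t) n = {cube_chain n e |e. is_cube_chain H (cubes H t) n e}"
proof -
  have "full_sub (cube_cat H t) (\<lambda>_. True) = cube_cat H t"
    by (simp add: full_sub_def cube_cat_def)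
  then show ?thesis
    using chains_full_sub_cube_cat[of H t "\<lambda>_. True" n] by simp
qed

lemma tab_map_cube_chain:
  "tab n (\<lambda>i j. map_prod f f (cube_chain n e i j)) = cube_chain n (\<lambda>i. f (e i))"
  unfolding cube_chain_def by (rule tab_cong) simp

lemma cube_map_chain [simp]: "cube_map H t f n (cube_chain n e, u) = (cube_chain n (\<lambda>i. f (e i)), u)"
  by (simp add: cube_map_def hocolim_map_def tab_map_cube_chain)

lemma hocolim_points_simps:
  "cells (hocolim C (points h)) n = chains C n \<times> UNIV"
  "act (hocolim C (points h)) m n \<phi> (\<sigma>, u) = (tab m (\<lambda>i j. \<sigma> (\<phi> i) (\<phi> j)), u)"
  "ht (hocolim C (points h)) n (\<sigma>, u) = h (vtx C \<sigma> 0)"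
  by (auto simp: hocolim_def points_def point_def)

lemma act_cube_chain:
  "\<phi> \<in> Delta m n \<Longrightarrow> tab m (\<lambda>i j. cube_chain n e (\<phi> i) (\<phi> j)) = cube_chain m (\<lambda>i. e (\<phi> i))"
  unfolding cube_chain_def by (rule tab_cong) (simp add: Delta_le Delta_mono)

lemma vtx_cube_chain [simp]:
  "vtx (cube_cat H t) (cube_chain n e) 0 = e 0"
  "vtx (full_sub (cube_cat H t) P) (cube_chain n e) 0 = e 0"
  by (simp_all add: vtx_def cube_cat_def full_sub_def)

text \<open>The height is read at the initial cube, and an operator can only move that cube to one
  of its faces.\<close>

lemma is_fsset_hocolim_cubes:
  fixes h :: "'v cube \<Rightarrow> 'h::order"
  assumes "\<And>c c'. c \<in> cubes H t \<Longrightarrow> face_of H c c' \<Longrightarrow> h c \<le> h c'"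
  shows "is_fsset (hocolim (cube_cat H t) (points h))"
proof -
  let ?X = "hocolim (cube_cat H t) (points h)"
  have sub: "is_cube_chain H (cubes H t) m (\<lambda>i. e (\<phi> i))"
    if "is_cube_chain H (cubes H t) n e" "\<phi> \<in> Delta m n" for m n e \<phi>
    using that unfolding is_cube_chain_def by (simp add: Delta_le Delta_mono)
  have cell: "\<exists>e. is_cube_chain H (cubes H t) n e \<and> x = (cube_chain n e, ())" if "x \<in> cells ?X n" for x n
    using that by (auto simp: hocolim_points_simps chains_cube_cat)
  have cell': "(cube_chain n e, u) \<in> cells ?X n" if "is_cube_chain H (cubes H t) n e" for n e u
    using that by (auto simp: hocolim_points_simps chains_cube_cat)
  show ?thesis
    unfolding is_fsset_def
  proof (intro conjI allI ballI)
    fix m n \<phi> x assume \<phi>: "\<phi> \<in> Delta m n" and "x \<in> cells ?X n"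
    then obtain e where e: "is_cube_chain H (cubes H t) n e" "x = (cube_chain n e, ())"
      using cell by blast
    then show "act ?X m n \<phi> x \<in> cells ?X m"
      using sub[OF e(1) \<phi>] by (simp add: hocolim_points_simps(2) act_cube_chain[OF \<phi>] cell')
    have "h (e 0) \<le> h (e (\<phi> 0))"
      using e(1) Delta_le[OF \<phi>, of 0] unfolding is_cube_chain_def by (intro assms) auto
    then show "ht ?X n x \<le> ht ?X m (act ?X m n \<phi> x)"
      by (simp add: e(2) hocolim_points_simps act_cube_chain[OF \<phi>])
  next
    fix n x assume "x \<in> cells ?X n"
    then obtain e where e: "x = (cube_chain n e, ())"
      using cell by blast
    show "act ?X n n (restrict id {..n}) x = x"
      unfolding e hocolim_points_simps(2) act_cube_chain[OF restrict_id_Delta] by (simp add: cube_chain_eq_iff)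
  next
    fix l m n \<psi> \<phi> x assume \<psi>: "\<psi> \<in> Delta l m" and \<phi>: "\<phi> \<in> Delta m n" and "x \<in> cells ?X n"
    then obtain e where e: "x = (cube_chain n e, ())"
      using cell by blast
    show "act ?X l m \<psi> (act ?X m n \<phi> x) = act ?X l n (compose {..l} \<phi> \<psi>) x"
      unfolding e hocolim_points_simps(2) act_cube_chain[OF compose_Delta[OF \<psi> \<phi>]] act_cube_chain[OF \<phi>]
        act_cube_chain[OF \<psi>]
      by (simp add: cube_chain_eq_iff compose_def)
  qed
qed

text \<open>The map must reflect faces as well as preserve them: the reflected faces turn the
  pointwise preimage of a chain into a chain again.\<close>

lemma chains_map_bij:
  assumes bij: "bij_betw f {c \<in> cubes H t. P c} (cubes H' t')"
    and face: "\<And>c c'. \<lbrakk>c \<in> cubes H t; P c; c' \<in> cubes H t; P c'\<rbrakk> \<Longrightarrow>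
      face_of H' (f c) (f c') \<longleftrightarrow> face_of H c c'"
  shows "bij_betw (\<lambda>\<tau>. tab n (\<lambda>i j. map_prod f f (\<tau> i j)))
    (chains (full_sub (cube_cat H t) P) n) (chains (cube_cat H' t') n)"
proof -
  let ?S = "{c \<in> cubes H t. P c}"
  let ?F = "\<lambda>\<tau>. tab n (\<lambda>i j. map_prod f f (\<tau> i j))"
  have inj: "inj_on f ?S" and im: "f ` ?S = cubes H' t'"
    using bij by (auto simp: bij_betw_def)
  show ?thesis
    unfolding bij_betw_def
  proof
    show "inj_on ?F (chains (full_sub (cube_cat H t) P) n)"
      unfolding chains_full_sub_cube_cat
    proof (rule inj_onI)
      fix \<sigma> \<tau>
      assume "\<sigma> \<in> {cube_chain n e |e. is_cube_chain H ?S n e}"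
        "\<tau> \<in> {cube_chain n e |e. is_cube_chain H ?S n e}" and eq: "?F \<sigma> = ?F \<tau>"
      then obtain e e' where e: "\<sigma> = cube_chain n e" "is_cube_chain H ?S n e"
        "\<tau> = cube_chain n e'" "is_cube_chain H ?S n e'" by blast
      have "e i = e' i" if "i \<le> n" for i
      proof (rule inj_onD[OF inj])
        show "f (e i) = f (e' i)"
          using eq that unfolding e tab_map_cube_chain by (simp add: cube_chain_eq_iff)
        show "e i \<in> ?S" "e' i \<in> ?S"
          using e(2,4) that unfolding is_cube_chain_def by blast+
      qed
      then show "\<sigma> = \<tau>" by (simp add: e cube_chain_eq_iff)
    qed
    show "?F ` chains (full_sub (cube_cat H t) P) n = chains (cube_cat H' t') n"
    proof (intro equalityI subsetI)
      fix \<tau> assume "\<tau> \<in> ?F ` chains (full_sub (cube_cat H t) P) n"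
      then obtain e where e: "\<tau> = cube_chain n (\<lambda>i. f (e i))" "is_cube_chain H ?S n e"
        unfolding chains_full_sub_cube_cat by (auto simp: tab_map_cube_chain)
      have "is_cube_chain H' (cubes H' t') n (\<lambda>i. f (e i))"
        using e(2) face im unfolding is_cube_chain_def by auto
      then show "\<tau> \<in> chains (cube_cat H' t') n"
        unfolding chains_cube_cat e(1) by blast
    next
      fix \<tau> assume "\<tau> \<in> chains (cube_cat H' t') n"
      then obtain e where e: "\<tau> = cube_chain n e" "is_cube_chain H' (cubes H' t') n e"
        unfolding chains_cube_cat by blast
      define g where "g i = inv_into ?S f (e i)" for i
      have g: "f (g i) = e i" "g i \<in> cubes H t" "P (g i)" if "i \<le> n" for i
      proof -
        have *: "e i \<in> f ` ?S"
          using e(2) that im unfolding is_cube_chain_def by auto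
        show "f (g i) = e i" using f_inv_into_f[OF *] by (simp add: g_def)
        show "g i \<in> cubes H t" "P (g i)" using inv_into_into[OF *] by (simp_all add: g_def)
      qed
      have "is_cube_chain H ?S n g"
        using e(2) g face unfolding is_cube_chain_def by (metis (mono_tags, lifting) le_trans mem_Collect_eq)
      moreover have "\<tau> = ?F (cube_chain n g)"
        unfolding tab_map_cube_chain e(1) cube_chain_eq_iff using g by simp
      ultimately show "\<tau> \<in> ?F ` chains (full_sub (cube_cat H t) P) n"
        unfolding chains_full_sub_cube_cat by blast
    qed
  qed
qed


section \<open>Definite forms and rational duals\<close>

lemma common_denominator:
  fixes x :: "'v \<Rightarrow> rat"
  assumes "finite S"
  shows "\<exists>N::int. N > 0 \<and> (\<forall>v\<in>S. \<exists>z::int. of_int N * x v = of_int z)"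
  using assms
proof induction
  case empty
  show ?case by (intro exI[of _ 1]) simp
next
  case (insert a S)
  then obtain N :: int where N: "N > 0" "\<forall>v\<in>S. \<exists>z::int. of_int N * x v = of_int z"
    by blast
  obtain p q where pq: "q > 0" "x a = of_int p / of_int q"
    by (cases "x a") (auto simp: Fract_of_int_quotient)
  have "of_int (N * q) * x a = of_int (N * p)"
    using pq by simp
  moreover have "\<exists>z::int. of_int (N * q) * x v = of_int z" if v: "v \<in> S" for v
  proof -
    obtain z :: int where z: "of_int N * x v = of_int z" using N v by blast
    have "of_int (N * q) * x v = of_int q * (of_int N * x v)" by simp
    also have "\<dots> = of_int (q * z)" unfolding z by simp
    finally show ?thesis by blast
  qed
  ultimately have "\<forall>v\<in>insert a S. \<exists>z::int. of_int (N * q) * x v = of_int z"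
    by blast
  with N(1) pq(1) show ?case by (intro exI[of _ "N * q"]) simp
qed

text \<open>Clearing denominators by \<open>N\<close> multiplies the form by the positive number
  \<open>N * N\<close> and leads back to the integral hypothesis.\<close>

lemma neg_def_rat:
  fixes x :: "'v \<Rightarrow> rat"
  assumes "finite (verts H)" "neg_def H" "v \<in> verts H" "x v \<noteq> 0"
  shows "qform H x x < 0"
proof -
  obtain N :: int where N: "N > 0" "\<forall>v\<in>verts H. \<exists>z::int. of_int N * x v = of_int z"
    using common_denominator[OF assms(1)] by blast
  obtain z :: "'v \<Rightarrow> int" where z: "of_int N * x v = of_int (z v)" if "v \<in> verts H" for v
    using N(2) by metis
  have "z v \<noteq> 0"
    using z[OF assms(3)] N(1) assms(4) by auto
  then have "qform H z z < 0"
    using assms(2,3) unfolding neg_def_def by blast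
  moreover have "of_int (qform H z z) = (of_int N)\<^sup>2 * qform H x x"
    unfolding qform_def of_int_sum sum_distrib_left
    by (intro sum.cong refl) (simp add: z[symmetric] power2_eq_square mult_ac)
  ultimately have "(of_int N)\<^sup>2 * qform H x x < 0"
    by (metis of_int_less_0_iff)
  then show ?thesis
    using N(1) by (simp add: mult_less_0_iff)
qed

text \<open>Gram-Schmidt by induction on \<open>S\<close>: a solution over \<open>S\<close> is
  corrected along a vector orthogonal to \<open>S\<close>, whose square is negative and can
  therefore be divided by.\<close>

lemma definite_form_dual_exists:
  fixes B :: "'v \<Rightarrow> 'v \<Rightarrow> 'a::linordered_field"
  assumes "finite S"
    and "\<And>x v. v \<in> S \<Longrightarrow> x v \<noteq> 0 \<Longrightarrow> (\<Sum>v\<in>S. \<Sum>w\<in>S. x v * x w * B v w) < 0"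
  shows "\<exists>x. (\<forall>v. v \<notin> S \<longrightarrow> x v = 0) \<and> (\<forall>w\<in>S. (\<Sum>v\<in>S. x v * B v w) = f w)"
  using assms
proof (induction S arbitrary: f)
  case empty
  show ?case by (intro exI[of _ "\<lambda>_. 0"]) simp
next
  case (insert a S)
  have drop: "(\<Sum>v\<in>insert a S. x v * B v w) = x a * B a w + (\<Sum>v\<in>S. x v * B v w)" for x w
    using insert.hyps by simp
  have neg: "(\<Sum>v\<in>S. \<Sum>w\<in>S. x v * x w * B v w) < 0" if "v \<in> S" "x v \<noteq> 0" for x v
  proof -
    let ?x = "x(a := 0)"
    have "(\<Sum>v\<in>insert a S. \<Sum>w\<in>insert a S. ?x v * ?x w * B v w) < 0"
    proof (rule insert.prems)
      show "v \<in> insert a S" "?x v \<noteq> 0"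
        using that insert.hyps by auto
    qed
    also have "(\<Sum>v\<in>insert a S. \<Sum>w\<in>insert a S. ?x v * ?x w * B v w)
        = (\<Sum>v\<in>S. \<Sum>w\<in>S. ?x v * ?x w * B v w)"
      using insert.hyps by simp
    also have "\<dots> = (\<Sum>v\<in>S. \<Sum>w\<in>S. x v * x w * B v w)"
      using insert.hyps by (intro sum.cong) auto
    finally show ?thesis .
  qed
  have IH: "\<exists>x. (\<forall>v. v \<notin> S \<longrightarrow> x v = 0) \<and> (\<forall>w\<in>S. (\<Sum>v\<in>S. x v * B v w) = f w)" for f
    by (rule insert.IH) (rule neg)
  obtain y where y: "\<And>v. v \<notin> S \<Longrightarrow> y v = 0" "\<And>w. w \<in> S \<Longrightarrow> (\<Sum>v\<in>S. y v * B v w) = f w"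
    using IH[of f] by blast
  obtain z where z: "\<And>v. v \<notin> S \<Longrightarrow> z v = 0" "\<And>w. w \<in> S \<Longrightarrow> (\<Sum>v\<in>S. z v * B v w) = - B a w"
    using IH[of "\<lambda>w. - B a w"] by blast
  \<comment> \<open>\<open>g\<close> spans the orthogonal complement of the span of \<open>S\<close>.\<close>
  define g where "g = z(a := 1)"
  have gS: "(\<Sum>v\<in>S. g v * B v w) = (\<Sum>v\<in>S. z v * B v w)" for w
    unfolding g_def using insert.hyps by (intro sum.cong) auto
  have g0: "(\<Sum>v\<in>insert a S. g v * B v w) = 0" if "w \<in> S" for w
    unfolding drop gS z(2)[OF that] by (simp add: g_def)
  define \<rho> where "\<rho> = (\<Sum>v\<in>insert a S. g v * B v a)"
  have "(\<Sum>v\<in>insert a S. \<Sum>w\<in>insert a S. g v * g w * B v w) =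
      (\<Sum>w\<in>insert a S. g w * (\<Sum>v\<in>insert a S. g v * B v w))"
    by (subst sum.swap) (simp add: sum_distrib_left mult_ac)
  also have "\<dots> = (\<Sum>w\<in>insert a S. if w = a then \<rho> else 0)"
  proof (intro sum.cong refl)
    fix w assume w: "w \<in> insert a S"
    show "g w * (\<Sum>v\<in>insert a S. g v * B v w) = (if w = a then \<rho> else 0)"
    proof (cases "w = a")
      case True
      have "g a = 1" by (simp add: g_def)
      with True show ?thesis unfolding \<rho>_def by simp
    next
      case False
      with w g0[of w] show ?thesis by simp
    qed
  qed
  also have "\<dots> = \<rho>"
    using insert.hyps by simp
  finally have "\<rho> < 0"
    using insert.prems[of a g] by (simp add: g_def)
  \<comment> \<open>Adding a multiple of \<open>g\<close> disturbs only the equation at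
    \<open>a\<close>, by that multiple of \<open>\<rho>\<close>; this \<open>c\<close> removes the
    error there.\<close>
  define c where "c = (f a - (\<Sum>v\<in>insert a S. y v * B v a)) / \<rho>"
  define x where "x v = y v + c * g v" for v
  have x: "(\<Sum>v\<in>insert a S. x v * B v w) =
      (\<Sum>v\<in>insert a S. y v * B v w) + c * (\<Sum>v\<in>insert a S. g v * B v w)" for w
    by (simp add: x_def sum.distrib sum_distrib_left algebra_simps)
  have "(\<Sum>v\<in>insert a S. x v * B v w) = f w" if "w \<in> insert a S" for w
  proof (cases "w = a")
    case True
    show ?thesis
      unfolding x True \<rho>_def[symmetric] using \<open>\<rho> < 0\<close> by (simp add: c_def)
  next
    case False
    then have w: "w \<in> S" using that by simp
    show ?thesis
      unfolding x g0[OF w] unfolding drop y(2)[OF w] using insert.hyps by (simp add: y(1))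
  qed
  moreover have "x v = 0" if "v \<notin> insert a S" for v
    using that by (simp add: x_def g_def y(1) z(1))
  ultimately show ?case by blast
qed

lemma dot_sym: "dot H v w = dot H w v"
  by (auto simp: dot_def insert_commute)

lemma qform_swap: "qform H x y = (\<Sum>w\<in>verts H. y w * (\<Sum>v\<in>verts H. x v * of_int (dot H v w)))"
  unfolding qform_def by (subst sum.swap) (simp add: sum_distrib_left mult_ac)

text \<open>The difference of two solutions pairs to zero with every vertex, so its square vanishes
  and definiteness kills it. This is what gives the description in \<open>rat_dual\<close> a
  value.\<close>

lemma rat_dual_ex1:
  assumes "finite (verts H)" "neg_def H"
  shows "\<exists>!x. (\<forall>v. v \<notin> verts H \<longrightarrow> x v = (0::rat)) \<and>
     (\<forall>w\<in>verts H. (\<Sum>v\<in>verts H. x v * of_int (dot H v w)) = of_int (f w))"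
proof (rule ex_ex1I)
  show "\<exists>x. (\<forall>v. v \<notin> verts H \<longrightarrow> x v = (0::rat)) \<and>
     (\<forall>w\<in>verts H. (\<Sum>v\<in>verts H. x v * of_int (dot H v w)) = of_int (f w))"
    using assms neg_def_rat[OF assms]
    by (intro definite_form_dual_exists) (auto simp: qform_def)
next
  fix x y :: "'a \<Rightarrow> rat"
  assume x: "(\<forall>v. v \<notin> verts H \<longrightarrow> x v = 0) \<and>
     (\<forall>w\<in>verts H. (\<Sum>v\<in>verts H. x v * of_int (dot H v w)) = of_int (f w))"
    and y: "(\<forall>v. v \<notin> verts H \<longrightarrow> y v = 0) \<and>
     (\<forall>w\<in>verts H. (\<Sum>v\<in>verts H. y v * of_int (dot H v w)) = of_int (f w))"
  define z where "z v = x v - y v" for v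
  have "qform H z z = (\<Sum>w\<in>verts H. z w * 0)"
    unfolding qform_swap z_def
    by (intro sum.cong refl arg_cong[where f = "(*) _"]) (use x y in \<open>simp add: left_diff_distrib sum_subtractf\<close>)
  then have "qform H z z = 0" by simp
  then have "z v = 0" if "v \<in> verts H" for v
    using neg_def_rat[OF assms that, of z] by force
  then show "x = y"
    using x y by (metis eq_iff_diff_eq_0 ext z_def)
qed

lemma
  assumes "finite (verts H)" "neg_def H"
  shows rat_dual_outside: "v \<notin> verts H \<Longrightarrow> rat_dual H f v = 0"
    and rat_dual_dot: "w \<in> verts H \<Longrightarrow> (\<Sum>v\<in>verts H. rat_dual H f v * of_int (dot H v w)) = of_int (f w)"
  using theI'[OF rat_dual_ex1[OF assms, of f], folded rat_dual_def] by blast+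

lemma rat_dual_eqI:
  assumes "finite (verts H)" "neg_def H" "\<And>v. v \<notin> verts H \<Longrightarrow> x v = 0"
    and "\<And>w. w \<in> verts H \<Longrightarrow> (\<Sum>v\<in>verts H. x v * of_int (dot H v w)) = of_int (f w)"
  shows "rat_dual H f = x"
  unfolding rat_dual_def by (rule the1_equality[OF rat_dual_ex1[OF assms(1,2)]]) (use assms in blast)


section \<open>Classes and orbits\<close>

lemma PD_add: "PD H (\<lambda>v. x v + y v) w = PD H x w + PD H y w"
  by (simp add: PD_def sum.distrib algebra_simps)

lemma PD_minus: "PD H (\<lambda>v. - x v) w = - PD H x w"
  by (simp add: PD_def sum_negf)

lemma plus_class_add: "plus_class H (plus_class H k x) y = plus_class H k (\<lambda>v. x v + y v)"
  by (simp add: plus_class_def PD_add fun_eq_iff)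

lemma plus_class_0 [simp]: "plus_class H k (\<lambda>v. 0) = k"
  by (simp add: plus_class_def PD_def fun_eq_iff)

lemma plus_verts_empty [simp]: "plus_verts H k {} = k"
  by (simp add: plus_verts_def)

lemma plus_verts_Un:
  "I \<inter> J = {} \<Longrightarrow> plus_verts H (plus_verts H k I) J = plus_verts H k (I \<union> J)"
  unfolding plus_verts_def plus_class_add
  by (rule arg_cong[where f = "plus_class H k"]) (auto simp: of_bool_def fun_eq_iff)

lemma plus_verts_commute:
  "plus_verts H (plus_verts H' k I) J = plus_verts H' (plus_verts H k J) I"
  by (simp add: plus_verts_def plus_class_def fun_eq_iff)

lemma plus_verts_inj: "plus_verts H k I = plus_verts H k' I \<longleftrightarrow> k = k'"
  by (simp add: plus_verts_def plus_class_def fun_eq_iff)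

lemma neg_neg [simp]: "neg (neg k) = k"
  by (simp add: neg_def fun_eq_iff)

lemma neg_plus_class: "neg (plus_class H k x) = plus_class H (neg k) (\<lambda>v. - x v)"
  by (simp add: neg_def plus_class_def PD_minus fun_eq_iff)

lemma plus_verts_neg_plus_verts: "plus_verts H (neg (plus_verts H k I)) I = neg k"
  by (simp add: plus_verts_def plus_class_def neg_def fun_eq_iff)

lemma orbit_refl: "k \<in> orbit H k"
  unfolding orbit_def by (metis plus_class_0 rangeI)

lemma orbit_plus_class [simp]: "orbit H (plus_class H k x) = orbit H k"
proof -
  have "orbit H (plus_class H k x) \<subseteq> orbit H k" for k and x :: "'a \<Rightarrow> int"
    unfolding orbit_def plus_class_add by auto
  from this[of k x] this[of "plus_class H k x" "\<lambda>v. - x v"] show ?thesis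
    by (auto simp: plus_class_add)
qed

lemma orbit_plus_verts [simp]: "orbit H (plus_verts H k I) = orbit H k"
  by (simp add: plus_verts_def)

lemma orbit_eqI: "k' \<in> orbit H k \<Longrightarrow> orbit H k' = orbit H k"
  unfolding orbit_def by (metis (no_types) imageE orbit_def orbit_plus_class)

lemma mem_orbit_iff: "k' \<in> orbit H k \<longleftrightarrow> orbit H k' = orbit H k"
  using orbit_eqI orbit_refl by metis

lemma spinc_orbit: "t \<in> spinc H \<Longrightarrow> k \<in> t \<Longrightarrow> t = orbit H k"
  unfolding spinc_def using orbit_eqI by blast

lemma orbit_neg: "orbit H (neg k) = neg ` orbit H k"
  unfolding orbit_def neg_plus_class image_image
proof (intro equalityI subsetI)
  fix y assume "y \<in> range (plus_class H (neg k))"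
  then obtain x where "y = plus_class H (neg k) x" by blast
  then have "y = plus_class H (neg k) (\<lambda>v. - (- x v))" by simp
  then show "y \<in> range (\<lambda>x. plus_class H (neg k) (\<lambda>v. - x v))" by (rule range_eqI[where x = "\<lambda>v. - x v"])
qed auto

text \<open>Translations commute even when they come from different graphs. With \<open>H'\<close> a
  graph having an additional unweighted vertex, addition of the knot class becomes a map of
  orbits.\<close>

lemma orbit_plus_verts_image:
  "orbit H (plus_verts H' k I) = (\<lambda>k. plus_verts H' k I) ` orbit H k"
  unfolding orbit_def image_image
  by (rule image_cong) (simp_all add: plus_verts_def plus_class_def fun_eq_iff)

lemma pairing_PD:
  "dom (wt H) = verts H \<Longrightarrow> pairing H (plus_class H k y) x = pairing H k x + 2 * qform H (\<lambda>v. of_int (y v)) x"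
  by (simp add: pairing_def plus_class_def PD_def qform_swap algebra_simps sum.distrib sum_distrib_left)

lemma qform_of_int: "qform H (\<lambda>v. of_int (y v)) x = (\<Sum>v\<in>verts H. of_int (y v) * (\<Sum>w\<in>verts H. x w * of_int (dot H w v)))"
  unfolding qform_def by (simp add: sum_distrib_left mult_ac dot_sym)

lemma Char_plus_class:
  assumes "dom (wt H) = verts H" "k \<in> Char H"
  shows "plus_class H k x \<in> Char H"
proof -
  have "plus_class H k x v = 0" if "v \<notin> verts H" for v
    using assms that by (simp add: Char_def plus_class_def PD_def)
  moreover have "even (pairing H (plus_class H k x) y - qform H y y)" for y :: "'a \<Rightarrow> int"
  proof -
    have "even (pairing H k y - qform H y y)"
      using assms(2) by (simp add: Char_def)
    then show ?thesis
      unfolding pairing_PD[OF assms(1)] by simp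
  qed
  ultimately show ?thesis
    unfolding Char_def by blast
qed

lemma spinc_subset_Char: "dom (wt H) = verts H \<Longrightarrow> t \<in> spinc H \<Longrightarrow> t \<subseteq> Char H"
  unfolding spinc_def orbit_def using Char_plus_class by blast

lemma orbit_in_spinc: "k \<in> Char H \<Longrightarrow> orbit H k \<in> spinc H"
  by (simp add: spinc_def)

lemma spinc_plus_verts: "t \<in> spinc H \<Longrightarrow> k \<in> t \<Longrightarrow> plus_verts H k I \<in> t"
  using spinc_orbit orbit_refl orbit_plus_verts by metis


section \<open>Faces and heights\<close>

lemma face_of_refl [simp]: "face_of H c c"
  unfolding face_of_def by (intro exI[of _ "{}"] exI[of _ "snd c"]) simp

lemma face_of_trans: "face_of H c c' \<Longrightarrow> face_of H c' c'' \<Longrightarrow> face_of H c c''"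
  unfolding face_of_def
proof (elim exE conjE)
  fix I E' J E''
  assume *: "I \<subseteq> snd c" "E' \<subseteq> snd c" "I \<inter> E' = {}" "c' = (plus_verts H (fst c) I, E')"
    "J \<subseteq> snd c'" "E'' \<subseteq> snd c'" "J \<inter> E'' = {}" "c'' = (plus_verts H (fst c') J, E'')"
  then have "I \<inter> J = {}" "I \<union> J \<subseteq> snd c" "E'' \<subseteq> snd c" "(I \<union> J) \<inter> E'' = {}"
    by auto
  with * show "\<exists>I E'. I \<subseteq> snd c \<and> E' \<subseteq> snd c \<and> I \<inter> E' = {} \<and> c'' = (plus_verts H (fst c) I, E')"
    by (intro exI[of _ "I \<union> J"] exI[of _ E'']) (simp add: plus_verts_Un)
qed

text \<open>The vertices of a face are among the vertices of the cube, so its minimum is taken over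
  a smaller set.\<close>

lemma hU_face_mono:
  assumes "finite (verts H)" "c \<in> cubes H t" "face_of H c c'"
  shows "hU H c \<le> hU H c'"
proof -
  obtain I E' where I: "I \<subseteq> snd c" "E' \<subseteq> snd c" "I \<inter> E' = {}" "c' = (plus_verts H (fst c) I, E')"
    using assms(3) unfolding face_of_def by blast
  have "finite (snd c)"
    using assms(1,2) unfolding cubes_def by (auto dest: finite_subset)
  moreover have "(\<lambda>J. hU0 H (plus_verts H (fst c') J)) ` Pow (snd c') \<subseteq>
      (\<lambda>J. hU0 H (plus_verts H (fst c) J)) ` Pow (snd c)"
  proof
    fix h assume "h \<in> (\<lambda>J. hU0 H (plus_verts H (fst c') J)) ` Pow (snd c')"
    then obtain J where J: "J \<subseteq> E'" "h = hU0 H (plus_verts H (plus_verts H (fst c) I) J)"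
      using I(4) by auto
    then have "I \<inter> J = {}" "I \<union> J \<in> Pow (snd c)"
      using I by auto
    then have "h = hU0 H (plus_verts H (fst c) (I \<union> J))" "I \<union> J \<in> Pow (snd c)"
      using J(2) by (simp_all add: plus_verts_Un)
    then show "h \<in> (\<lambda>J. hU0 H (plus_verts H (fst c) J)) ` Pow (snd c)" by blast
  qed
  ultimately show ?thesis
    unfolding hU_def by (intro Min_antimono) auto
qed

lemma face_of_shift:
  assumes "face_of H c c'"
  shows "face_of H (plus_verts H' (fst c) I, snd c) (plus_verts H' (fst c') I, snd c')"
proof -
  obtain J E' where "J \<subseteq> snd c" "E' \<subseteq> snd c" "J \<inter> E' = {}" "c' = (plus_verts H (fst c) J, E')"
    using assms unfolding face_of_def by blast
  then show ?thesis
    unfolding face_of_def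
    by (intro exI[of _ J] exI[of _ E']) (simp add: plus_verts_commute[of H' H])
qed


section \<open>The lattice of the surgered plumbing\<close>

locale surgery =
  fixes Gv :: "'v wgraph" and v :: 'v and n :: int
  assumes forest: "forest Gv"
    and v_in: "v \<in> verts Gv"
    and dom_wt: "dom (wt Gv) = verts Gv - {v}"
    and negdef: "neg_def (give_weight Gv v n)"
begin

abbreviation G where "G \<equiv> del_vertex Gv v"
abbreviation Gn where "Gn \<equiv> give_weight Gv v n"
abbreviation V where "V \<equiv> verts Gv"
abbreviation r where "r \<equiv> seifert_framing Gv v n"
abbreviation A where "A \<equiv> Ahat Gv v n"
abbreviation Sg where "Sg \<equiv> Sigma_class Gv v"
abbreviation K where "K k \<equiv> plus_verts Gv k {v}"

lemma finV [simp]: "finite V"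
  using forest by (simp add: forest_def)

lemma graph_simps [simp]:
  "verts G = V - {v}" "verts Gn = V" "dom (wt Gn) = V" "dom (wt G) = V - {v}"
  using dom_wt v_in by (auto simp: del_vertex_def give_weight_def)

lemma dot_G: "a \<noteq> v \<Longrightarrow> b \<noteq> v \<Longrightarrow> dot G a b = dot Gn a b"
  by (simp add: dot_def del_vertex_def give_weight_def)

lemma dot_Gv: "a \<noteq> v \<or> b \<noteq> v \<Longrightarrow> dot Gv a b = dot Gn a b"
  by (auto simp: dot_def give_weight_def)

lemma sum_V: "(\<Sum>w\<in>V. f w) = f v + (\<Sum>w\<in>V - {v}. f w)" for f :: "'v \<Rightarrow> 'a::comm_monoid_add"
  by (rule sum.remove) (simp_all add: v_in)

lemma neg_def_G: "neg_def G"
  unfolding neg_def_def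
proof (intro allI impI)
  fix x :: "'v \<Rightarrow> int" assume "\<exists>w\<in>verts G. x w \<noteq> 0"
  then have "\<exists>w\<in>verts Gn. (x(v := 0)) w \<noteq> 0"
    by auto
  then have "qform Gn (x(v := 0)) (x(v := 0)) < 0"
    using negdef unfolding neg_def_def by blast
  also have "qform Gn (x(v := 0)) (x(v := 0)) = qform G x x"
    unfolding qform_def graph_simps sum_V by (auto simp: dot_G intro!: sum.cong)
  finally show "qform G x x < 0" .
qed

section \<open>The class \<Sigma> and the Seifert framing\<close>

abbreviation y0 where "y0 \<equiv> rat_dual G (dot Gv v)"

lemma dual_G_v [simp]: "rat_dual G f v = 0"
  using rat_dual_outside[OF _ neg_def_G] by simp

lemma dual_G_dot:
  "w \<in> V - {v} \<Longrightarrow> (\<Sum>u\<in>V - {v}. rat_dual G f u * of_int (dot Gn u w)) = of_int (f w)"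
  using rat_dual_dot[OF _ neg_def_G, of w f] by (simp add: dot_G cong: sum.cong_simp)

lemma Sg_simps: "Sg v = 1" "w \<noteq> v \<Longrightarrow> Sg w = - y0 w"
  by (simp_all add: Sigma_class_def)

lemma Sg_outside: "w \<notin> V \<Longrightarrow> Sg w = 0"
  using rat_dual_outside[OF _ neg_def_G, of w] v_in by (auto simp: Sigma_class_def)

lemma Sg_dot:
  assumes "w \<in> V - {v}"
  shows "(\<Sum>u\<in>V. Sg u * of_int (dot Gn u w)) = 0"
proof -
  have "(\<Sum>u\<in>V - {v}. Sg u * of_int (dot Gn u w)) = - (\<Sum>u\<in>V - {v}. y0 u * of_int (dot Gn u w))"
    unfolding sum_negf[symmetric] by (intro sum.cong) (auto simp: Sg_simps)
  also have "\<dots> = - of_int (dot Gv v w)"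
    using dual_G_dot[OF assms] by simp
  finally show ?thesis
    using assms by (simp add: sum_V Sg_simps dot_Gv)
qed

text \<open>In the square of \<Sigma>, expanded over one factor, the vertices of \<open>G\<close>
  contribute nothing by orthogonality and \<open>v\<close> enters with coefficient one.\<close>

lemma r_eq: "(\<Sum>u\<in>V. Sg u * of_int (dot Gn u v)) = r"
proof -
  let ?F = "\<lambda>w. \<Sum>u\<in>V. Sg u * of_int (dot Gn u w)"
  have "r = (\<Sum>w\<in>V. Sg w * ?F w)"
    by (simp add: seifert_framing_def qform_swap)
  also have "\<dots> = Sg v * ?F v + (\<Sum>w\<in>V - {v}. Sg w * ?F w)"
    by (rule sum_V)
  also have "(\<Sum>w\<in>V - {v}. Sg w * ?F w) = 0"
    using Sg_dot by (intro sum.neutral ballI) (simp only: mult_zero_right)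
  finally show ?thesis by (simp add: Sg_simps)
qed

lemma r_neg: "r < 0"
  unfolding seifert_framing_def
  using neg_def_rat[OF _ negdef, of v Sg] by (simp add: v_in Sg_simps)

abbreviation pS where "pS L \<equiv> pairing Gn L Sg"

lemma pS_plus_class: "pS (plus_class Gn L x) = pS L + 2 * of_int (x v) * r"
proof -
  have "qform Gn (\<lambda>v. of_int (x v)) Sg = of_int (x v) * r"
  proof -
    let ?F = "\<lambda>w. \<Sum>u\<in>V. Sg u * of_int (dot Gn u w)"
    have "qform Gn (\<lambda>v. of_int (x v)) Sg = (\<Sum>w\<in>V. of_int (x w) * ?F w)"
      by (simp add: qform_of_int)
    also have "\<dots> = of_int (x v) * ?F v + (\<Sum>w\<in>V - {v}. of_int (x w) * ?F w)"
      by (rule sum_V)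
    also have "(\<Sum>w\<in>V - {v}. of_int (x w) * ?F w) = 0"
      using Sg_dot by (intro sum.neutral ballI) (simp only: mult_zero_right)
    finally show ?thesis by (simp add: r_eq)
  qed
  then show ?thesis
    by (simp add: pairing_PD)
qed

lemma A_plus_class: "A (plus_class Gn L x) = A L + of_int (x v) * r"
  by (simp add: Ahat_def pS_plus_class field_simps)

lemma A_plus_verts: "A (plus_verts Gn L I) = A L + of_bool (v \<in> I) * r"
  by (simp add: plus_verts_def A_plus_class)

lemma A_neg: "A (neg L) = r - A L"
  by (simp add: Ahat_def pairing_def neg_def sum_negf field_simps)

lemma A_upd: "A (L(v := L v + 2)) = A L + 1"
  by (simp add: Ahat_def pairing_def sum_V Sg_simps field_simps)

lemma restr_upd [simp]: "restr G (L(v := c)) = restr G L"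
  by (auto simp: restr_def)

lemma restr_neg: "restr G (neg L) = neg (restr G L)"
  by (auto simp: restr_def neg_def)

lemma restr_plus_class:
  assumes "x v = 0"
  shows "restr G (plus_class Gn L x) = plus_class G (restr G L) x"
  using assms by (auto simp: restr_def plus_class_def PD_def sum_V dot_G fun_eq_iff intro!: sum.cong)

lemma restr_plus_v: "restr G (plus_verts Gn L {v}) = K (restr G L)"
  using dom_wt
  by (auto simp: restr_def plus_verts_def plus_class_def PD_def sum_V dot_Gv fun_eq_iff of_bool_def
      intro!: sum.cong)

lemma restr_plus_verts:
  "v \<notin> I \<Longrightarrow> restr G (plus_verts Gn L I) = plus_verts G (restr G L) I"
  by (simp add: plus_verts_def restr_plus_class)

lemma plus_verts_G_Diff [simp]: "plus_verts G k (I - {v}) = plus_verts G k I"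
  by (auto simp: plus_verts_def plus_class_def PD_def fun_eq_iff intro!: sum.cong)

lemma plus_verts_split:
  "v \<in> I \<Longrightarrow> plus_verts Gn L I = plus_verts Gn (plus_verts Gn L (I - {v})) {v}"
  by (subst plus_verts_Un) (auto simp: insert_absorb)

lemma restr_plus_verts_v:
  "v \<in> I \<Longrightarrow> restr G (plus_verts Gn L I) = K (plus_verts G (restr G L) I)"
  by (subst plus_verts_split) (simp_all add: restr_plus_v restr_plus_verts)

section \<open>Classes of the surgered plumbing as pairs of a restriction and a value of
  \<open>Ahat\<close>\<close>

lemma pS_eq: "pS L = of_int (L v) + (\<Sum>w\<in>V - {v}. of_int (restr G L w) * Sg w)"
  by (auto simp: pairing_def sum_V Sg_simps restr_def intro!: sum.cong)

text \<open>Since \<Sigma> has coefficient one at \<open>v\<close>, the value on \<Sigma> and the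
  restriction together recover \<open>L v\<close>, the only value that restriction forgets.\<close>

lemma class_eqI:
  assumes "L \<in> Char Gn" "L' \<in> Char Gn" "restr G L = restr G L'" "A L = A L'"
  shows "L = L'"
proof
  fix w
  have "L v = L' v"
    using assms(3,4) by (simp add: Ahat_def pS_eq)
  moreover have "L w = L' w" if "w \<in> V - {v}"
    using fun_cong[OF assms(3), of w] that by (simp add: restr_def)
  moreover have "L w = L' w" if "w \<notin> V"
    using assms(1,2) that by (simp add: Char_def)
  ultimately show "L w = L' w" by (cases "w \<in> V - {v}") auto
qed

lemma class_lift:
  assumes "k \<in> orbit G (restr G L)"
  obtains L' where "L' \<in> orbit Gn L" "restr G L' = k" "A L' = A L"
proof -
  obtain x where x: "k = plus_class G (restr G L) x"
    using assms unfolding orbit_def by blast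
  \<comment> \<open>The coefficient at \<open>v\<close> is invisible in \<open>G\<close> but would
    move \<open>Ahat\<close> by a multiple of \<open>r\<close>, so it is set to zero before
    lifting.\<close>
  let ?x = "x(v := 0)"
  have "plus_class G (restr G L) ?x = k"
    unfolding x by (auto simp: plus_class_def PD_def fun_eq_iff intro!: sum.cong)
  then show thesis
    by (intro that[of "plus_class Gn L ?x"])
      (simp_all add: orbit_def restr_plus_class A_plus_class)
qed

lemma restr_Char:
  assumes "L \<in> Char Gn"
  shows "restr G L \<in> Char G"
proof -
  have "even (pairing G (restr G L) x - qform G x x)" for x :: "'v \<Rightarrow> int"
  proof -
    have "even (pairing Gn L (x(v := 0)) - qform Gn (x(v := 0)) (x(v := 0)))"
      using assms unfolding Char_def by blast
    moreover have "pairing Gn L (x(v := 0)) = pairing G (restr G L) x"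
      by (auto simp: pairing_def sum_V restr_def intro!: sum.cong)
    moreover have "qform Gn (x(v := 0)) (x(v := 0)) = qform G x x"
      unfolding qform_def graph_simps sum_V by (auto simp: dot_G intro!: sum.cong)
    ultimately show ?thesis by simp
  qed
  then show ?thesis
    unfolding Char_def by (simp add: restr_def)
qed

text \<open>Orthogonal decomposition: the dual of \<open>L\<close> is the dual of its restriction
  plus a multiple of \<Sigma>, and pairing with \<Sigma> forces the coefficient to be
  \<open>pS L / r\<close>.\<close>

lemma square_split: "square Gn L = square G (restr G L) + (pS L)\<^sup>2 / r"
proof -
  let ?y = "rat_dual G (restr G L)"
  define c where "c = pS L / r"
  have "rat_dual Gn L = (\<lambda>w. ?y w + c * Sg w)"
  proof (rule rat_dual_eqI[OF _ negdef])
    show "?y w + c * Sg w = 0" if "w \<notin> verts Gn" for w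
      using that rat_dual_outside[OF _ neg_def_G, of w] Sg_outside[of w] by simp
    fix w assume "w \<in> verts Gn"
    have split: "(\<Sum>u\<in>V. (?y u + c * Sg u) * of_int (dot Gn u w)) =
        (\<Sum>u\<in>V - {v}. ?y u * of_int (dot Gn u w)) + c * (\<Sum>u\<in>V. Sg u * of_int (dot Gn u w))"
    proof -
      have "(\<Sum>u\<in>V. ?y u * of_int (dot Gn u w)) = (\<Sum>u\<in>V - {v}. ?y u * of_int (dot Gn u w))"
        by (simp add: sum_V)
      then show ?thesis
        unfolding distrib_right sum.distrib sum_distrib_left by (simp add: mult.assoc)
    qed
    have "(\<Sum>u\<in>V. (?y u + c * Sg u) * of_int (dot Gn u w)) = of_int (L w)"
    proof (cases "w = v")
      case False
      then have w: "w \<in> V - {v}" using \<open>w \<in> verts Gn\<close> by simp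
      show ?thesis
        unfolding split dual_G_dot[OF w] Sg_dot[OF w] using w by (simp add: restr_def)
    next
      case True
      \<comment> \<open>Against the vertices of \<open>G\<close>, \<open>v\<close> pairs as
        \<open>y0\<close> does. Exchanging the sums gives the value of the restriction on
        \<open>y0\<close>, which cancels the difference between \<open>pS L\<close> and
        \<open>L v\<close>.\<close>
      have "(\<Sum>u\<in>V - {v}. ?y u * of_int (dot Gn u v)) =
          (\<Sum>u\<in>V - {v}. ?y u * (\<Sum>w\<in>V - {v}. y0 w * of_int (dot Gn w u)))"
        by (intro sum.cong refl) (simp add: dual_G_dot dot_Gv dot_sym[of _ v])
      also have "\<dots> = (\<Sum>w\<in>V - {v}. y0 w * (\<Sum>u\<in>V - {v}. ?y u * of_int (dot Gn u w)))"
        unfolding sum_distrib_left by (subst sum.swap) (simp add: mult_ac dot_sym)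
      also have "\<dots> = - (\<Sum>w\<in>V - {v}. of_int (restr G L w) * Sg w)"
        unfolding sum_negf[symmetric]
        by (intro sum.cong refl) (auto simp: dual_G_dot Sg_simps)
      finally show ?thesis
        unfolding True split[unfolded True] r_eq using r_neg by (simp add: c_def pS_eq)
    qed
    then show "(\<Sum>u\<in>verts Gn. (?y u + c * Sg u) * of_int (dot Gn u w)) = of_int (L w)"
      by simp
  qed simp
  then have "square Gn L = pairing Gn L ?y + c * pS L"
    by (simp add: square_def pairing_def distrib_left sum.distrib sum_distrib_left mult_ac)
  moreover have "pairing Gn L ?y = square G (restr G L)"
    by (auto simp: square_def pairing_def sum_V restr_def intro!: sum.cong)
  ultimately show ?thesis
    by (simp add: c_def power2_eq_square)
qed

text \<open>This is the origin of \<open>gr\<close>: as \<open>2 * A L - r\<close> is the value of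
  \<open>L\<close> on \<Sigma>, its square over \<open>4 * r\<close>, plus \<open>1/4\<close> for
  the additional vertex \<open>v\<close>, is the grading shift.\<close>

lemma hU0_split: "hU0 Gn L = hU0 G (restr G L) + gr r (A L)"
proof -
  have "card V = Suc (card (V - {v}))"
    using card_Suc_Diff1[OF finV v_in] by simp
  moreover have "2 * A L - r = pS L"
    by (simp add: Ahat_def add_divide_distrib)
  ultimately show ?thesis
    using r_neg by (simp add: hU0_def gr_def square_split field_simps)
qed

text \<open>The squares of \<open>2 * i + r\<close> and \<open>2 * i - r\<close> differ by
  \<open>8 * i * r\<close>. The resulting \<open>2 * i\<close> is the shift of the second height in
  \<open>Astar\<close> and in the target of \<open>\<eta>2\<close>.\<close>

lemma gr_add_r: "gr r (i + r) = gr r i + 2 * i"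
  using r_neg by (simp add: gr_def field_simps power2_eq_square)

lemma hU_B:
  assumes "E \<subseteq> V" "v \<notin> E"
  shows "hU Gn (L, E) = hU G (restr G L, E) + gr r (A L)"
proof -
  have "finite (Pow E)" using finite_subset[OF _ finV] assms by auto
  have "(\<lambda>I. hU0 Gn (plus_verts Gn L I)) ` Pow E =
      (\<lambda>I. hU0 G (plus_verts G (restr G L) I) + gr r (A L)) ` Pow E"
  proof (rule image_cong[OF refl])
    fix I assume "I \<in> Pow E"
    then have "v \<notin> I" using assms by blast
    then show "hU0 Gn (plus_verts Gn L I) = hU0 G (plus_verts G (restr G L) I) + gr r (A L)"
      by (simp add: hU0_split restr_plus_verts A_plus_verts)
  qed
  then show ?thesis
    unfolding hU_def fst_conv snd_conv by (simp add: Min_add_commute[OF \<open>finite (Pow E)\<close> Pow_not_empty])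
qed

text \<open>The vertices of the cube lie on its two facets normal to \<open>v\<close>. On the near
  one \<open>Ahat\<close> is unchanged and \<open>hU\<close> appears; on the far one it is larger by
  \<open>r\<close>, which gives \<open>hV\<close> and, through \<open>gr_add_r\<close>, the summand
  \<open>2 * A L\<close>.\<close>

lemma hU_A:
  assumes "E \<subseteq> V" "v \<in> E"
  shows "hU Gn (L, E) = min (hU G (restr G L, E - {v}))
    (hV Gv v (restr G L, E - {v}) + 2 * A L) + gr r (A L)"
proof -
  let ?E = "E - {v}"
  have fin: "finite (Pow ?E)" using finite_subset[OF _ finV] assms by auto
  have E: "?E \<subseteq> V" "v \<notin> ?E" using assms by auto
  have Pow: "Pow E = Pow ?E \<union> insert v ` Pow ?E"
    using assms(2) Pow_insert[of v ?E] by (simp add: insert_absorb)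
  have "hU Gn (L, E) = min (hU Gn (L, ?E)) (hU Gn (plus_verts Gn L {v}, ?E))"
  proof -
    have "(\<lambda>I. hU0 Gn (plus_verts Gn L I)) ` insert v ` Pow ?E =
        (\<lambda>I. hU0 Gn (plus_verts Gn (plus_verts Gn L {v}) I)) ` Pow ?E"
      unfolding image_image
    proof (rule image_cong[OF refl])
      fix I assume "I \<in> Pow ?E"
      then have "{v} \<inter> I = {}" by auto
      then show "hU0 Gn (plus_verts Gn L (insert v I)) = hU0 Gn (plus_verts Gn (plus_verts Gn L {v}) I)"
        by (simp add: plus_verts_Un)
    qed
    then show ?thesis
      unfolding hU_def fst_conv snd_conv Pow image_Un using fin
      by (subst Min_Un) auto
  qed
  also have "hU Gn (plus_verts Gn L {v}, ?E) = hV Gv v (restr G L, ?E) + 2 * A L + gr r (A L)"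
    unfolding hU_B[OF E] by (simp add: hV_def restr_plus_v A_plus_verts gr_add_r)
  finally show ?thesis
    unfolding hU_B[OF E] by (simp add: min_def)
qed


section \<open>Index objects of cubes\<close>

abbreviation X where "X \<equiv> CFKI Gv v"
abbreviation cls where "cls s \<equiv> spinc_class Gv v n s"
abbreviation C where "C s \<equiv> TB_index Gv v n s"
abbreviation T where "T f \<equiv> TB_cube Gv v n f"

lemma X_simps [simp]:
  "idx X = spinc G"
  "conjg X t = neg ` t"
  "addK X t = K ` t"
  "cfk X t = CFK Gv v t"
  "flip X t = cube_map G t (\<lambda>(k, E). (K k, E))"
  "invI X t = cube_map G t (\<lambda>(k, E). (neg (plus_verts G k E), E))"
  "invJ X t = cube_map G t (\<lambda>(k, E). (neg (plus_verts G (K k) E), E))"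
  by (simp_all add: CFKI_def Let_def)

lemma addK_X [simp]: "addK X = (`) K"
  by (rule ext) simp

lemma C_simps [simp]:
  "src (C s) = surg_src" "tgt (C s) = surg_tgt ((`) K) r" "idn (C s) = Idn" "cmp (C s) = surg_cmp"
  by (simp_all add: TB_index_def surg_cat_def Let_def)

lemma Ob_C: "Ob (C s) = {ObA t i |t i. (t, i) \<in> cls s} \<union> {ObB t i |t i. (t, i) \<in> cls s}"
  by (simp add: TB_index_def surg_cat_def Let_def)

lemma Arr_C: "Arr (C s) = Idn ` Ob (C s) \<union> {Lam t i |t i. (t, i) \<in> cls s} \<union> {Rho t i |t i. (t, i) \<in> cls s}"
  by (simp add: TB_index_def surg_cat_def Let_def)

lemma spinc_Char: "s \<in> spinc Gn \<Longrightarrow> L \<in> s \<Longrightarrow> L \<in> Char Gn"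
  using spinc_subset_Char[of Gn s] by auto

definition pair :: "('v \<Rightarrow> int) \<Rightarrow> ('v \<Rightarrow> int) set \<times> rat" where
  "pair L = (orbit G (restr G L), A L)"

lemma cls_eq: "cls s = pair ` s"
  unfolding spinc_class_def pair_def ..

lemma pair_plus_verts:
  "pair (plus_verts Gn L I) = (if v \<in> I then (K ` fst (pair L), snd (pair L) + r) else pair L)"
  by (simp add: pair_def A_plus_verts restr_plus_verts restr_plus_verts_v orbit_plus_verts_image[of G Gv])

text \<open>The index object whose block contains the cube, computed from the cube alone so that no
  Spin^c structure has to be carried along.\<close>

definition dobj :: "'v cube \<Rightarrow> ('v \<Rightarrow> int) set surg_ob" where
  "dobj e = (if v \<in> snd e then ObA else ObB) (fst (pair (fst e))) (snd (pair (fst e)))"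

lemma dobj_eq_ObA: "dobj (L, E) = ObA t i \<longleftrightarrow> v \<in> E \<and> pair L = (t, i)"
  by (auto simp: dobj_def prod_eq_iff)

lemma dobj_eq_ObB: "dobj (L, E) = ObB t i \<longleftrightarrow> v \<notin> E \<and> pair L = (t, i)"
  by (auto simp: dobj_def prod_eq_iff)

lemma dobj_in_Ob: "fst e \<in> s \<Longrightarrow> dobj e \<in> Ob (C s)"
  by (auto simp: dobj_def Ob_C cls_eq)

text \<open>For an index object the first component is an orbit, where membership and equality of
  orbits agree. Thus the blocks are the fibres of \<open>dobj\<close>.\<close>

lemma in_block_iff:
  assumes "d \<in> Ob (C s)"
  shows "in_block Gv v n d e \<longleftrightarrow> dobj e = d"
proof -
  have *: "restr G L \<in> t \<longleftrightarrow> orbit G (restr G L) = t" if "(t, i) \<in> cls s" for t i L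
  proof -
    obtain L0 where "t = orbit G (restr G L0)"
      using \<open>(t, i) \<in> cls s\<close> unfolding cls_eq pair_def by auto
    then show ?thesis by (simp add: mem_orbit_iff)
  qed
  obtain L E where e: "e = (L, E)" by (cases e)
  show ?thesis
  proof (cases d)
    case (ObA t i)
    then have "(t, i) \<in> cls s" using assms by (simp add: Ob_C)
    then show ?thesis
      unfolding e ObA dobj_eq_ObA in_block.simps pair_def prod.inject by (simp add: *)
  next
    case (ObB t i)
    then have "(t, i) \<in> cls s" using assms by (simp add: Ob_C)
    then show ?thesis
      unfolding e ObB dobj_eq_ObB in_block.simps pair_def prod.inject by (simp add: *)
  qed
qed

text \<open>Only the rational coordinate of the target is inspected, since \<open>Lam t i\<close>
  and \<open>Rho t i\<close> end at \<open>i\<close> and \<open>i + r\<close>. The value is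
  meaningful only for objects joined by an arrow; the last clause is a default that is correct for
  equal objects.\<close>

fun arr :: "'s surg_ob \<Rightarrow> 's surg_ob \<Rightarrow> 's surg_arr" where
  "arr (ObA t i) (ObB t' j) = (if j = i then Lam t i else Rho t i)"
| "arr d d' = Idn d"

lemma arr_self [simp]: "arr d d = Idn d"
  by (cases d) simp_all

text \<open>As \<open>r \<noteq> 0\<close>, the index category is thin.\<close>

lemma arr_src_tgt: "arr (surg_src f) (surg_tgt ((`) K) r f) = f"
  using r_neg by (cases f) auto

lemma chain_eq_arr:
  assumes "\<sigma> \<in> chains (C s) m" "i \<le> j" "j \<le> m"
  shows "\<sigma> i j = arr (vtx (C s) \<sigma> i) (vtx (C s) \<sigma> j)"
  using chains_arr(2,3)[OF assms] arr_src_tgt[of "\<sigma> i j"] by simp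

text \<open>If the first arrow is not an identity, it ends at a b-object, so the second one is an
  identity and acts trivially.\<close>

lemma T_cmp: "surg_tgt ((`) K) r f = surg_src g \<Longrightarrow> T (surg_cmp f g) e = T g (T f e)"
  by (cases f; cases g; cases e) auto

lemma cmp_arr:
  "\<lbrakk>f \<in> Arr (C s); g \<in> Arr (C s); surg_tgt ((`) K) r f = surg_src g\<rbrakk> \<Longrightarrow>
    surg_src (surg_cmp f g) = surg_src f \<and>
    surg_tgt ((`) K) r (surg_cmp f g) = surg_tgt ((`) K) r g"
  by (cases f; cases g) auto

lemma T_cubes:
  assumes "s \<in> spinc Gn" "e \<in> cubes Gn s" "dobj e = surg_src f"
  shows "T f e \<in> cubes Gn s" "dobj (T f e) = surg_tgt ((`) K) r f" "face_of Gn e (T f e)"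
proof -
  obtain L E where e: "e = (L, E)" by (cases e)
  have LE: "L \<in> s" "E \<subseteq> V" using assms(2) by (auto simp: e cubes_def)
  show "T f e \<in> cubes Gn s" "dobj (T f e) = surg_tgt ((`) K) r f"
    using assms(3) LE spinc_plus_verts[OF assms(1) LE(1)]
    by (cases f; auto simp: e cubes_def dobj_eq_ObA dobj_eq_ObB pair_plus_verts)+
  have "face_of Gn (L, E) (L, E - {v})"
    unfolding face_of_def by (intro exI[of _ "{}"] exI[of _ "E - {v}"]) auto
  moreover have "face_of Gn (L, E) (plus_verts Gn L {v}, E - {v})" if "v \<in> E"
    unfolding face_of_def by (intro exI[of _ "{v}"] exI[of _ "E - {v}"]) (use that in auto)
  ultimately show "face_of Gn e (T f e)"
    using assms(3) by (cases f) (auto simp: e dobj_eq_ObA)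
qed

lemma T_inj:
  assumes "dobj e = surg_src f" "dobj e' = surg_src f" "T f e = T f e'"
  shows "e = e'"
  using assms
  by (cases f; cases e; cases e') (auto simp: dobj_eq_ObA plus_verts_inj)

text \<open>Within one block \<open>v\<close> cannot be among the translated vertices, as it would
  change \<open>Ahat\<close> by the nonzero \<open>r\<close>, and it is a direction of both cubes or
  of neither.\<close>

lemma face_of_Diff_iff:
  assumes "dobj (L, E) = dobj (L', E')"
  shows "face_of Gn (L, E - {v}) (L', E' - {v}) \<longleftrightarrow> face_of Gn (L, E) (L', E')"
proof
  assume "face_of Gn (L, E - {v}) (L', E' - {v})"
  then obtain I where "I \<subseteq> E - {v}" "E' - {v} \<subseteq> E - {v}" "I \<inter> (E' - {v}) = {}" "L' = plus_verts Gn L I"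
    unfolding face_of_def by auto
  moreover have "v \<in> E' \<longleftrightarrow> v \<in> E" using assms by (auto simp: dobj_def split: if_splits)
  ultimately show "face_of Gn (L, E) (L', E')"
    unfolding face_of_def by (intro exI[of _ I] exI[of _ E']) auto
next
  assume "face_of Gn (L, E) (L', E')"
  then obtain I where I: "I \<subseteq> E" "E' \<subseteq> E" "I \<inter> E' = {}" "L' = plus_verts Gn L I"
    unfolding face_of_def by auto
  have "v \<notin> I"
    using assms I r_neg by (auto simp: dobj_def I(4) pair_plus_verts split: if_splits)
  with I show "face_of Gn (L, E - {v}) (L', E' - {v})"
    unfolding face_of_def by (intro exI[of _ I] exI[of _ "E' - {v}"]) auto
qed

lemma T_face_iff:
  assumes "dobj e = surg_src f" "dobj e' = surg_src f"
  shows "face_of Gn (T f e) (T f e') \<longleftrightarrow> face_of Gn e e'"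
proof -
  obtain L E L' E' where e: "e = (L, E)" "e' = (L', E')" by (cases e; cases e')
  have "face_of Gn (plus_verts Gn L {v}, F) (plus_verts Gn L' {v}, F') \<longleftrightarrow> face_of Gn (L, F) (L', F')" for F F'
    unfolding face_of_def by (auto simp: plus_verts_commute[of Gn Gn L "{v}"] plus_verts_inj)
  then show ?thesis
    using face_of_Diff_iff[of L E L' E'] assms by (cases f) (auto simp: e)
qed

text \<open>A face in another block factors as a face inside the block followed by transport along
  the arrow. The witness is then \<open>e'\<close> with the direction \<open>v\<close> put back and,
  for \<open>Rho\<close>, with the translation by \<open>v\<close> left out.\<close>

lemma face_arr:
  assumes s: "s \<in> spinc Gn" and e: "e \<in> cubes Gn s" "e' \<in> cubes Gn s" and face: "face_of Gn e e'"
  defines "f \<equiv> arr (dobj e) (dobj e')"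
  shows "f \<in> Arr (C s)" "surg_src f = dobj e" "surg_tgt ((`) K) r f = dobj e'"
    "\<exists>c\<in>cubes Gn s. dobj c = dobj e \<and> T f c = e' \<and> face_of Gn e c"
proof -
  obtain L E where LE: "e = (L, E)" "L \<in> s" "E \<subseteq> V"
    using e(1) by (auto simp: cubes_def)
  obtain I E' where I: "I \<subseteq> E" "E' \<subseteq> E" "I \<inter> E' = {}" "e' = (plus_verts Gn L I, E')"
    using face unfolding face_of_def LE by auto
  have cl: "pair L \<in> cls s" unfolding cls_eq using LE by blast
  let ?P = "f \<in> Arr (C s) \<and> surg_src f = dobj e \<and> surg_tgt ((`) K) r f = dobj e' \<and>
    (\<exists>c\<in>cubes Gn s. dobj c = dobj e \<and> T f c = e' \<and> face_of Gn e c)"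
  \<comment> \<open>The fate of \<open>v\<close>: kept as a direction, never a direction, dropped at
    the near facet (\<open>Lam\<close>), dropped at the far facet (\<open>Rho\<close>).\<close>
  consider "v \<in> E'" | "v \<notin> E" | "v \<in> E" "v \<notin> E'" "v \<notin> I" | "v \<in> E" "v \<notin> E'" "v \<in> I"
    using I by blast
  then have ?P
  proof cases
    case 1
    then have "v \<notin> I" "v \<in> E" using I by auto
    then have *: "dobj e' = dobj e" using 1 by (simp add: dobj_def LE I pair_plus_verts)
    then show ?thesis
      using dobj_in_Ob[of e s] LE e(2) face by (auto simp: f_def Arr_C I(4))
  next
    case 2
    then have "v \<notin> I" "v \<notin> E'" using I by auto
    then have *: "dobj e' = dobj e" using 2 by (simp add: dobj_def LE I pair_plus_verts)
    then show ?thesis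
      using dobj_in_Ob[of e s] LE e(2) face by (auto simp: f_def Arr_C I(4))
  next
    case 3
    have f: "f = Lam (fst (pair L)) (snd (pair L))"
      using 3 by (simp add: f_def LE I dobj_def pair_plus_verts)
    let ?c = "(plus_verts Gn L I, insert v E')"
    have "?c \<in> cubes Gn s"
      using LE I 3 spinc_plus_verts[OF s LE(2)] by (auto simp: cubes_def)
    moreover have "dobj ?c = dobj e" "T f ?c = e'"
      using 3 by (simp_all add: dobj_def LE pair_plus_verts f I(4))
    moreover have "face_of Gn e ?c"
      unfolding face_of_def LE using I 3 by (intro exI[of _ I] exI[of _ "insert v E'"]) auto
    moreover have "f \<in> Arr (C s)" "surg_src f = dobj e" "surg_tgt ((`) K) r f = dobj e'"
      using 3 cl by (auto simp: f Arr_C LE I dobj_def pair_plus_verts)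
    ultimately show ?thesis by blast
  next
    case 4
    have f: "f = Rho (fst (pair L)) (snd (pair L))"
      using 4 r_neg by (simp add: f_def LE I dobj_def pair_plus_verts)
    let ?c = "(plus_verts Gn L (I - {v}), insert v E')"
    have "?c \<in> cubes Gn s"
      using LE I 4 spinc_plus_verts[OF s LE(2)] by (auto simp: cubes_def)
    moreover have "dobj ?c = dobj e" "T f ?c = e'"
      using 4 by (simp_all add: dobj_def LE pair_plus_verts f I(4) plus_verts_split[symmetric])
    moreover have "face_of Gn e ?c"
      unfolding face_of_def LE using I 4 by (intro exI[of _ "I - {v}"] exI[of _ "insert v E'"]) auto
    moreover have "f \<in> Arr (C s)" "surg_src f = dobj e" "surg_tgt ((`) K) r f = dobj e'"
      using 4 cl by (auto simp: f Arr_C LE I dobj_def pair_plus_verts)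
    ultimately show ?thesis by blast
  qed
  then show "f \<in> Arr (C s)" "surg_src f = dobj e" "surg_tgt ((`) K) r f = dobj e'"
    "\<exists>c\<in>cubes Gn s. dobj c = dobj e \<and> T f c = e' \<and> face_of Gn e c"
    by blast+
qed


section \<open>The homotopy colimit of the blocks\<close>

abbreviation TBh where "TBh s \<equiv> hocolim_TB Gv v n s"
abbreviation XDh where "XDh s \<equiv> hocolim (C s) (XD r X)"

definition is_TB_cell ::
  "('v \<Rightarrow> int) set \<Rightarrow> nat \<Rightarrow> ('v \<Rightarrow> int) set surg_arr chain \<Rightarrow> (nat \<Rightarrow> 'v cube) \<Rightarrow> bool" where
  "is_TB_cell s m \<sigma> c \<longleftrightarrow> \<sigma> \<in> chains (C s) m \<and> is_cube_chain Gn (cubes Gn s) m c \<and>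
     (\<forall>i\<le>m. dobj (c i) = vtx (C s) \<sigma> 0)"

lemma is_cube_chain_block:
  assumes "d \<in> Ob (C s)"
  shows "is_cube_chain Gn {c \<in> cubes Gn s. in_block Gv v n d c} m c \<longleftrightarrow>
    is_cube_chain Gn (cubes Gn s) m c \<and> (\<forall>i\<le>m. dobj (c i) = d)"
  using in_block_iff[OF assms] by (auto simp: is_cube_chain_def)

lemma cells_TBh:
  "cells (TBh s) m = {(\<sigma>, (cube_chain m c, ())) |\<sigma> c. is_TB_cell s m \<sigma> c}"
proof -
  have "(\<sigma>, \<tau>) \<in> cells (TBh s) m \<longleftrightarrow> (\<exists>c. \<tau> = (cube_chain m c, ()) \<and> is_TB_cell s m \<sigma> c)" for \<sigma> \<tau>
  proof (cases "\<sigma> \<in> chains (C s) m")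
    case True
    have "(\<sigma>, \<tau>) \<in> cells (TBh s) m \<longleftrightarrow>
        fst \<tau> \<in> chains (full_sub (cube_cat Gn s) (in_block Gv v n (vtx (C s) \<sigma> 0))) m"
      using True by (cases \<tau>) (simp add: hocolim_TB_def hocolim_def TB_def Let_def points_def point_def)
    also have "\<dots> \<longleftrightarrow> (\<exists>c. \<tau> = (cube_chain m c, ()) \<and> is_TB_cell s m \<sigma> c)"
      unfolding chains_full_sub_cube_cat is_cube_chain_block[OF chains_ob(1)[OF True le0]]
      using True by (cases \<tau>) (auto simp: is_TB_cell_def)
    finally show ?thesis .
  next
    case False
    then show ?thesis by (auto simp: hocolim_TB_def hocolim_def is_TB_cell_def)
  qed
  then show ?thesis by auto
qed

lemma act_TBh:
  assumes "\<phi> \<in> Delta m k"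
  shows "act (TBh s) m k \<phi> (\<sigma>, (cube_chain k c, u)) =
    (tab m (\<lambda>i j. \<sigma> (\<phi> i) (\<phi> j)), (cube_chain m (\<lambda>i. T (\<sigma> 0 (\<phi> 0)) (c (\<phi> i))), u))"
  using act_cube_chain[OF assms, of c]
  by (simp add: hocolim_TB_def hocolim_def[of "C s"] TB_def Let_def hocolim_points_simps)

lemma ht_TBh: "ht (TBh s) k (\<sigma>, (cube_chain k c, u)) = hU Gn (c 0)"
  by (simp add: hocolim_TB_def hocolim_def[of "C s"] TB_def Let_def hocolim_points_simps)

lemma assemble_chain:
  "assemble Gv v n m (\<sigma>, (cube_chain m c, u)) = (cube_chain m (\<lambda>i. T (\<sigma> 0 i) (c i)), u)"
  unfolding assemble_def cube_chain_def[of m "\<lambda>i. T (\<sigma> 0 i) (c i)"]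
  by (simp, rule tab_cong) simp

text \<open>A face of the assembled chain is the original face carried into the block of index
  \<open>i\<close>, followed by transport along \<open>\<sigma> i j\<close>; both are faces.\<close>

lemma TB_cell_facts:
  assumes s: "s \<in> spinc Gn" and cell: "is_TB_cell s m \<sigma> c" and "i \<le> j" "j \<le> m"
  shows "T (\<sigma> 0 i) (c j) \<in> cubes Gn s" "dobj (T (\<sigma> 0 i) (c j)) = vtx (C s) \<sigma> i"
    "T (\<sigma> 0 j) (c j) = T (\<sigma> i j) (T (\<sigma> 0 i) (c j))"
    "face_of Gn (T (\<sigma> 0 i) (c i)) (T (\<sigma> 0 j) (c j))"
proof -
  have \<sigma>: "\<sigma> \<in> chains (C s) m" and c: "\<And>i. i \<le> m \<Longrightarrow> c i \<in> cubes Gn s \<and> dobj (c i) = vtx (C s) \<sigma> 0"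
    and face: "\<And>i j. i \<le> j \<Longrightarrow> j \<le> m \<Longrightarrow> face_of Gn (c i) (c j)"
    using cell unfolding is_TB_cell_def is_cube_chain_def by auto
  note \<sigma>arr = chains_arr[OF \<sigma>, simplified]
  have i: "i \<le> m" using assms by simp
  show 1: "T (\<sigma> 0 i) (c j) \<in> cubes Gn s" "dobj (T (\<sigma> 0 i) (c j)) = vtx (C s) \<sigma> i"
    using T_cubes[OF s, of "c j" "\<sigma> 0 i"] c[OF assms(4)] \<sigma>arr[OF le0 i] by auto
  have "\<sigma> 0 j = surg_cmp (\<sigma> 0 i) (\<sigma> i j)"
    using chains_cmp[OF \<sigma> le0 assms(3,4)] by simp
  then show 2: "T (\<sigma> 0 j) (c j) = T (\<sigma> i j) (T (\<sigma> 0 i) (c j))"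
    using \<sigma>arr[OF le0 i] \<sigma>arr[OF assms(3,4)] by (simp add: T_cmp)
  have "face_of Gn (T (\<sigma> 0 i) (c i)) (T (\<sigma> 0 i) (c j))"
    using c[OF i] c[OF assms(4)] \<sigma>arr[OF le0 i] face[OF assms(3,4)] by (simp add: T_face_iff)
  moreover have "face_of Gn (T (\<sigma> 0 i) (c j)) (T (\<sigma> 0 j) (c j))"
    unfolding 2 using T_cubes(3)[OF s 1(1), of "\<sigma> i j"] 1(2) \<sigma>arr[OF assms(3,4)] by simp
  ultimately show "face_of Gn (T (\<sigma> 0 i) (c i)) (T (\<sigma> 0 j) (c j))"
    by (rule face_of_trans)
qed

text \<open>For injectivity, the block of each assembled cube names its index and every transport is
  injective on its block. For surjectivity, the delicate point is that cubes pulled back one at a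
  time still form a chain.\<close>

lemma assemble_bij:
  assumes s: "s \<in> spinc Gn"
  shows "bij_betw (assemble Gv v n m) (cells (TBh s) m) (cells (CF Gn s) m)"
  unfolding bij_betw_def
proof
  have cells_CF: "cells (CF Gn s) m = {(cube_chain m e, ()) |e. is_cube_chain Gn (cubes Gn s) m e}"
    by (auto simp: CF_def hocolim_points_simps chains_cube_cat)
  show "inj_on (assemble Gv v n m) (cells (TBh s) m)"
  proof (rule inj_onI)
    fix x y assume "x \<in> cells (TBh s) m" "y \<in> cells (TBh s) m"
      and eq: "assemble Gv v n m x = assemble Gv v n m y"
    then obtain \<sigma> c \<sigma>' c' where
      x: "x = (\<sigma>, (cube_chain m c, ()))" "is_TB_cell s m \<sigma> c" and
      y: "y = (\<sigma>', (cube_chain m c', ()))" "is_TB_cell s m \<sigma>' c'"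
      unfolding cells_TBh by auto
    have Teq: "T (\<sigma> 0 i) (c i) = T (\<sigma>' 0 i) (c' i)" if "i \<le> m" for i
      using eq that unfolding x y assemble_chain by (simp add: cube_chain_eq_iff)
    have \<sigma>: "\<sigma> \<in> chains (C s) m" "\<sigma>' \<in> chains (C s) m"
      using x y by (simp_all add: is_TB_cell_def)
    have v: "vtx (C s) \<sigma> i = vtx (C s) \<sigma>' i" if "i \<le> m" for i
      using TB_cell_facts(2)[OF s x(2) order_refl that] TB_cell_facts(2)[OF s y(2) order_refl that]
        Teq[OF that] by simp
    have \<sigma>\<sigma>': "\<sigma> i j = \<sigma>' i j" if "i \<le> j" "j \<le> m" for i j
      unfolding chain_eq_arr[OF \<sigma>(1) that] chain_eq_arr[OF \<sigma>(2) that] using that by (simp add: v)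
    then have "\<sigma> = \<sigma>'"
      using tab_cong[of m \<sigma> \<sigma>'] \<sigma>[THEN chains_tab] by simp
    moreover have "c i = c' i" if "i \<le> m" for i
    proof (rule T_inj)
      show "T (\<sigma> 0 i) (c i) = T (\<sigma> 0 i) (c' i)"
        using Teq[OF that] \<open>\<sigma> = \<sigma>'\<close> by simp
      show "dobj (c i) = surg_src (\<sigma> 0 i)" "dobj (c' i) = surg_src (\<sigma> 0 i)"
        using chains_arr(2)[OF \<sigma>(1) le0 that] x(2) y(2) that \<open>\<sigma> = \<sigma>'\<close> by (simp_all add: is_TB_cell_def)
    qed
    ultimately show "x = y"
      by (simp add: x y cube_chain_eq_iff)
  qed
  show "assemble Gv v n m ` cells (TBh s) m = cells (CF Gn s) m"
  proof (intro equalityI subsetI)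
    fix y assume "y \<in> assemble Gv v n m ` cells (TBh s) m"
    then obtain \<sigma> c where c: "y = (cube_chain m (\<lambda>i. T (\<sigma> 0 i) (c i)), ())" "is_TB_cell s m \<sigma> c"
      unfolding cells_TBh by (auto simp: assemble_chain)
    have "is_cube_chain Gn (cubes Gn s) m (\<lambda>i. T (\<sigma> 0 i) (c i))"
      unfolding is_cube_chain_def using TB_cell_facts[OF s c(2)] by blast
    then show "y \<in> cells (CF Gn s) m"
      unfolding cells_CF c(1) by blast
  next
    fix y assume "y \<in> cells (CF Gn s) m"
    then obtain e where e: "y = (cube_chain m e, ())" "is_cube_chain Gn (cubes Gn s) m e"
      unfolding cells_CF by blast
    have ecube: "e i \<in> cubes Gn s" if "i \<le> m" for i
      using e(2) that by (simp add: is_cube_chain_def)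
    have eface: "face_of Gn (e i) (e j)" if "i \<le> j" "j \<le> m" for i j
      using e(2) that by (simp add: is_cube_chain_def)
    define a where "a i j = arr (dobj (e i)) (dobj (e j))" for i j
    define \<sigma> where "\<sigma> = tab m a"
    have a: "a i j \<in> Arr (C s)" "surg_src (a i j) = dobj (e i)" "surg_tgt ((`) K) r (a i j) = dobj (e j)"
      if "i \<le> j" "j \<le> m" for i j
      unfolding a_def using face_arr[OF s ecube ecube eface] that by auto
    have acmp: "a i k = surg_cmp (a i j) (a j k)" if "i \<le> j" "j \<le> k" "k \<le> m" for i j k
    proof -
      have "surg_src (surg_cmp (a i j) (a j k)) = dobj (e i)"
        "surg_tgt ((`) K) r (surg_cmp (a i j) (a j k)) = dobj (e k)"
        using cmp_arr[of "a i j" s "a j k"] a that by auto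
      then show ?thesis
        using arr_src_tgt[of "surg_cmp (a i j) (a j k)"] by (simp add: a_def)
    qed
    have aii: "a i i = Idn (dobj (e i))" for i by (simp add: a_def)
    have vtx\<sigma>: "vtx (C s) \<sigma> i = dobj (e i)" if "i \<le> m" for i
      using that by (simp add: \<sigma>_def aii)
    have ob: "dobj (e i) \<in> Ob (C s)" if "i \<le> m" for i
      using ecube[OF that] by (intro dobj_in_Ob) (auto simp: cubes_def)
    have \<sigma>: "\<sigma> \<in> chains (C s) m"
    proof -
      have \<sigma>a: "\<sigma> i j = a i j" if "i \<le> j" "j \<le> m" for i j
        using that by (simp add: \<sigma>_def)
      have "tab m \<sigma> = \<sigma>"
        by (simp add: \<sigma>_def)
      moreover have "\<sigma> i k = cmp (C s) (\<sigma> i j) (\<sigma> j k)" if "i \<le> j" "j \<le> k" "k \<le> m" for i j k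
        using acmp[OF that] that by (simp add: \<sigma>a)
      moreover have "vtx (C s) \<sigma> i \<in> Ob (C s) \<and> \<sigma> i i = idn (C s) (vtx (C s) \<sigma> i)" if "i \<le> m" for i
        using ob[OF that] that by (simp add: \<sigma>a aii vtx\<sigma>)
      moreover have "\<sigma> i j \<in> Arr (C s) \<and> src (C s) (\<sigma> i j) = vtx (C s) \<sigma> i \<and>
          tgt (C s) (\<sigma> i j) = vtx (C s) \<sigma> j" if "i \<le> j" "j \<le> m" for i j
        using a[OF that] that by (simp add: \<sigma>a vtx\<sigma>)
      ultimately show ?thesis
        unfolding chains_def by blast
    qed
    obtain c where c: "c j \<in> cubes Gn s" "dobj (c j) = dobj (e 0)" "T (a 0 j) (c j) = e j"
      if "j \<le> m" for j
      using face_arr(4)[OF s ecube ecube eface] a_def le0 by metis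
    have "face_of Gn (c i) (c j)" if ij: "i \<le> j" "j \<le> m" and i: "i \<le> m" for i j
    proof (cases "\<exists>d. a 0 i = Idn d")
      case True
      then obtain d where Idn: "a 0 i = Idn d" by blast
      have d: "d = dobj (e 0)" "dobj (e i) = dobj (e 0)"
        using a(2,3)[OF le0 i] Idn by auto
      have ei: "e i = c i"
        using c(3)[OF i] Idn by (cases "c i") simp
      \<comment> \<open>Up to stage \<open>i\<close> the index has not moved, so \<open>e j\<close>
        can also be lifted relative to \<open>e i\<close>. This lift is a face of
        \<open>e i\<close>, and injectivity of the transport identifies it with \<open>c j\<close>,
        which was chosen relative to \<open>e 0\<close>.\<close>
      obtain c' where c': "dobj c' = dobj (e 0)" "T (a i j) c' = e j" "face_of Gn (e i) c'"
        using face_arr(4)[OF s ecube[OF i] ecube[OF ij(2)] eface[OF ij], folded a_def]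
        unfolding d(2) by blast
      have aij: "a i j = a 0 j" by (simp only: a_def d)
      have "c' = c j"
      proof (rule T_inj)
        show "dobj c' = surg_src (a 0 j)" "dobj (c j) = surg_src (a 0 j)"
          unfolding c'(1) c(2)[OF ij(2)] a(2)[OF le0 ij(2)] by (rule refl)+
        show "T (a 0 j) c' = T (a 0 j) (c j)"
          unfolding c(3)[OF ij(2)] using c'(2) unfolding aij .
      qed
      then show ?thesis using c'(3) ei by simp
    next
      \<comment> \<open>The target of a non-identity arrow has only its identity leaving it.\<close>
      case False
      then have "a 0 j = a 0 i"
        using acmp[OF le0 ij] by (cases "a 0 i") auto
      then have "face_of Gn (T (a 0 i) (c i)) (T (a 0 i) (c j))"
        using c(3)[OF i] c(3)[OF ij(2)] eface[OF ij] by simp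
      moreover have "dobj (c i) = surg_src (a 0 i)" "dobj (c j) = surg_src (a 0 i)"
        using c(2)[OF i] c(2)[OF ij(2)] a(2)[OF le0 i] by simp_all
      ultimately show ?thesis
        using T_face_iff by blast
    qed
    then have "is_TB_cell s m \<sigma> c"
      unfolding is_TB_cell_def is_cube_chain_def using \<sigma> c vtx\<sigma> by auto
    moreover have "y = assemble Gv v n m (\<sigma>, (cube_chain m c, ()))"
      unfolding assemble_chain e(1) using c by (simp add: cube_chain_eq_iff \<sigma>_def)
    ultimately show "y \<in> assemble Gv v n m ` cells (TBh s) m"
      unfolding cells_TBh by blast
  qed
qed

text \<open>The operator carries the remaining cubes into the block of the new initial index, and
  transport along a single arrow preserves faces.\<close>

lemma TBh_closed:
  assumes s: "s \<in> spinc Gn" and \<phi>: "\<phi> \<in> Delta m k" and "x \<in> cells (TBh s) k"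
  shows "act (TBh s) m k \<phi> x \<in> cells (TBh s) m"
proof -
  obtain \<sigma> c where c: "x = (\<sigma>, (cube_chain k c, ()))" "is_TB_cell s k \<sigma> c"
    using assms(3) unfolding cells_TBh by auto
  have \<sigma>: "\<sigma> \<in> chains (C s) k" using c(2) by (simp add: is_TB_cell_def)
  have "face_of Gn (T (\<sigma> 0 (\<phi> 0)) (c i)) (T (\<sigma> 0 (\<phi> 0)) (c j))" if "i \<le> j" "j \<le> k" for i j
    using c(2) that chains_arr(2)[OF \<sigma> le0 Delta_le[OF \<phi> le0]]
    by (simp add: T_face_iff is_TB_cell_def is_cube_chain_def)
  moreover have "vtx (C s) (tab m (\<lambda>i j. \<sigma> (\<phi> i) (\<phi> j))) 0 = vtx (C s) \<sigma> (\<phi> 0)"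
    by (simp add: vtx_def)
  moreover have "\<phi> 0 \<le> \<phi> i" "\<phi> i \<le> k" if "i \<le> m" for i
    using Delta_le[OF \<phi> that] Delta_mono[OF \<phi> le0 that] by auto
  ultimately have "is_TB_cell s m (tab m (\<lambda>i j. \<sigma> (\<phi> i) (\<phi> j))) (\<lambda>i. T (\<sigma> 0 (\<phi> 0)) (c (\<phi> i)))"
    using chains_act[OF \<sigma> \<phi>] TB_cell_facts(1,2)[OF s c(2)] Delta_mono[OF \<phi>]
    by (auto simp: is_TB_cell_def is_cube_chain_def)
  then show ?thesis
    unfolding c(1) act_TBh[OF \<phi>] cells_TBh by blast
qed

lemma assemble_iso:
  assumes s: "s \<in> spinc Gn"
  shows "fsset_iso (TBh s) (CF Gn s) (assemble Gv v n)"
proof (rule fsset_iso_pull)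
  show "is_fsset (CF Gn s)"
    unfolding CF_def by (rule is_fsset_hocolim_cubes) (simp add: hU_face_mono)
  fix m k \<phi> x assume \<phi>: "\<phi> \<in> Delta m k" and x: "x \<in> cells (TBh s) k"
  then show "act (TBh s) m k \<phi> x \<in> cells (TBh s) m"
    by (rule TBh_closed[OF s])
  obtain \<sigma> c where c: "x = (\<sigma>, (cube_chain k c, ()))" "is_TB_cell s k \<sigma> c"
    using x unfolding cells_TBh by auto
  have "T (\<sigma> (\<phi> 0) (\<phi> i)) (T (\<sigma> 0 (\<phi> 0)) (c (\<phi> i))) = T (\<sigma> 0 (\<phi> i)) (c (\<phi> i))" if "i \<le> m" for i
    using TB_cell_facts(3)[OF s c(2)] Delta_le[OF \<phi> that] Delta_mono[OF \<phi> le0 that] by simp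
  then show "assemble Gv v n m (act (TBh s) m k \<phi> x) = act (CF Gn s) m k \<phi> (assemble Gv v n k x)"
    unfolding c(1) act_TBh[OF \<phi>] assemble_chain CF_def hocolim_points_simps act_cube_chain[OF \<phi>]
    by (simp add: cube_chain_eq_iff)
next
  show "bij_betw (assemble Gv v n k) (cells (TBh s) k) (cells (CF Gn s) k)" for k
    by (rule assemble_bij[OF s])
next
  fix k x assume x: "x \<in> cells (TBh s) k"
  obtain \<sigma> c where c: "x = (\<sigma>, (cube_chain k c, ()))" "is_TB_cell s k \<sigma> c"
    using x unfolding cells_TBh by auto
  \<comment> \<open>Heights are read at the initial cube, which assembling does not move.\<close>
  have "\<sigma> 0 0 = Idn (vtx (C s) \<sigma> 0)"
    using chains_ob(2)[of \<sigma> "C s" k 0] c(2) by (simp add: is_TB_cell_def)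
  then show "ht (CF Gn s) k (assemble Gv v n k x) = ht (TBh s) k x"
    by (cases "c 0") (simp add: c(1) assemble_chain ht_TBh CF_def hocolim_points_simps)
qed


section \<open>Restriction of a block to the cubes of \<open>G\<close>\<close>

definition restr_cube :: "'v cube \<Rightarrow> 'v cube" where
  "restr_cube = (\<lambda>(L, E). (restr G L, E - {v}))"

fun spin :: "'s surg_ob \<Rightarrow> 's" where
  "spin (ObA t i) = t"
| "spin (ObB t i) = t"

lemma face_of_pair:
  "face_of H (k, E) (k', E') \<longleftrightarrow> (\<exists>I. I \<subseteq> E \<and> E' \<subseteq> E \<and> I \<inter> E' = {} \<and> k' = plus_verts H k I)"
  unfolding face_of_def by auto

text \<open>\<open>Ahat\<close> is constant on a block, so a translation between restrictions lifts:
  both candidates are characteristic with equal restriction and equal \<open>Ahat\<close>.\<close>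

lemma restr_cube_face:
  assumes s: "s \<in> spinc Gn" and e: "e \<in> cubes Gn s" "e' \<in> cubes Gn s" and d: "dobj e = dobj e'"
  shows "face_of G (restr_cube e) (restr_cube e') \<longleftrightarrow> face_of Gn e e'"
proof -
  obtain L E L' E' where ee: "e = (L, E)" "e' = (L', E')" by (cases e; cases e')
  have L: "L \<in> Char Gn" "L' \<in> Char Gn"
    using e spinc_Char[OF s] by (auto simp: ee cubes_def)
  have p: "A L = A L'"
    using d by (auto simp: ee dobj_def pair_def split: if_splits)
  have *: "restr G L' = plus_verts G (restr G L) I \<longleftrightarrow> L' = plus_verts Gn L I" if "I \<subseteq> E - {v}" for I
  proof -
    have "v \<notin> I" using that by blast
    show ?thesis
    proof
      assume "restr G L' = plus_verts G (restr G L) I"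
      moreover have "plus_verts Gn L I \<in> Char Gn"
        unfolding plus_verts_def using L(1) by (simp add: Char_plus_class)
      ultimately show "L' = plus_verts Gn L I"
        using L(2) \<open>v \<notin> I\<close> p
        by (intro class_eqI[of L' "plus_verts Gn L I"]) (simp_all add: A_plus_verts restr_plus_verts)
    qed (simp add: restr_plus_verts \<open>v \<notin> I\<close>)
  qed
  have "face_of G (restr_cube e) (restr_cube e') \<longleftrightarrow> face_of Gn (L, E - {v}) (L', E' - {v})"
    unfolding restr_cube_def ee prod.case face_of_pair using * by (simp cong: conj_cong)
  then show ?thesis
    using face_of_Diff_iff[of L E L' E'] d by (simp add: ee)
qed

lemma restr_cube_bij:
  assumes s: "s \<in> spinc Gn" and d: "d \<in> Ob (C s)"
  shows "bij_betw restr_cube {c \<in> cubes Gn s. in_block Gv v n d c} (cubes G (spin d))"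
proof -
  obtain i where "(spin d, i) \<in> cls s" "d = ObA (spin d) i \<or> d = ObB (spin d) i"
    using d by (auto simp: Ob_C)
  then obtain L0 where L0: "L0 \<in> s" "pair L0 = (spin d, i)"
    and d_cases: "d = ObA (spin d) i \<or> d = ObB (spin d) i"
    unfolding cls_eq by auto
  have spin: "spin d = orbit G (restr G L0)" and A0: "A L0 = i"
    using L0 by (simp_all add: pair_def)
  have inj: "inj_on restr_cube {c \<in> cubes Gn s. dobj c = d}"
  proof (rule inj_onI)
    fix e e' assume e: "e \<in> {c \<in> cubes Gn s. dobj c = d}" "e' \<in> {c \<in> cubes Gn s. dobj c = d}"
      and eq: "restr_cube e = restr_cube e'"
    obtain L E L' E' where ee: "e = (L, E)" "e' = (L', E')" by (cases e; cases e')
    have "v \<in> E \<longleftrightarrow> v \<in> E'" "A L = A L'"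
      using e by (auto simp: ee dobj_def pair_def split: if_splits)
    moreover have "restr G L = restr G L'" "E - {v} = E' - {v}"
      using eq by (auto simp: ee restr_cube_def)
    moreover have "L \<in> Char Gn" "L' \<in> Char Gn"
      using e spinc_Char[OF s] by (auto simp: ee cubes_def)
    ultimately show "e = e'"
      using class_eqI[of L L'] by (auto simp: ee)
  qed
  have "restr_cube ` {c \<in> cubes Gn s. dobj c = d} = cubes G (spin d)"
  proof (intro equalityI subsetI)
    fix y assume "y \<in> restr_cube ` {c \<in> cubes Gn s. dobj c = d}"
    then obtain L E where LE: "y = (restr G L, E - {v})" "dobj (L, E) = d" "E \<subseteq> V"
      by (auto simp: restr_cube_def cubes_def)
    have "spin d = orbit G (restr G L)"
      unfolding LE(2)[symmetric] by (simp add: dobj_def pair_def)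
    then have "restr G L \<in> spin d"
      by (simp add: orbit_refl)
    moreover have "E - {v} \<subseteq> V - {v}"
      using LE(3) by blast
    ultimately show "y \<in> cubes G (spin d)"
      unfolding LE(1) by (simp add: cubes_def)
  next
    fix y assume "y \<in> cubes G (spin d)"
    then obtain k E where kE: "y = (k, E)" "k \<in> orbit G (restr G L0)" "E \<subseteq> V - {v}"
      by (auto simp: cubes_def spin)
    obtain L where L: "L \<in> orbit Gn L0" "restr G L = k" "A L = A L0"
      using class_lift[OF kE(2)] by blast
    have Ls: "L \<in> s"
      using L(1) spinc_orbit[OF s L0(1)] by simp
    have pL: "pair L = (spin d, i)"
      using kE(2) by (simp add: pair_def L spin A0 mem_orbit_iff)
    \<comment> \<open>At an a-object the direction \<open>v\<close>, erased by restriction, has to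
      be put back.\<close>
    let ?E = "if d = ObA (spin d) i then insert v E else E"
    have "(L, ?E) \<in> cubes Gn s" "restr_cube (L, ?E) = y"
      using Ls kE v_in L(2) by (auto simp: cubes_def restr_cube_def)
    moreover have "dobj (L, ?E) = d"
      using d_cases kE(3) by (auto simp: dobj_def pL)
    ultimately show "y \<in> restr_cube ` {c \<in> cubes Gn s. dobj c = d}"
      by (intro image_eqI[of _ _ "(L, ?E)"]) simp_all
  qed
  with inj show ?thesis
    unfolding bij_betw_def by (simp add: in_block_iff[OF d])
qed

section \<open>The values of the surgery diagram and the isomorphism \<Phi>\<close>

lemma cells_XD_ob: "cells (XD_ob r X d) m = chains (cube_cat G (spin d)) m \<times> UNIV"
  by (cases d) (simp_all add: raise_def Astar_def p1_def reheight_def CFK_def hocolim_points_simps)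

lemma act_XD_ob:
  "\<phi> \<in> Delta m k \<Longrightarrow> act (XD_ob r X d) m k \<phi> (cube_chain k e, u) = (cube_chain m (\<lambda>i. e (\<phi> i)), u)"
  by (cases d)
    (simp_all add: raise_def Astar_def p1_def reheight_def CFK_def hocolim_points_simps act_cube_chain)

text \<open>At an a-object the minimum in \<open>Astar\<close> is the one over the two facets normal
  to \<open>v\<close>; at a b-object only \<open>hU\<close> occurs. In both cases
  \<open>raise\<close> supplies the grading term.\<close>

lemma ht_XD_ob:
  assumes "E \<subseteq> V" "e 0 = restr_cube (L, E)"
  shows "ht (XD_ob r X (dobj (L, E))) k (cube_chain k e, u) = hU Gn (L, E)"
  using assms hU_A[of E L] hU_B[of E L]
  by (auto simp: dobj_def raise_def Astar_def p1_def reheight_def CFK_def hocolim_points_simps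
      restr_cube_def pair_def)

lemma hocolim_Phi_eq:
  "hocolim_Phi Gv v n s m (\<sigma>, (\<tau>, u)) = (tab m \<sigma>, (tab m (\<lambda>i j. map_prod restr_cube restr_cube (\<tau> i j)), u))"
  by (simp add: hocolim_Phi_def hocolim_map_def Phi_def cube_map_def restr_cube_def)

lemma hocolim_Phi_chain:
  "\<sigma> \<in> chains (C s) m \<Longrightarrow>
    hocolim_Phi Gv v n s m (\<sigma>, (cube_chain m c, u)) = (\<sigma>, (cube_chain m (\<lambda>i. restr_cube (c i)), u))"
  by (simp add: hocolim_Phi_eq tab_map_cube_chain chains_tab)

lemma cells_XDh: "cells (XDh s) m = {(\<sigma>, (\<tau>, u)).
    \<sigma> \<in> chains (C s) m \<and> \<tau> \<in> chains (cube_cat G (spin (vtx (C s) \<sigma> 0))) m}"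
  by (auto simp: hocolim_def XD_def cells_XD_ob)

lemma cells_TBh_eq: "cells (TBh s) m = {(\<sigma>, (\<tau>, u)). \<sigma> \<in> chains (C s) m \<and>
    \<tau> \<in> chains (full_sub (cube_cat Gn s) (in_block Gv v n (vtx (C s) \<sigma> 0))) m}"
  by (auto simp: hocolim_TB_def hocolim_def TB_def Let_def points_def point_def)

lemma act_XDh:
  assumes "\<phi> \<in> Delta m k"
  shows "act (XDh s) m k \<phi> (\<sigma>, (cube_chain k e, u)) =
    (tab m (\<lambda>i j. \<sigma> (\<phi> i) (\<phi> j)), XD_mor X (\<sigma> 0 (\<phi> 0)) m (cube_chain m (\<lambda>i. e (\<phi> i)), u))"
  by (simp add: hocolim_def XD_def act_XD_ob[OF assms])

text \<open>The indices are kept, and all cubes of a cell lie in the block of the initial index, so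
  the bijections of the single blocks combine.\<close>

lemma Phi_bij:
  assumes s: "s \<in> spinc Gn"
  shows "bij_betw (hocolim_Phi Gv v n s m) (cells (TBh s) m) (cells (XDh s) m)"
proof -
  define B where "B d = chains (full_sub (cube_cat Gn s) (in_block Gv v n d)) m" for d
  define B' where "B' d = chains (cube_cat G (spin d)) m" for d :: "('v \<Rightarrow> int) set surg_ob"
  define g where "g \<tau> = tab m (\<lambda>i j. map_prod restr_cube restr_cube (\<tau> i j))" for \<tau>
  have g: "bij_betw g (B d) (B' d)" if d: "d \<in> Ob (C s)" for d
    unfolding g_def B_def B'_def
    by (rule chains_map_bij[OF restr_cube_bij[OF s d]])
      (rule restr_cube_face[OF s], simp_all add: in_block_iff[OF d])
  have Phi: "hocolim_Phi Gv v n s m (\<sigma>, (\<tau>, u)) = (\<sigma>, (g \<tau>, u))" if "\<sigma> \<in> chains (C s) m" for \<sigma> \<tau> u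
    using that by (simp add: hocolim_Phi_eq chains_tab g_def)
  show ?thesis
    unfolding cells_TBh_eq cells_XDh B_def[symmetric] B'_def[symmetric] bij_betw_def
  proof
    show "inj_on (hocolim_Phi Gv v n s m)
        {(\<sigma>, (\<tau>, u)). \<sigma> \<in> chains (C s) m \<and> \<tau> \<in> B (vtx (C s) \<sigma> 0)}"
      by (rule inj_onI) (auto simp: Phi dest: inj_onD[OF bij_betw_imp_inj_on[OF g[OF chains_ob(1)[OF _ le0]]]])
    show "hocolim_Phi Gv v n s m ` {(\<sigma>, (\<tau>, u)). \<sigma> \<in> chains (C s) m \<and> \<tau> \<in> B (vtx (C s) \<sigma> 0)} =
        {(\<sigma>, (\<tau>, u)). \<sigma> \<in> chains (C s) m \<and> \<tau> \<in> B' (vtx (C s) \<sigma> 0)}"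
    proof (intro equalityI subsetI)
      fix y assume "y \<in> hocolim_Phi Gv v n s m ` {(\<sigma>, (\<tau>, u)). \<sigma> \<in> chains (C s) m \<and> \<tau> \<in> B (vtx (C s) \<sigma> 0)}"
      then show "y \<in> {(\<sigma>, (\<tau>, u)). \<sigma> \<in> chains (C s) m \<and> \<tau> \<in> B' (vtx (C s) \<sigma> 0)}"
        using bij_betwE[OF g[OF chains_ob(1)[OF _ le0]]] by (auto simp: Phi)
    next
      fix y assume "y \<in> {(\<sigma>, (\<tau>, u::unit)). \<sigma> \<in> chains (C s) m \<and> \<tau> \<in> B' (vtx (C s) \<sigma> 0)}"
      then obtain \<sigma> \<tau> u where y: "y = (\<sigma>, (\<tau>, u))" "\<sigma> \<in> chains (C s) m" "\<tau> \<in> B' (vtx (C s) \<sigma> 0)"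
        by auto
      then obtain \<tau>' where "\<tau>' \<in> B (vtx (C s) \<sigma> 0)" "\<tau> = g \<tau>'"
        using bij_betw_imp_surj_on[OF g[OF chains_ob(1)[OF y(2) le0]]] by blast
      with y show "y \<in> hocolim_Phi Gv v n s m ` {(\<sigma>, (\<tau>, u)). \<sigma> \<in> chains (C s) m \<and> \<tau> \<in> B (vtx (C s) \<sigma> 0)}"
        using Phi[OF y(2), of \<tau>' u] by (intro image_eqI[of _ _ "(\<sigma>, (\<tau>', u))"]) auto
    qed
  qed
qed

text \<open>Naturality of \<Phi>: \<open>Lam\<close> deletes the direction \<open>v\<close>, which
  restriction forgets anyway, while \<open>Rho\<close> adds \<open>v\<close>, and this restricts to
  the translation in the flip map.\<close>

lemma XD_mor_restr_cube:
  assumes "\<And>i. i \<le> m \<Longrightarrow> dobj (c i) = surg_src f"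
  shows "XD_mor X f m (cube_chain m (\<lambda>i. restr_cube (c i)), u) = (cube_chain m (\<lambda>i. restr_cube (T f (c i))), u)"
proof (cases f)
  case (Idn d)
  then show ?thesis by (auto simp: cube_chain_eq_iff restr_cube_def split: prod.split)
next
  case (Lam t i)
  then show ?thesis by (auto simp: cube_chain_eq_iff restr_cube_def split: prod.split)
next
  case (Rho t i)
  then show ?thesis by (auto simp: cube_chain_eq_iff restr_cube_def restr_plus_v split: prod.split)
qed

lemma Phi_iso:
  assumes s: "s \<in> spinc Gn"
  shows "fsset_iso (TBh s) (XDh s) (hocolim_Phi Gv v n s)"
proof (rule fsset_iso_push)
  show "is_fsset (TBh s)"
    using assemble_iso[OF s] by (simp add: fsset_iso_def)
  show "bij_betw (hocolim_Phi Gv v n s k) (cells (TBh s) k) (cells (XDh s) k)" for k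
    by (rule Phi_bij[OF s])
  fix m k \<phi> x assume \<phi>: "\<phi> \<in> Delta m k" and x: "x \<in> cells (TBh s) k"
  obtain \<sigma> c where c: "x = (\<sigma>, (cube_chain k c, ()))" "is_TB_cell s k \<sigma> c"
    using x unfolding cells_TBh by auto
  have \<sigma>: "\<sigma> \<in> chains (C s) k" using c(2) by (simp add: is_TB_cell_def)
  have src: "dobj (c i) = surg_src (\<sigma> 0 (\<phi> 0))" if "i \<le> k" for i
    using c(2) that chains_arr(2)[OF \<sigma> le0 Delta_le[OF \<phi> le0]] by (simp add: is_TB_cell_def)
  show "hocolim_Phi Gv v n s m (act (TBh s) m k \<phi> x) = act (XDh s) m k \<phi> (hocolim_Phi Gv v n s k x)"
    unfolding c(1) act_TBh[OF \<phi>] hocolim_Phi_chain[OF \<sigma>] hocolim_Phi_chain[OF chains_act[OF \<sigma> \<phi>]]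
      act_XDh[OF \<phi>]
    by (subst XD_mor_restr_cube) (simp_all add: src Delta_le[OF \<phi>])
next
  fix k x assume x: "x \<in> cells (TBh s) k"
  obtain \<sigma> c where c: "x = (\<sigma>, (cube_chain k c, ()))" "is_TB_cell s k \<sigma> c"
    using x unfolding cells_TBh by auto
  obtain L E where LE: "c 0 = (L, E)" by (cases "c 0")
  have "c 0 \<in> cubes Gn s" "vtx (C s) \<sigma> 0 = dobj (c 0)"
    using c(2) by (simp_all add: is_TB_cell_def is_cube_chain_def)
  then have "E \<subseteq> V" "vtx (C s) \<sigma> 0 = dobj (L, E)"
    by (simp_all add: LE cubes_def)
  moreover have "\<sigma> \<in> chains (C s) k" using c(2) by (simp add: is_TB_cell_def)
  ultimately show "ht (XDh s) k (hocolim_Phi Gv v n s k x) = ht (TBh s) k x"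
    by (simp add: c(1) ht_TBh hocolim_Phi_chain hocolim_def[of "C s"] XD_def ht_XD_ob LE)
qed


section \<open>The isomorphism and its compatibility with the involutions\<close>

text \<open>
  \<open>cut_cube e\<^sub>0 e\<close> is the cube of \<open>G\<close> that the face \<open>e\<close> of \<open>e\<^sub>0\<close> has as preimage under the arrow of the
  index category from the object of \<open>e\<^sub>0\<close> to that of \<open>e\<close>; \<open>neg (K (neg k))\<close> is \<open>k - v\<close>.
\<close>

definition cut_cube :: "'v cube \<Rightarrow> 'v cube \<Rightarrow> 'v cube" where
  "cut_cube e0 e = (if A (fst e) = A (fst e0) then restr G (fst e) else neg (K (neg (restr G (fst e)))),
     snd e - {v})"

text \<open>No Spin^c structure enters, so the same formula applies at the source and at the target
  of each involution.\<close>

definition cut_simplex ::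
  "nat \<Rightarrow> 'v cube_simplex \<Rightarrow> ('v \<Rightarrow> int) set surg_arr chain \<times> 'v cube_simplex" where
  "cut_simplex m = (\<lambda>(\<tau>, u). (tab m (\<lambda>i j. arr (dobj (fst (\<tau> i i))) (dobj (fst (\<tau> j j)))),
     (cube_chain m (\<lambda>i. cut_cube (fst (\<tau> 0 0)) (fst (\<tau> i i))), u)))"

lemma cut_simplex_chain:
  "cut_simplex m (cube_chain m e, u) =
    (tab m (\<lambda>i j. arr (dobj (e i)) (dobj (e j))), (cube_chain m (\<lambda>i. cut_cube (e 0) (e i)), u))"
  by (simp add: cut_simplex_def tab_eq_iff cube_chain_eq_iff)

lemma K_neg_K: "neg (K (neg (K k))) = k"
  by (simp add: plus_verts_neg_plus_verts)

text \<open>Transport along \<open>Rho\<close> changes \<open>Ahat\<close> by \<open>r\<close>, and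
  \<open>Lam\<close> and identities leave it fixed. Comparison with the initial cube thus detects
  whether \<open>v\<close> has to be subtracted.\<close>

lemma cut_cube_T:
  assumes "dobj e0 = surg_src f" "dobj c = surg_src f"
  shows "cut_cube e0 (T f c) = restr_cube c"
proof -
  obtain L0 E0 L E where e: "e0 = (L0, E0)" "c = (L, E)" by (cases e0; cases c)
  have "dobj c = dobj e0"
    using assms by simp
  then have "A L = A L0"
    by (auto simp: e dobj_def pair_def split: if_splits)
  then show ?thesis
    using r_neg by (cases f) (simp_all add: e cut_cube_def restr_cube_def A_plus_verts restr_plus_v K_neg_K)
qed

lemma cut_simplex_assemble:
  assumes s: "s \<in> spinc Gn" and x: "x \<in> cells (TBh s) m"
  shows "cut_simplex m (assemble Gv v n m x) = hocolim_Phi Gv v n s m x"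
proof -
  obtain \<sigma> c where c: "x = (\<sigma>, (cube_chain m c, ()))" "is_TB_cell s m \<sigma> c"
    using x unfolding cells_TBh by auto
  have \<sigma>: "\<sigma> \<in> chains (C s) m" and d: "\<And>i. i \<le> m \<Longrightarrow> dobj (c i) = vtx (C s) \<sigma> 0"
    using c(2) by (simp_all add: is_TB_cell_def)
  let ?e = "\<lambda>i. T (\<sigma> 0 i) (c i)"
  have v: "dobj (?e i) = vtx (C s) \<sigma> i" if "i \<le> m" for i
    using TB_cell_facts(2)[OF s c(2) order_refl that] .
  have "tab m (\<lambda>i j. arr (dobj (?e i)) (dobj (?e j))) = tab m \<sigma>"
    using chain_eq_arr[OF \<sigma>] v by (intro tab_cong) simp
  moreover have "cut_cube (?e 0) (?e i) = restr_cube (c i)" if "i \<le> m" for i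
    using chains_arr(2)[OF \<sigma> le0 that] d[OF that] v[of 0] by (intro cut_cube_T) simp_all
  ultimately show ?thesis
    unfolding c(1) assemble_chain cut_simplex_chain hocolim_Phi_chain[OF \<sigma>] chains_tab[OF \<sigma>]
    by (simp add: cube_chain_eq_iff)
qed

section \<open>The involution and the flip map on single cubes\<close>

definition inv_cube :: "'v cube \<Rightarrow> 'v cube" where
  "inv_cube = (\<lambda>(L, E). (neg (plus_verts Gn L E), E))"

definition shift_cube :: "'v cube \<Rightarrow> 'v cube" where
  "shift_cube = (\<lambda>(L, E). (L(v := L v + 2), E))"

lemma pair_neg: "pair (neg L) = (neg ` fst (pair L), r - snd (pair L))"
  by (simp add: pair_def restr_neg orbit_neg A_neg)

lemma pair_shift_cube: "pair (L(v := L v + 2)) = (fst (pair L), snd (pair L) + 1)"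
  by (simp add: pair_def A_upd)

text \<open>Reflection negates the vertex opposite to the base. If \<open>v\<close> is a direction,
  that vertex has \<open>Ahat\<close> equal to \<open>i + r\<close> and gives
  \<open>r - (i + r) = - i\<close>; otherwise it gives \<open>r - i\<close>. This accounts for the
  two clauses of \<open>inv_ob\<close>.\<close>

lemma dobj_inv_cube: "dobj (inv_cube e) = inv_ob r X (dobj e)"
  by (cases e) (simp add: inv_cube_def dobj_def pair_neg pair_plus_verts image_image)

lemma dobj_shift_cube: "dobj (shift_cube e) = succ_ob (dobj e)"
  by (cases e) (simp add: shift_cube_def dobj_def pair_shift_cube)

lemma arr_succ: "arr (succ_ob d) (succ_ob d') = succ_arr (arr d d')"
  by (cases d; cases d') simp_all

text \<open>From a source at \<open>- i\<close>, the end of the reflected \<open>Lam\<close> is at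
  \<open>r - i\<close>, as for \<open>Rho\<close>, and the end of the reflected \<open>Rho\<close>
  is at \<open>- i\<close>, as for \<open>Lam\<close>.\<close>

lemma arr_inv:
  "arr (inv_ob r X (surg_src f)) (inv_ob r X (surg_tgt ((`) K) r f)) = inv_arr r X f"
  using r_neg by (cases f) (auto simp: image_image)

text \<open>If \<open>v\<close> is a direction of the initial cube, reflection exchanges the facets
  normal to \<open>v\<close>: a face cut without translation on one facet is cut with translation by
  \<open>-v\<close> after reflection, and conversely. The \<open>v\<close> in \<open>invJ\<close>
  compensates for this; for faces that keep \<open>v\<close> as a direction it is the summand
  \<open>v\<close> of the reflection itself.\<close>

lemma inv_cover_cut_cube:
  assumes e: "is_cube_chain Gn (cubes Gn s) m e"
  shows "inv_cover X (dobj (e 0)) m (cube_chain m (\<lambda>i. cut_cube (e 0) (e i)), u) =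
    (cube_chain m (\<lambda>i. cut_cube (inv_cube (e 0)) (inv_cube (e i))), u)"
proof -
  obtain L0 E0 where e0: "e 0 = (L0, E0)" by (cases "e 0")
  have *: "cut_cube (inv_cube (e 0)) (inv_cube (e i)) =
      (case cut_cube (e 0) (e i) of (k, E) \<Rightarrow>
        (neg (plus_verts G (if v \<in> E0 then K k else k) E), E))" if i: "i \<le> m" for i
  proof -
    obtain I E where I: "I \<subseteq> E0" "E \<subseteq> E0" "I \<inter> E = {}" "e i = (plus_verts Gn L0 I, E)"
    proof -
      have "face_of Gn (L0, E0) (e i)"
        using e i unfolding e0[symmetric] by (simp add: is_cube_chain_def)
      then show thesis
        using that unfolding face_of_def by auto
    qed
    let ?L = "plus_verts Gn L0 I"
    have A: "A ?L = A L0 + of_bool (v \<in> I) * r"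
      "A (neg (plus_verts Gn ?L E)) = r - (A L0 + of_bool (v \<in> I) * r + of_bool (v \<in> E) * r)"
      "A (neg (plus_verts Gn L0 E0)) = r - (A L0 + of_bool (v \<in> E0) * r)"
      by (simp_all add: A_neg A_plus_verts)
    have KE: "K (plus_verts G k E) = plus_verts G (K k) E" for k
      by (rule plus_verts_commute)
    have R: "restr G (neg (plus_verts Gn ?L E)) =
        neg (if v \<in> E then K (plus_verts G (restr G ?L) E) else plus_verts G (restr G ?L) E)"
      by (simp add: restr_neg restr_plus_verts restr_plus_verts_v)
    \<comment> \<open>These are again the possible fates of \<open>v\<close>: never a direction,
      kept, dropped at the near facet, dropped at the far facet. Only the last two need
      \<open>r\<close> to be nonzero.\<close>
    consider "v \<notin> E0" "v \<notin> I" "v \<notin> E" | "v \<in> E0" "v \<notin> I" "v \<in> E" | "v \<in> E0" "v \<notin> I" "v \<notin> E"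
      | "v \<in> E0" "v \<in> I" "v \<notin> E"
      using I by blast
    then show ?thesis
    proof cases
      case 1
      then show ?thesis
        by (simp add: e0 I(4) inv_cube_def cut_cube_def A R)
    next
      case 2
      then show ?thesis
        by (simp add: e0 I(4) inv_cube_def cut_cube_def A R KE)
    next
      case 3
      then show ?thesis
        using r_neg by (simp add: e0 I(4) inv_cube_def cut_cube_def A R KE)
    next
      case 4
      have "K (neg (K (neg k))) = k" for k
        by (metis K_neg_K neg_neg)
      with 4 show ?thesis
        using r_neg by (simp add: e0 I(4) inv_cube_def cut_cube_def A R KE)
    qed
  qed
  show ?thesis
    by (cases "v \<in> E0") (simp_all add: dobj_def e0 cube_chain_eq_iff *[unfolded e0] split: prod.split)
qed

text \<open>\<open>hocolim_map\<close> consults the index category only for the source of an arrow,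
  which is the same function for every \<open>s'\<close>.\<close>

lemma cut_simplex_inv_cube:
  assumes s: "s \<in> spinc Gn" and e: "is_cube_chain Gn (cubes Gn s) m e"
  shows "hocolim_map (C s') (inv_arr r X) (inv_cover X) m (cut_simplex m (cube_chain m e, u)) =
    cut_simplex m (cube_chain m (\<lambda>i. inv_cube (e i)), u)"
proof -
  have "arr (dobj (inv_cube (e i))) (dobj (inv_cube (e j))) = inv_arr r X (arr (dobj (e i)) (dobj (e j)))"
    if "i \<le> j" "j \<le> m" for i j
  proof -
    have "e i \<in> cubes Gn s" "e j \<in> cubes Gn s" "face_of Gn (e i) (e j)"
      using e that by (auto simp: is_cube_chain_def)
    from face_arr(2,3)[OF s this] show ?thesis
      unfolding dobj_inv_cube using arr_inv[of "arr (dobj (e i)) (dobj (e j))"] by simp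
  qed
  moreover have "vtx (C s') (tab m (\<lambda>i j. arr (dobj (e i)) (dobj (e j)))) 0 = dobj (e 0)"
    by simp
  ultimately show ?thesis
    unfolding cut_simplex_chain hocolim_map_def prod.case
    by (simp add: inv_cover_cut_cube[OF e] tab_eq_iff)
qed

text \<open>Both values of \<open>Ahat\<close> rise by one and both restrictions stay, so the test
  has the same outcome. This matches a flip map that is the identity on underlying simplices and
  moves only the index.\<close>

lemma cut_cube_shift_cube: "cut_cube (shift_cube e0) (shift_cube e) = cut_cube e0 e"
  by (cases e; cases e0) (simp add: cut_cube_def shift_cube_def A_upd)

lemma cut_simplex_shift_cube:
  "hocolim_map (C s') succ_arr (\<lambda>d n x. x) m (cut_simplex m (cube_chain m e, u)) =
    cut_simplex m (cube_chain m (\<lambda>i. shift_cube (e i)), u)"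
  unfolding cut_simplex_chain hocolim_map_def prod.case cut_cube_shift_cube dobj_shift_cube arr_succ
  by (simp add: tab_eq_iff)


section \<open>The dual knot\<close>

context
  fixes u :: 'v
  assumes u: "u \<notin> V"
begin

abbreviation Hu where "Hu \<equiv> attach Gn v u"

lemma del_Hu [simp]: "del_vertex Hu u = Gn"
proof -
  have "{e \<in> insert {v, u} (edges Gv). u \<notin> e} = edges Gv"
    using forest u by (auto simp: forest_def)
  moreover have "wt Gn u = None"
    using u graph_simps(3) by blast
  then have "(wt Gn)(u := None) = wt Gn"
    by (rule fun_upd_idem)
  ultimately show ?thesis
    using u by (simp add: del_vertex_def attach_def give_weight_def)
qed

lemma plus_u: "plus_verts Hu L {u} = L(v := L v + 2)"
proof
  fix w
  have "(\<Sum>x\<in>verts Hu. of_bool (x \<in> {u}) * dot Hu x w) = dot Hu u w"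
    by (subst sum.remove[of _ u]) (simp_all add: attach_def)
  moreover have "dot Hu u w = of_bool (w = v)" if "w \<in> V"
  proof -
    have "{u, w} \<notin> edges Gv"
      using forest u by (auto simp: forest_def)
    then show ?thesis
      using u that by (auto simp: dot_def attach_def give_weight_def doubleton_eq_iff)
  qed
  moreover have "dom (wt Hu) = V"
    by (simp add: attach_def)
  ultimately have "PD Hu (\<lambda>x. of_bool (x \<in> {u})) w = of_bool (w = v)"
    unfolding PD_def using v_in by (cases "w \<in> V") auto
  then show "plus_verts Hu L {u} w = (L(v := L v + 2)) w"
    by (simp add: plus_verts_def plus_class_def)
qed

lemma shift_cube_eq: "shift_cube e = (plus_verts Hu (fst e) {u}, snd e)"
  by (cases e) (simp add: shift_cube_def plus_u)

lemma Hu_simps [simp]: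
  "idx (CFKI Hu u) = spinc Gn"
  "conjg (CFKI Hu u) t = neg ` t"
  "addK (CFKI Hu u) t = (\<lambda>k. plus_verts Hu k {u}) ` t"
  "cfk (CFKI Hu u) t = CFK Hu u t"
  "invI (CFKI Hu u) t = cube_map Gn t inv_cube"
  "invJ (CFKI Hu u) t = cube_map Gn t (\<lambda>e. inv_cube (shift_cube e))"
  by (simp_all add: CFKI_def Let_def inv_cube_def shift_cube_def plus_u case_prod_beta')

lemma CFK_Hu: "CFK Hu u s = hocolim (cube_cat Gn s) (points (\<lambda>c. (hU Gn c, hU Gn (shift_cube c))))"
  by (simp add: CFK_def hV_def shift_cube_eq)

lemma spinc_shift_cube:
  assumes "s \<in> spinc Gn"
  shows "(\<lambda>k. plus_verts Hu k {u}) ` s \<in> spinc Gn"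
proof -
  obtain L where L: "L \<in> Char Gn" "s = orbit Gn L"
    using assms by (auto simp: spinc_def)
  have "L(v := L v + 2) \<in> Char Gn"
  proof -
    have "pairing Gn (L(v := L v + 2)) x = pairing Gn L x + 2 * x v" for x :: "'v \<Rightarrow> int"
      by (simp add: pairing_def sum_V algebra_simps)
    then show ?thesis
      using L(1) v_in unfolding Char_def by auto
  qed
  then have "orbit Gn (plus_verts Hu L {u}) \<in> spinc Gn"
    by (simp add: plus_u orbit_in_spinc)
  then show ?thesis
    unfolding L(2) by (simp add: orbit_plus_verts_image[of Gn Hu])
qed

lemma is_cube_chain_shift_cube:
  assumes "is_cube_chain Gn (cubes Gn s) m e"
  shows "is_cube_chain Gn (cubes Gn ((\<lambda>k. plus_verts Hu k {u}) ` s)) m (\<lambda>i. shift_cube (e i))"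
proof -
  have "shift_cube c \<in> cubes Gn ((\<lambda>k. plus_verts Hu k {u}) ` s)" if "c \<in> cubes Gn s" for c
    using that by (auto simp: shift_cube_eq cubes_def)
  then show ?thesis
    using assms face_of_shift unfolding is_cube_chain_def shift_cube_eq by blast
qed

lemma cells_CFK_Hu: "cells (CFK Hu u s) m = {(cube_chain m e, ()) |e. is_cube_chain Gn (cubes Gn s) m e}"
  by (auto simp: CFK_Hu hocolim_points_simps chains_cube_cat)

abbreviation XKDh where "XKDh s \<equiv> hocolim (C s) (XKD r X)"

lemma XKDh_simps:
  "cells (XKDh s) = cells (XDh s)"
  "act (XKDh s) = act (XDh s)"
  "ht (XKDh s) m (\<sigma>, x) = (ht (XD_ob r X (vtx (C s) \<sigma> 0)) m x,
     ht (XD_ob r X (succ_ob (vtx (C s) \<sigma> 0))) m x)"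
  by (simp_all add: hocolim_def XKD_def XD_def reheight_def)

text \<open>Simplices and operators are those of the singly filtered case, so bijectivity and
  equivariance come from the two isomorphisms out of the colimit of the blocks.\<close>

lemma cut_simplex_iso:
  assumes s: "s \<in> spinc Gn"
  shows "fsset_iso (CFK Hu u s) (XKDh s) cut_simplex"
proof (rule fsset_iso_push)
  have iso: "fsset_iso (CF Gn s) (XDh s) cut_simplex"
    by (rule fsset_iso_factor[OF assemble_iso[OF s] Phi_iso[OF s]]) (rule cut_simplex_assemble[OF s])
  have eq: "cells (CFK Hu u s) = cells (CF Gn s)" "act (CFK Hu u s) = act (CF Gn s)"
    by (simp_all add: CFK_Hu CF_def hocolim_def points_def point_def)
  show "is_fsset (CFK Hu u s)"
    unfolding CFK_Hu
  proof (rule is_fsset_hocolim_cubes)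
    fix c c' assume c: "c \<in> cubes Gn s" "face_of Gn c c'"
    then have "hU Gn c \<le> hU Gn c'"
      by (intro hU_face_mono) simp_all
    moreover have "hU Gn (shift_cube c) \<le> hU Gn (shift_cube c')"
    proof (rule hU_face_mono)
      show "shift_cube c \<in> cubes Gn ((\<lambda>k. plus_verts Hu k {u}) ` s)"
        using c(1) by (auto simp: shift_cube_eq cubes_def)
      show "face_of Gn (shift_cube c) (shift_cube c')"
        unfolding shift_cube_eq by (rule face_of_shift[OF c(2)])
    qed simp
    ultimately show "(hU Gn c, hU Gn (shift_cube c)) \<le> (hU Gn c', hU Gn (shift_cube c'))"
      by simp
  qed
  show "bij_betw (cut_simplex k) (cells (CFK Hu u s) k) (cells (XKDh s) k)" for k
    using iso by (simp add: eq XKDh_simps fsset_iso_def)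
  show "cut_simplex m (act (CFK Hu u s) m k \<phi> x) = act (XKDh s) m k \<phi> (cut_simplex k x)"
    if "\<phi> \<in> Delta m k" "x \<in> cells (CFK Hu u s) k" for m k \<phi> x
    using iso that by (simp add: eq XKDh_simps fsset_iso_def)
  fix k x assume "x \<in> cells (CFK Hu u s) k"
  then obtain e where e: "x = (cube_chain k e, ())" "is_cube_chain Gn (cubes Gn s) k e"
    unfolding cells_CFK_Hu by auto
  obtain L E where LE: "e 0 = (L, E)" by (cases "e 0")
  have "e 0 \<in> cubes Gn s"
    using e(2) by (simp add: is_cube_chain_def)
  then have E: "E \<subseteq> V"
    by (simp add: LE cubes_def)
  let ?x = "(cube_chain k (\<lambda>i. cut_cube (e 0) (e i)), ())"
  \<comment> \<open>The shift changes only the value at \<open>v\<close>, so the cut of the initial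
    cube is also the restriction of the shifted cube, and \<open>ht_XD_ob\<close> applies at the
    successor index too.\<close>
  have cut_cube: "cut_cube (e 0) (e 0) = restr_cube (L, E)" "cut_cube (e 0) (e 0) = restr_cube (shift_cube (L, E))"
    by (simp_all add: cut_cube_def restr_cube_def LE shift_cube_def)
  have "ht (XD_ob r X (dobj (L, E))) k ?x = hU Gn (L, E)"
    by (rule ht_XD_ob[where e = "\<lambda>i. cut_cube (e 0) (e i)", OF E cut_cube(1)])
  moreover have "ht (XD_ob r X (succ_ob (dobj (L, E)))) k ?x = hU Gn (shift_cube (L, E))"
    unfolding dobj_shift_cube[symmetric] using ht_XD_ob[where e = "\<lambda>i. cut_cube (e 0) (e i)", OF E] cut_cube(2) by (simp add: shift_cube_def)
  ultimately show "ht (XKDh s) k (cut_simplex k x) = ht (CFK Hu u s) k x"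
    unfolding e(1) cut_simplex_chain XKDh_simps by (simp add: LE CFK_Hu hocolim_points_simps)
qed

end


section \<open>Spin-c structures of the surgered manifold\<close>

lemma surg_pairs_eq: "surg_pairs Gv v n = pair ` Char Gn"
proof (intro equalityI subsetI)
  fix p assume "p \<in> surg_pairs Gv v n"
  then obtain L where "fst p \<in> spinc G" "L \<in> Char Gn" "restr G L \<in> fst p" "A L = snd p"
    by (auto simp: surg_pairs_def)
  then have "p = pair L"
    using spinc_orbit[of "fst p" G "restr G L"] by (simp add: pair_def prod_eq_iff)
  then show "p \<in> pair ` Char Gn"
    using \<open>L \<in> Char Gn\<close> by blast
next
  fix p assume "p \<in> pair ` Char Gn"
  then show "p \<in> surg_pairs Gv v n"
    using orbit_in_spinc[OF restr_Char] orbit_refl by (auto simp: surg_pairs_def pair_def)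
qed

abbreviation rel where "rel \<equiv> surg_rel ((`) K) r (surg_pairs Gv v n)"

lemma rel_step:
  assumes "L \<in> Char Gn"
  shows "(pair L, pair (plus_verts Gn L {v})) \<in> rel" "(pair (plus_verts Gn L {v}), pair L) \<in> rel"
proof -
  let ?S = "{((t, i), (K ` t, i + r)) |t i. (t, i) \<in> surg_pairs Gv v n}"
  have "pair L \<in> surg_pairs Gv v n"
    using assms by (simp add: surg_pairs_eq)
  then have "(pair L, pair (plus_verts Gn L {v})) \<in> ?S"
    unfolding pair_plus_verts by (cases "pair L") auto
  then show "(pair L, pair (plus_verts Gn L {v})) \<in> rel" "(pair (plus_verts Gn L {v}), pair L) \<in> rel"
    unfolding surg_rel_def Let_def by (meson UnCI converseI r_into_rtrancl)+
qed

lemma rel_trans: "(x, y) \<in> rel \<Longrightarrow> (y, z) \<in> rel \<Longrightarrow> (x, z) \<in> rel"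
  unfolding surg_rel_def Let_def by (rule rtrancl_trans)

text \<open>The coefficient of \<open>v\<close> may be negative, so the induction runs in both
  directions and the downward one uses the reversed step.\<close>

lemma rel_int:
  assumes L: "L \<in> Char Gn"
  shows "(pair L, pair (plus_class Gn L (\<lambda>w. a * of_bool (w = v)))) \<in> rel"
proof (induction a rule: int_induct[where k = 0])
  case base
  show ?case by (simp add: surg_rel_def Let_def)
next
  case (step1 a)
  let ?M = "plus_class Gn L (\<lambda>w. a * of_bool (w = v))"
  have "plus_verts Gn ?M {v} = plus_class Gn L (\<lambda>w. (a + 1) * of_bool (w = v))"
    by (simp add: plus_verts_def plus_class_add algebra_simps)
  then show ?case
    using rel_trans[OF step1(2) rel_step(1)] Char_plus_class[OF _ L] by simp
next
  case (step2 a)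
  let ?M = "plus_class Gn L (\<lambda>w. (a - 1) * of_bool (w = v))"
  have "plus_verts Gn ?M {v} = plus_class Gn L (\<lambda>w. a * of_bool (w = v))"
    by (simp add: plus_verts_def plus_class_add algebra_simps)
  then show ?case
    using rel_trans[OF step2(2)] rel_step(2)[of ?M] Char_plus_class[OF _ L] by simp
qed

text \<open>Translations with coefficient zero at \<open>v\<close> do not change the pair, and
  translation by \<open>v\<close> is the generating step of the relation.\<close>

lemma rel_class:
  assumes L: "L \<in> Char Gn"
  shows "rel `` {pair L} = pair ` orbit Gn L"
proof (intro equalityI subsetI)
  fix p assume "p \<in> rel `` {pair L}"
  then have "(pair L, p) \<in> ({((t, i), (K ` t, i + r)) |t i. (t, i) \<in> surg_pairs Gv v n} \<union>
      {((t, i), (K ` t, i + r)) |t i. (t, i) \<in> surg_pairs Gv v n}\<inverse>)\<^sup>*"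
    unfolding surg_rel_def Let_def by simp
  then show "p \<in> pair ` orbit Gn L"
  proof (induction rule: rtrancl_induct)
    case base
    show ?case using orbit_refl by blast
  next
    case (step y z)
    from step.IH obtain M where M: "M \<in> orbit Gn L" "y = pair M" by blast
    have orb: "plus_class Gn M x \<in> orbit Gn L" for x
      using M(1) by (auto simp: orbit_def plus_class_add)
    from step.hyps(2) consider "z = (K ` fst y, snd y + r)" | "y = (K ` fst z, snd z + r)"
      by auto
    then show ?case
    proof cases
      case 1
      then have "z = pair (plus_verts Gn M {v})"
        by (simp add: pair_plus_verts M(2))
      then show ?thesis using orb by (simp add: plus_verts_def)
    next
      case 2
      \<comment> \<open>A backward step determines \<open>z\<close> only through its translate by
        the knot class and \<open>r\<close>; injectivity of \<open>K\<close> on sets then identifies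
        \<open>z\<close> with the pair of \<open>M - v\<close>.\<close>
      let ?N = "plus_class Gn M (\<lambda>w. - of_bool (w = v))"
      have "M = plus_verts Gn ?N {v}"
        by (simp add: plus_verts_def plus_class_add)
      then have "pair M = (K ` fst (pair ?N), snd (pair ?N) + r)"
        by (metis insertI1 pair_plus_verts)
      then have "K ` fst z = K ` fst (pair ?N)" "snd z = snd (pair ?N)"
        using 2 M(2) by simp_all
      moreover have "inj K"
        by (simp add: inj_def plus_verts_inj)
      ultimately have "z = pair ?N"
        by (simp add: prod_eq_iff inj_image_eq_iff)
      then show ?thesis using orb by blast
    qed
  qed
next
  fix p assume "p \<in> pair ` orbit Gn L"
  then obtain x where p: "p = pair (plus_class Gn L x)"
    unfolding orbit_def by blast
  let ?M = "plus_class Gn L (x(v := 0))"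
  have "pair ?M = pair L"
    by (simp add: pair_def restr_plus_class A_plus_class)
  moreover have "plus_class Gn L x = plus_class Gn ?M (\<lambda>w. x v * of_bool (w = v))"
    unfolding plus_class_add by (rule arg_cong[where f = "plus_class Gn L"]) auto
  ultimately show "p \<in> rel `` {pair L}"
    using rel_int[of ?M "x v"] Char_plus_class[OF _ L] by (simp add: p)
qed

text \<open>For injectivity, a class \<open>L\<close> of one orbit has the pair of some
  \<open>L'\<close> in the other; moving \<open>L'\<close> within its orbit at fixed
  \<open>Ahat\<close> until the restrictions agree yields \<open>L\<close> itself, so the orbits
  meet.\<close>

lemma cls_bij: "bij_betw (spinc_class Gv v n) (spinc Gn) (surg_pairs Gv v n // rel)"
  unfolding bij_betw_def
proof
  show "inj_on (spinc_class Gv v n) (spinc Gn)"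
  proof (rule inj_onI)
    fix s s' assume s: "s \<in> spinc Gn" "s' \<in> spinc Gn" and eq: "cls s = cls s'"
    obtain L where L: "L \<in> s" using s(1) orbit_refl by (auto simp: spinc_def)
    then obtain L' where L': "L' \<in> s'" "pair L = pair L'"
      using eq unfolding cls_eq by blast
    then have "restr G L \<in> orbit G (restr G L')"
      by (simp add: pair_def mem_orbit_iff)
    then obtain M where M: "M \<in> orbit Gn L'" "restr G M = restr G L" "A M = A L'"
      using class_lift by blast
    have "M \<in> s'"
      using M(1) spinc_orbit[OF s(2) L'(1)] by simp
    moreover have "M = L"
    proof (rule class_eqI)
      show "M \<in> Char Gn" "L \<in> Char Gn"
        using spinc_Char s L \<open>M \<in> s'\<close> by blast+
      show "restr G M = restr G L" "A M = A L"
        using M L'(2) by (simp_all add: pair_def)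
    qed
    ultimately show "s = s'"
      using spinc_orbit s L by metis
  qed
  show "spinc_class Gv v n ` spinc Gn = surg_pairs Gv v n // rel"
  proof -
    have "spinc_class Gv v n ` spinc Gn = (\<lambda>L. rel `` {pair L}) ` Char Gn"
      unfolding spinc_def image_image cls_eq by (rule image_cong) (simp_all add: rel_class)
    also have "\<dots> = surg_pairs Gv v n // rel"
      unfolding quotient_def surg_pairs_eq by auto
    finally show ?thesis .
  qed
qed

lemma XKI_simps:
  "idx (XKI r (surg_pairs Gv v n) X) = surg_pairs Gv v n // rel"
  "conjg (XKI r (surg_pairs Gv v n) X) c = (\<lambda>(t, i). (neg ` t, r - i)) ` c"
  "addK (XKI r (surg_pairs Gv v n) X) c = (\<lambda>(t, i). (t, i + 1)) ` c"
  "cfk (XKI r (surg_pairs Gv v n) X) (cls s) = hocolim (C s) (XKD r X)"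
  "invI (XKI r (surg_pairs Gv v n) X) (cls s) = hocolim_map (C s) (inv_arr r X) (inv_cover X)"
  "invJ (XKI r (surg_pairs Gv v n) X) (cls s) =
    (\<lambda>m x. hocolim_map (surg_cat ((`) K) r ((\<lambda>(t, i). (t, i + 1)) ` cls s))
      (inv_arr r X) (inv_cover X) m (hocolim_map (C s) succ_arr (\<lambda>d n x. x) m x))"
  by (simp_all add: XKI_def Let_def TB_index_def)

lemma surgery_iso:
  assumes u: "u \<notin> V"
  shows "cfki_iso (CFKI (attach Gn v u) u) (XKI r (surg_pairs Gv v n) X) (spinc_class Gv v n) (\<lambda>s. cut_simplex)"
  unfolding cfki_iso_def Hu_simps[OF u]
proof (intro conjI ballI allI)
  show "bij_betw (spinc_class Gv v n) (spinc Gn) (idx (XKI r (surg_pairs Gv v n) X))"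
    unfolding XKI_simps by (rule cls_bij)
  fix s assume s: "s \<in> spinc Gn"
  let ?s' = "(\<lambda>k. plus_verts (attach Gn v u) k {u}) ` s"
  show "cls (neg ` s) = conjg (XKI r (surg_pairs Gv v n) X) (cls s)"
    unfolding XKI_simps cls_eq image_image by (simp add: pair_neg case_prod_beta')
  show cls': "cls ?s' = addK (XKI r (surg_pairs Gv v n) X) (cls s)"
    unfolding XKI_simps cls_eq image_image by (simp add: plus_u[OF u] pair_shift_cube case_prod_beta')
  show "fsset_iso (CFK (attach Gn v u) u s) (cfk (XKI r (surg_pairs Gv v n) X) (cls s)) cut_simplex"
    unfolding XKI_simps by (rule cut_simplex_iso[OF u s])
  fix m x assume "x \<in> cells (CFK (attach Gn v u) u s) m"
  then obtain e where e: "x = (cube_chain m e, ())" "is_cube_chain Gn (cubes Gn s) m e"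
    unfolding cells_CFK_Hu[OF u] by auto
  show "cut_simplex m (cube_map Gn s inv_cube m x) = invI (XKI r (surg_pairs Gv v n) X) (cls s) m (cut_simplex m x)"
    unfolding XKI_simps e(1) cut_simplex_inv_cube[OF s e(2)] by simp
  \<comment> \<open>On the surgery side \<open>invJ\<close> passes through the structure translated
    by the dual knot, and its index category is that of the shifted orbit.\<close>
  have C': "surg_cat ((`) K) r ((\<lambda>(t, i). (t, i + 1)) ` cls s) = C ?s'"
    unfolding TB_index_def cls' XKI_simps by simp
  show "cut_simplex m (cube_map Gn s (\<lambda>e. inv_cube (shift_cube e)) m x) =
      invJ (XKI r (surg_pairs Gv v n) X) (cls s) m (cut_simplex m x)"
    unfolding XKI_simps e(1) cut_simplex_shift_cube C' cut_simplex_inv_cube[OF spinc_shift_cube[OF u s] is_cube_chain_shift_cube[OF u e(2)]]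
    by simp
qed

end

text \<open>That \<open>f\<close> extends \<open>hocolim_Phi\<close> means that the two agree on the
  colimit of the blocks once this is identified with the simplicial set of the surgered plumbing by
  \<open>assemble\<close>.\<close>

theorem proposition7p4:
  fixes Gv0 :: "'v wgraph" and v0 u0 :: 'v and n :: int
  assumes "forest Gv0"
    and "v0 \<in> verts Gv0"
    and "dom (wt Gv0) = verts Gv0 - {v0}"
    and "neg_def (give_weight Gv0 v0 n)"
    and "u0 \<notin> verts Gv0"
  shows "\<exists>f.
    (\<forall>s\<in>spinc (give_weight Gv0 v0 n).
       fsset_iso (hocolim_TB Gv0 v0 n s) (CF (give_weight Gv0 v0 n) s) (assemble Gv0 v0 n) \<and>
       fsset_iso (hocolim_TB Gv0 v0 n s)
         (hocolim (TB_index Gv0 v0 n s) (XD (seifert_framing Gv0 v0 n) (CFKI Gv0 v0)))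
         (hocolim_Phi Gv0 v0 n s) \<and>
       (\<forall>m. \<forall>x\<in>cells (hocolim_TB Gv0 v0 n s) m.
          f s m (assemble Gv0 v0 n m x) = hocolim_Phi Gv0 v0 n s m x)) \<and>
    cfki_iso
      (CFKI (attach (give_weight Gv0 v0 n) v0 u0) u0)
      (XKI (seifert_framing Gv0 v0 n) (surg_pairs Gv0 v0 n) (CFKI Gv0 v0))
      (spinc_class Gv0 v0 n)
      f"
proof -
  interpret surgery Gv0 v0 n
    using assms by unfold_locales
  show ?thesis
    using assemble_iso Phi_iso cut_simplex_assemble surgery_iso[OF assms(5)]
    by (intro exI[of _ "\<lambda>s. cut_simplex"]) blast
qed

end
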